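(* Suppose that $E\|X_k^{(g)}\|^4<\infty$ for $g=0,1$, that there is at least one $h$ with $\|\mathcal{R}_h\|_{\mathcal{S}}>0$, and that assumptions (A1)–(A3) below hold. If $$\frac{\sum_{h=0}^{p_n}\Big(W(h)\sum_{j=1}^{d_{h,n}}\lambda_{hj}\Big)}{\sum_{h=0}^{p_n}\Big(W(h)\sum_{i,j=1}^{d_{h,n}}\sigma_{ij}^h\Big)}\to\infty,$$ then for $g\in\{0,1\}$ the misclassification probability of the estimated classifier satisfies $P(\Pi_{1-g}\mid\Pi_g,\{\hat\nu_{h,j}\colon h\ge0,j\ge1\})\overset{p}{\to}0$ as $n\to\infty$. (A1) For each $0\le h\le p_n$, $\mathcal{R}_h(\cdot)=\sum_{j\ge1}\lambda_{hj}\langle\nu_{h,j},\cdot\rangle\nu_{h,j}$ with $\lambda_{h1}>\lambda_{h2}>\cdots$, $\sum_j\lambda_{hj}<\infty$, and there exists $\alpha_h>2$ such that $\lambda_{hj}-\lambda_{h,j+1}\ge c\,j^{-\alpha_h}$ for all $j$, where $c>0$ is a constant not depending on $h$. (A2) $p_n/n\to0$, $d_{h,n}=n^{1/\tau_h}$ for some $\tau_h>0$, and $$\sum_{h=0}^{p_n}W(h)\,n^{(2\alpha_h+1)/\tau_h-1}\to0,\qquad \sum_{h=0}^{p_n}W(h)\,n^{1/\tau_h-1/2}\to0.$$ (A3) For every $h$, $g\in\{0,1\}$ and $q\in\{1,2\}$, $E\|\widehat C^{(h)}_g-C^{(h)}_g\|_{\mathcal{S}}^{2q}\le O((n_g-h)^{-q})$;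 moreover $n_0/n_1\to\eta$ with $\eta\notin\{0,\infty\}$.
   Context: Work in $L^2[0,1]$ with inner product $\langle x,y\rangle=\int_0^1x(t)y(t)\,dt$; $\|\Phi\|_{\mathcal{S}}$ denotes the Hilbert–Schmidt norm of an operator. For each group $g\in\{0,1\}$, $\{X_k^{(g)}\colon k\ge1\}$ is a weakly stationary zero-mean sequence of random functions in $L^2[0,1]$; the training sample of group $g$ is $X_1^{(g)},\dots,X_{n_g}^{(g)}$, with $n=n_0+n_1$. For $h\in\mathbb{N}$: $C_g^{(h)}(\cdot)=E\{X_k^{(g)}\langle X_{k+h}^{(g)},\cdot\rangle\}$, $C_g^{(-h)}(\cdot)=E\{X_{k+h}^{(g)}\langle X_k^{(g)},\cdot\rangle\}$, with estimators $\widehat C_g^{(h)}(\cdot)=(n_g-h)^{-1}\sum_{k=1}^{n_g-h}\langle X^{(g)}_{k+h},\cdot\rangle X^{(g)}_k$ and $\widehat C_g^{(-h)}(\cdot)=(n_g-h)^{-1}\sum_{k=1}^{n_g-h}\langle X^{(g)}_{k},\cdot\rangle X^{(g)}_{k+h}$. Let $\kappa_g^{(h)}=C_g^{(h)}+C_g^{(-h)}$, $\hat\kappa_g^{(h)}=\widehat C_g^{(h)}+\widehat C_g^{(-h)}$, $\mathcal{R}_h=(\kappa_0^{(h)}-\kappa_1^{(h)})^2$ with eigenvalues $\lambda_{hj}$ and orthonormal eigenfunctions $\nu_{h,j}$ (discriminative feature functions), and $\widehat{\mathcal{R}}_h=(\hat\kappa_0^{(h)}-\hat\kappa_1^{(h)})^2$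 with eigenfunctions $\hat\nu_{h,j}$ ordered by decreasing eigenvalue. The maximal lag is $p=p_n$ and the dimensions are $d_h=d_{h,n}$; $W(h)>0$ are weights. Let $Y_1,\dots,Y_{p_n+1}$ be consecutive functions from group $\Pi_g$ (i.e. consecutive elements of a process with the same law as $\{X_k^{(g)}\}$) to be classified, and $\hat\kappa_{y,h}(\cdot)=\frac{1}{p_n+1-h}\sum_{k=1}^{p_n+1-h}(Y_k\langle Y_{k+h},\cdot\rangle+Y_{k+h}\langle Y_k,\cdot\rangle)$. Define $y^h_{ij}=\langle\hat\kappa_{y,h}(\nu_{h,i}),\nu_{h,j}\rangle$ and $\sigma^h_{ij}=E\{y^h_{ij}-\langle\kappa_g^{(h)}(\nu_{h,i}),\nu_{h,j}\rangle\}^2$. The estimated classifier computes, for $g'=0,1$, $\widehat S^h_{g',ij}=\langle\hat\kappa^{(h)}_{g'}(\hat\nu_{h,i}),\hat\nu_{h,j}\rangle$ and $\widehat D_{g'}=\sum_{h=0}^{p_n}W(h)\sum_{i,j=1}^{d_{h,n}}(\widehat S^h_{g',ij}-\langle\hat\kappa_{y,h}(\hat\nu_{h,i}),\hat\nu_{h,j}\rangle)^2$, and assigns $Y_1,\dots,Y_{p_n+1}$ to $\Pi_0$ if $\widehat D_0-\widehat D_1<0$ and to $\Pi_1$ otherwise. $P(\Pi_{1-g}\mid\Pi_g,\{\hat\nu_{h,j}\})$ is the (conditional on the training sample) probability that group-$g$ functions are assigned to $\Pi_{1-g}$. *)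

theory Defs
  imports "HOL-Probability.Probability"
begin

text \<open>The ambient space L2[0,1] is modelled by an abstract separable real Hilbert space 'a.
  Operators are represented as functions 'a => 'a.  Group labels g are the naturals 0 and 1.
  Processes: X g k omega is the k-th function (k >= 1) of group g.\<close>

definition complete_orthonormal :: "'a::real_inner set \<Rightarrow> bool" where
  "complete_orthonormal B \<longleftrightarrow> (\<forall>e\<in>B. norm e = 1) \<and> (\<forall>e\<in>B. \<forall>f\<in>B. e \<noteq> f \<longrightarrow> e \<bullet> f = 0)
     \<and> (\<forall>v. (\<forall>e\<in>B. v \<bullet> e = 0) \<longrightarrow> v = 0)"

definition hs_norm_sq :: "('a::real_inner \<Rightarrow> 'a) \<Rightarrow> ennreal" where
  "hs_norm_sq T = (\<integral>\<^sup>+ e. ennreal ((norm (T e))\<^sup>2) \<partial>count_space (SOME B. complete_orthonormal B))"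

definition weakly_stationary_zm :: "'b measure \<Rightarrow> (nat \<Rightarrow> 'b \<Rightarrow> 'a::{real_inner,complete_space,second_countable_topology}) \<Rightarrow> bool" where
  "weakly_stationary_zm M Xg \<longleftrightarrow>
     (\<forall>k\<ge>1. Xg k \<in> borel_measurable M \<and> integrable M (\<lambda>\<omega>. (norm (Xg k \<omega>))\<^sup>2)
        \<and> integrable M (Xg k) \<and> (\<integral>\<omega>. Xg k \<omega> \<partial>M) = 0) \<and>
     (\<forall>k\<ge>1. \<forall>h u v. (\<integral>\<omega>. (Xg k \<omega> \<bullet> u) * (Xg (k + h) \<omega> \<bullet> v) \<partial>M)
                    = (\<integral>\<omega>. (Xg 1 \<omega> \<bullet> u) * (Xg (1 + h) \<omega> \<bullet> v) \<partial>M))"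

text \<open>C^(h) and C^(-h) (computed at k = 1, which by stationarity is any k).\<close>
definition Cov :: "'b measure \<Rightarrow> (nat \<Rightarrow> 'b \<Rightarrow> 'a::{real_inner,complete_space,second_countable_topology}) \<Rightarrow> nat \<Rightarrow> 'a \<Rightarrow> 'a" where
  "Cov M Xg h v = (\<integral>\<omega>. (Xg (1 + h) \<omega> \<bullet> v) *\<^sub>R Xg 1 \<omega> \<partial>M)"

definition CovRev :: "'b measure \<Rightarrow> (nat \<Rightarrow> 'b \<Rightarrow> 'a::{real_inner,complete_space,second_countable_topology}) \<Rightarrow> nat \<Rightarrow> 'a \<Rightarrow> 'a" where
  "CovRev M Xg h v = (\<integral>\<omega>. (Xg 1 \<omega> \<bullet> v) *\<^sub>R Xg (1 + h) \<omega> \<partial>M)"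

definition kappa :: "'b measure \<Rightarrow> (nat \<Rightarrow> 'b \<Rightarrow> 'a::{real_inner,complete_space,second_countable_topology}) \<Rightarrow> nat \<Rightarrow> 'a \<Rightarrow> 'a" where
  "kappa M Xg h v = Cov M Xg h v + CovRev M Xg h v"

definition Rop :: "'b measure \<Rightarrow> (nat \<Rightarrow> nat \<Rightarrow> 'b \<Rightarrow> 'a::{real_inner,complete_space,second_countable_topology}) \<Rightarrow> nat \<Rightarrow> 'a \<Rightarrow> 'a" where
  "Rop M X h v = (let D = (\<lambda>u. kappa M (X 0) h u - kappa M (X 1) h u) in D (D v))"

definition Chat :: "(nat \<Rightarrow> 'b \<Rightarrow> 'a::real_inner) \<Rightarrow> nat \<Rightarrow> nat \<Rightarrow> 'b \<Rightarrow> 'a \<Rightarrow> 'a" where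
  "Chat Xg m h \<omega> v = (1 / real (m - h)) *\<^sub>R (\<Sum>k = 1..m - h. (Xg (k + h) \<omega> \<bullet> v) *\<^sub>R Xg k \<omega>)"

definition ChatRev :: "(nat \<Rightarrow> 'b \<Rightarrow> 'a::real_inner) \<Rightarrow> nat \<Rightarrow> nat \<Rightarrow> 'b \<Rightarrow> 'a \<Rightarrow> 'a" where
  "ChatRev Xg m h \<omega> v = (1 / real (m - h)) *\<^sub>R (\<Sum>k = 1..m - h. (Xg k \<omega> \<bullet> v) *\<^sub>R Xg (k + h) \<omega>)"

definition kappahat :: "(nat \<Rightarrow> 'b \<Rightarrow> 'a::real_inner) \<Rightarrow> nat \<Rightarrow> nat \<Rightarrow> 'b \<Rightarrow> 'a \<Rightarrow> 'a" where
  "kappahat Xg m h \<omega> v = Chat Xg m h \<omega> v + ChatRev Xg m h \<omega> v"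

text \<open>Estimated R_h at stage n; ns g n is the training sample size n_g of group g.\<close>
definition Rhat :: "(nat \<Rightarrow> nat \<Rightarrow> 'b \<Rightarrow> 'a::real_inner) \<Rightarrow> (nat \<Rightarrow> nat \<Rightarrow> nat) \<Rightarrow> nat \<Rightarrow> nat \<Rightarrow> 'b \<Rightarrow> 'a \<Rightarrow> 'a" where
  "Rhat X ns n h \<omega> v = (let D = (\<lambda>u. kappahat (X 0) (ns 0 n) h \<omega> u - kappahat (X 1) (ns 1 n) h \<omega> u) in D (D v))"

definition spectral_decomp :: "('a::real_inner \<Rightarrow> 'a) \<Rightarrow> (nat \<Rightarrow> real) \<Rightarrow> (nat \<Rightarrow> 'a) \<Rightarrow> bool" where
  "spectral_decomp T lam nu \<longleftrightarrow>
     (\<forall>i\<ge>1. \<forall>j\<ge>1. nu i \<bullet> nu j = (if i = j then 1 else 0)) \<and>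
     (\<forall>v. ((\<lambda>j. (lam j * (nu j \<bullet> v)) *\<^sub>R nu j) has_sum T v) {1..})"

text \<open>Classifier statistic D: K h = kappa-hat_{g'}^(h), Ky h = kappa-hat_{y,h}, nu h i = nu-hat_{h,i}.\<close>
definition classif_stat :: "nat \<Rightarrow> (nat \<Rightarrow> real) \<Rightarrow> (nat \<Rightarrow> nat) \<Rightarrow> (nat \<Rightarrow> nat \<Rightarrow> 'a::real_inner)
    \<Rightarrow> (nat \<Rightarrow> 'a \<Rightarrow> 'a) \<Rightarrow> (nat \<Rightarrow> 'a \<Rightarrow> 'a) \<Rightarrow> real" where
  "classif_stat P W dd nu K Ky =
     (\<Sum>h = 0..P. W h * (\<Sum>i = 1..dd h. \<Sum>j = 1..dd h. (K h (nu h i) \<bullet> nu h j - Ky h (nu h i) \<bullet> nu h j)\<^sup>2))"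

text \<open>Conditional (on the training sample omega) probability that the p n + 1 consecutive test
  functions Y g 1, ..., Y g (p n + 1) of group g are assigned to group 1 - g.\<close>
definition misclass :: "(nat \<Rightarrow> nat \<Rightarrow> 'b \<Rightarrow> 'a::real_inner) \<Rightarrow> 'c measure \<Rightarrow> (nat \<Rightarrow> nat \<Rightarrow> 'c \<Rightarrow> 'a)
    \<Rightarrow> (nat \<Rightarrow> nat \<Rightarrow> nat) \<Rightarrow> (nat \<Rightarrow> nat) \<Rightarrow> (nat \<Rightarrow> nat \<Rightarrow> nat) \<Rightarrow> (nat \<Rightarrow> real)
    \<Rightarrow> (nat \<Rightarrow> nat \<Rightarrow> 'b \<Rightarrow> nat \<Rightarrow> 'a) \<Rightarrow> nat \<Rightarrow> nat \<Rightarrow> 'b \<Rightarrow> real" where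
  "misclass X N Y ns p d W nuhat g n \<omega> =
     measure N {\<eta> \<in> space N.
       (let Dhat = (\<lambda>g'. classif_stat (p n) W (\<lambda>h. d h n) (\<lambda>h. nuhat n h \<omega>)
                           (\<lambda>h. kappahat (X g') (ns g' n) h \<omega>)
                           (\<lambda>h. kappahat (Y g) (p n + 1) h \<eta>))
        in if g = 0 then \<not> (Dhat 0 - Dhat 1 < 0) else Dhat 0 - Dhat 1 < 0)}"

definition sigma_coef :: "'b measure \<Rightarrow> (nat \<Rightarrow> nat \<Rightarrow> 'b \<Rightarrow> 'a::{real_inner,complete_space,second_countable_topology})
    \<Rightarrow> 'c measure \<Rightarrow> (nat \<Rightarrow> nat \<Rightarrow> 'c \<Rightarrow> 'a) \<Rightarrow> nat \<Rightarrow> nat \<Rightarrow> nat \<Rightarrow> (nat \<Rightarrow> 'a) \<Rightarrow> nat \<Rightarrow> nat \<Rightarrow> real" where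
  "sigma_coef M X N Y P g h nuh i j =
     (\<integral>\<eta>. (kappahat (Y g) (P + 1) h \<eta> (nuh i) \<bullet> nuh j - kappa M (X g) h (nuh i) \<bullet> nuh j)\<^sup>2 \<partial>N)"

end

theory Submission
  imports Defs
begin

text \<open>
  Let \<open>D = \<kappa>\<^sub>0 - \<kappa>\<^sub>1\<close> at a given lag, let \<open>\<nu>\<close> be the true and \<open>\<nu>'\<close> the estimated eigenbasis. If the
  test sample is misclassified, the triangle inequality in the weighted Euclidean space of
  coefficient matrices bounds the distance of the two estimated matrices by twice the distance of
  the correct one to the test matrix. The former is close to the signal \<open>\<Sum> W \<lambda>\<close>, because \<open>D\<close> is
  diagonal in the basis \<open>\<nu>\<close>; the latter is close to the test noise, whose mean is \<open>\<Sum> W \<sigma>\<close>. Both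
  approximations replace \<open>\<nu>'\<close> by \<open>\<nu>\<close>, which costs at most the squared operator norm of the matrix
  involved times the squared distance of the two bases; that distance is controlled by Weyl's
  inequality and the spectral gaps, and Markov's inequality with (A3) and (A2) makes it small with
  high probability. Hilbert--Schmidt norms enter only as upper bounds for operator norms.
\<close>

section \<open>Orthonormal bases and the Hilbert--Schmidt norm\<close>

lemma exists_complete_orthonormal: "\<exists>B::'a::real_inner set. complete_orthonormal B"
proof -
  define \<A> :: "'a set set" where
    "\<A> = {B. (\<forall>e\<in>B. norm e = 1) \<and> (\<forall>e\<in>B. \<forall>f\<in>B. e \<noteq> f \<longrightarrow> e \<bullet> f = 0)}"
  have "\<exists>B\<in>\<A>. \<forall>X\<in>\<A>. B \<subseteq> X \<longrightarrow> X = B"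
  proof (rule subset_Zorn')
    fix C assume C: "subset.chain \<A> C"
    have "e \<bullet> f = 0" if ef: "e \<in> \<Union>C" "f \<in> \<Union>C" "e \<noteq> f" for e f
    proof -
      obtain E F where EF: "E \<in> C" "F \<in> C" "e \<in> E" "f \<in> F" using ef by blast
      then have "E \<subseteq> F \<or> F \<subseteq> E" using C by (auto simp: subset.chain_def)
      then obtain G where "G \<in> C" "e \<in> G" "f \<in> G" using EF by blast
      then show ?thesis using C ef(3) by (auto simp: subset.chain_def \<A>_def)
    qed
    moreover have "norm e = 1" if "e \<in> \<Union>C" for e
      using that C by (auto simp: subset.chain_def \<A>_def)
    ultimately show "\<Union>C \<in> \<A>" by (auto simp: \<A>_def)
  qed
  then obtain B where B: "B \<in> \<A>" and max: "\<And>X. X \<in> \<A> \<Longrightarrow> B \<subseteq> X \<Longrightarrow> X = B" by blast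
  have "v = 0" if v: "\<forall>e\<in>B. v \<bullet> e = 0" for v
  proof (rule ccontr)
    assume "v \<noteq> 0"
    then have "insert (sgn v) B \<in> \<A>"
      using B v by (auto simp: \<A>_def norm_sgn sgn_div_norm inner_commute)
    then have "sgn v \<in> B" using max by blast
    with v have "v \<bullet> sgn v = 0" by (rule bspec)
    then show False using \<open>v \<noteq> 0\<close> by (simp add: sgn_div_norm)
  qed
  then have "complete_orthonormal B" using B by (simp add: complete_orthonormal_def \<A>_def)
  then show ?thesis ..
qed

lemma complete_orthonormal_countable:
  fixes B :: "'a::{real_inner,second_countable_topology} set"
  assumes "complete_orthonormal B"
  shows "countable B"
proof -
  have dist: "dist e f \<ge> 1" if "e \<in> B" "f \<in> B" "e \<noteq> f" for e f
  proof -
    have "(dist e f)\<^sup>2 = 2"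
      using assms that by (simp add: complete_orthonormal_def dist_norm power2_norm_eq_inner
        inner_diff inner_commute norm_eq_1)
    then show ?thesis by (smt (verit) power_le_one zero_le_dist)
  qed
  define U where "U e = ball e (1/2::real)" for e :: 'a
  have disj: "U e \<inter> U f = {}" if "e \<in> B" "f \<in> B" "e \<noteq> f" for e f
  proof -
    have False if "x \<in> U e" "x \<in> U f" for x
      using that dist[OF \<open>e \<in> B\<close> \<open>f \<in> B\<close> \<open>e \<noteq> f\<close>] dist_triangle2[of e f x] 
      by (auto simp: U_def dist_commute)
    then show ?thesis by blast
  qed
  have mem: "e \<in> U e" for e by (simp add: U_def)
  have "countable (U ` B)"
  proof (rule countable_disjoint_open_subsets)
    show "open S" if "S \<in> U ` B" for S using that by (auto simp: U_def)
    show "pairwise disjnt (U ` B)" using disj by (force simp: pairwise_def disjnt_def)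
  qed
  moreover have "inj_on U B"
    using disj mem by (metis IntI empty_iff inj_onI)
  ultimately show ?thesis by (rule countable_image_inj_on)
qed

lemma bessel_finite:
  fixes u :: "'i \<Rightarrow> 'a::real_inner"
  assumes "finite F" and on: "\<And>i j. i \<in> F \<Longrightarrow> j \<in> F \<Longrightarrow> u i \<bullet> u j = (if i = j then 1 else 0)"
  shows "(\<Sum>i\<in>F. (u i \<bullet> v)\<^sup>2) \<le> (norm v)\<^sup>2"
    and norm_sum_orthonormal: "(norm (\<Sum>i\<in>F. c i *\<^sub>R u i))\<^sup>2 = (\<Sum>i\<in>F. (c i)\<^sup>2)"
proof -
  have norm: "(norm (\<Sum>i\<in>F. c i *\<^sub>R u i))\<^sup>2 = (\<Sum>i\<in>F. (c i)\<^sup>2)" for c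
  proof -
    have "(norm (\<Sum>i\<in>F. c i *\<^sub>R u i))\<^sup>2 = (\<Sum>i\<in>F. \<Sum>j\<in>F. c i * c j * (u i \<bullet> u j))"
      unfolding power2_norm_eq_inner inner_sum_left
      by (simp add: inner_sum_right mult.assoc mult.left_commute)
    also have "\<dots> = (\<Sum>i\<in>F. \<Sum>j\<in>F. if j = i then c i * c j else 0)"
      by (intro sum.cong refl) (auto simp: on)
    finally show ?thesis using assms(1) by (simp add: power2_eq_square)
  qed
  show "(norm (\<Sum>i\<in>F. c i *\<^sub>R u i))\<^sup>2 = (\<Sum>i\<in>F. (c i)\<^sup>2)" by (rule norm)
  define w where "w = (\<Sum>i\<in>F. (u i \<bullet> v) *\<^sub>R u i)"
  have "0 \<le> (norm (v - w))\<^sup>2" by simp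
  also have "\<dots> = (norm v)\<^sup>2 - 2 * (w \<bullet> v) + (norm w)\<^sup>2"
    by (simp add: power2_norm_eq_inner inner_diff inner_commute)
  also have "w \<bullet> v = (\<Sum>i\<in>F. (u i \<bullet> v)\<^sup>2)"
    by (simp add: w_def inner_sum_left power2_eq_square)
  also have "(norm w)\<^sup>2 = (\<Sum>i\<in>F. (u i \<bullet> v)\<^sup>2)" unfolding w_def by (rule norm)
  finally show "(\<Sum>i\<in>F. (u i \<bullet> v)\<^sup>2) \<le> (norm v)\<^sup>2" by simp
qed

lemma parseval:
  fixes v :: "'a::{real_inner,complete_space,second_countable_topology}"
  assumes B: "complete_orthonormal B"
  shows "(\<integral>\<^sup>+e. ennreal ((e \<bullet> v)\<^sup>2) \<partial>count_space B) = ennreal ((norm v)\<^sup>2)"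
proof -
  have cB: "countable B" by (rule complete_orthonormal_countable[OF B])
  have on: "e \<bullet> f = (if e = f then 1 else 0)" if "e \<in> B" "f \<in> B" for e f
    using B that by (auto simp: complete_orthonormal_def norm_eq_1)
  define F where "F n = {e \<in> B. to_nat_on B e < n}" for n
  have fin: "finite (F n)" for n
    by (rule inj_on_finite[of "to_nat_on B" _ "{..<n}"])
       (auto simp: F_def intro: inj_on_subset[OF inj_on_to_nat_on[OF cB]])
  have FB: "F n \<subseteq> B" for n by (auto simp: F_def)
  have Fmono: "F m \<subseteq> F n" if "m \<le> n" for m n using that by (auto simp: F_def)
  define s where "s n = (\<Sum>e\<in>F n. (e \<bullet> v)\<^sup>2)" for n
  define w where "w n = (\<Sum>e\<in>F n. (e \<bullet> v) *\<^sub>R e)" for n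
  have bes: "(\<Sum>e\<in>G. (e \<bullet> v)\<^sup>2) \<le> (norm v)\<^sup>2" if "finite G" "G \<subseteq> B" for G
    using that bessel_finite(1)[where F=G and u="\<lambda>e. e"] on by (metis subsetD)
  have wd: "(norm (w n - w m))\<^sup>2 = s n - s m" if "m \<le> n" for m n
  proof -
    have "w n - w m = (\<Sum>e\<in>F n - F m. (e \<bullet> v) *\<^sub>R e)"
      unfolding w_def by (rule sum_diff[symmetric]) (auto simp: fin Fmono that)
    then have "(norm (w n - w m))\<^sup>2 = (\<Sum>e\<in>F n - F m. (e \<bullet> v)\<^sup>2)"
      using norm_sum_orthonormal[where F="F n - F m" and u="\<lambda>e. e" and c="\<lambda>e. e \<bullet> v"] fin on FB
      by (metis DiffD1 finite_Diff subsetD)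
    also have "\<dots> = s n - s m" unfolding s_def by (rule sum_diff) (auto simp: fin Fmono that)
    finally show ?thesis .
  qed
  have "incseq s"
    unfolding s_def incseq_def by (auto intro!: sum_mono2 fin Fmono)
  moreover have "s n \<le> (norm v)\<^sup>2" for n unfolding s_def by (rule bes[OF fin FB])
  ultimately have conv: "convergent s"
    by (metis incseq_convergent convergent_def)
  have "Cauchy w"
  proof (rule metric_CauchyI)
    fix r :: real assume r: "r > 0"
    obtain k where k: "\<And>m n. m \<ge> k \<Longrightarrow> n \<ge> k \<Longrightarrow> dist (s m) (s n) < r\<^sup>2"
      using metric_CauchyD[OF convergent_Cauchy[OF conv], of "r\<^sup>2"] r by auto
    have *: "dist (w n) (w m) < r" if "m \<ge> k" "n \<ge> m" for m n
    proof -
      have "(norm (w n - w m))\<^sup>2 < r\<^sup>2" using wd[of m n] k[of n m] that by (auto simp: dist_real_def)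
      then show ?thesis using r by (auto simp: dist_norm intro: power_less_imp_less_base)
    qed
    show "\<exists>k. \<forall>m\<ge>k. \<forall>n\<ge>k. dist (w m) (w n) < r"
      using * by (metis dist_commute linear)
  qed
  then obtain x where x: "w \<longlonglongrightarrow> x" using Cauchy_convergent_iff convergent_def by blast
  have "(v - x) \<bullet> f = 0" if f: "f \<in> B" for f
  proof -
    have "w n \<bullet> f = f \<bullet> v" if "n > to_nat_on B f" for n
    proof -
      have fF: "f \<in> F n" using that f by (auto simp: F_def)
      have "w n \<bullet> f = (\<Sum>e\<in>F n. (e \<bullet> v) * (e \<bullet> f))" by (simp add: w_def inner_sum_left)
      also have "\<dots> = (\<Sum>e\<in>F n. if e = f then e \<bullet> v else 0)"
        using FB f by (intro sum.cong) (auto simp: on subset_iff)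
      finally show ?thesis using fF fin by simp
    qed
    then have "(\<lambda>n. w n \<bullet> f) \<longlonglongrightarrow> f \<bullet> v"
      by (intro tendsto_eventually) (auto simp: eventually_at_top_dense)
    moreover have "(\<lambda>n. w n \<bullet> f) \<longlonglongrightarrow> x \<bullet> f" by (intro tendsto_intros x)
    ultimately show ?thesis using LIMSEQ_unique by (auto simp: inner_diff inner_commute)
  qed
  then have "x = v" using B unfolding complete_orthonormal_def by (metis right_minus_eq)
  then have "(\<lambda>n. (norm (w n))\<^sup>2) \<longlonglongrightarrow> (norm v)\<^sup>2" using x by (intro tendsto_intros) auto
  moreover have "(norm (w n))\<^sup>2 = s n" for n
    using wd[of 0 n] by (simp add: w_def s_def F_def)
  ultimately have "s \<longlonglongrightarrow> (norm v)\<^sup>2" by simp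
  then have lim: "(\<lambda>n. ennreal (s n)) \<longlonglongrightarrow> ennreal ((norm v)\<^sup>2)" by simp
  let ?I = "\<integral>\<^sup>+e. ennreal ((e \<bullet> v)\<^sup>2) \<partial>count_space B"
  have fin_I: "(\<integral>\<^sup>+e. ennreal ((e \<bullet> v)\<^sup>2) \<partial>count_space G) = ennreal (\<Sum>e\<in>G. (e \<bullet> v)\<^sup>2)" if "finite G" for G
    using that by (simp add: nn_integral_count_space_finite)
  have "ennreal (s n) \<le> ?I" for n
    unfolding s_def fin_I[OF fin, symmetric]
    using FB[of n] by (subst (1 2) nn_integral_count_space_indicator)
       (auto intro!: nn_integral_mono simp: indicator_def)
  then have "ennreal ((norm v)\<^sup>2) \<le> ?I" by (intro LIMSEQ_le_const2[OF lim]) auto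
  moreover have "?I \<le> ennreal ((norm v)\<^sup>2)"
  proof -
    have "incseq (\<lambda>n. \<lambda>e. ennreal ((e \<bullet> v)\<^sup>2) * indicator (F n) e)"
      using Fmono by (auto simp: incseq_def le_fun_def indicator_def)
    then have "(\<integral>\<^sup>+e. (SUP n. ennreal ((e \<bullet> v)\<^sup>2) * indicator (F n) e) \<partial>count_space B)
        = (SUP n. \<integral>\<^sup>+e. ennreal ((e \<bullet> v)\<^sup>2) * indicator (F n) e \<partial>count_space B)"
      by (rule nn_integral_monotone_convergence_SUP) auto
    also have "\<dots> \<le> ennreal ((norm v)\<^sup>2)"
    proof (rule SUP_least)
      fix n
      have "(\<integral>\<^sup>+e. ennreal ((e \<bullet> v)\<^sup>2) * indicator (F n) e \<partial>count_space B)
          = (\<integral>\<^sup>+e. ennreal ((e \<bullet> v)\<^sup>2) \<partial>count_space (F n))"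
        using FB[of n] by (subst (1 2) nn_integral_count_space_indicator)
          (auto intro!: nn_integral_cong simp: indicator_def)
      then show "(\<integral>\<^sup>+e. ennreal ((e \<bullet> v)\<^sup>2) * indicator (F n) e \<partial>count_space B) \<le> ennreal ((norm v)\<^sup>2)"
        using bes[OF fin FB, of n] by (simp add: fin_I[OF fin] ennreal_leI)
    qed
    also have "(\<integral>\<^sup>+e. (SUP n. ennreal ((e \<bullet> v)\<^sup>2) * indicator (F n) e) \<partial>count_space B) = ?I"
    proof (intro nn_integral_cong antisym SUP_least)
      fix e assume "e \<in> space (count_space B)"
      then have "e \<in> F (Suc (to_nat_on B e))" by (auto simp: F_def)
      then show "ennreal ((e \<bullet> v)\<^sup>2) \<le> (SUP n. ennreal ((e \<bullet> v)\<^sup>2) * indicator (F n) e)"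
        by (intro SUP_upper2[of "Suc (to_nat_on B e)"]) auto
    qed (auto simp: indicator_def)
    finally show ?thesis .
  qed
  ultimately show ?thesis by simp
qed

definition some_basis :: "'a::real_inner set" where
  "some_basis = (SOME B. complete_orthonormal B)"

lemma complete_orthonormal_some_basis: "complete_orthonormal some_basis"
  unfolding some_basis_def using exists_complete_orthonormal by (rule someI_ex)

lemma countable_some_basis: "countable (some_basis :: 'a::{real_inner,second_countable_topology} set)"
  by (rule complete_orthonormal_countable[OF complete_orthonormal_some_basis])

lemma hs_norm_sq_some_basis:
  "hs_norm_sq T = (\<integral>\<^sup>+e. ennreal ((norm (T e))\<^sup>2) \<partial>count_space some_basis)"
  by (simp add: hs_norm_sq_def some_basis_def)

lemma hs_norm_sq_adjoint:
  fixes T :: "'a::{real_inner,complete_space,second_countable_topology} \<Rightarrow> 'a"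
  assumes adj: "\<And>v w. T v \<bullet> w = v \<bullet> S w"
  shows "hs_norm_sq S = hs_norm_sq T"
proof -
  note p = parseval[OF complete_orthonormal_some_basis, symmetric]
  have "hs_norm_sq S = (\<integral>\<^sup>+f. \<integral>\<^sup>+e. ennreal ((e \<bullet> S f)\<^sup>2) \<partial>count_space some_basis \<partial>count_space some_basis)"
    unfolding hs_norm_sq_some_basis p ..
  also have "\<dots> = (\<integral>\<^sup>+e. \<integral>\<^sup>+f. ennreal ((e \<bullet> S f)\<^sup>2) \<partial>count_space some_basis \<partial>count_space some_basis)"
    by (rule nn_integral_count_space_nn_integral[OF countable_some_basis]) auto
  also have "\<dots> = hs_norm_sq T"
    unfolding hs_norm_sq_some_basis p by (simp add: adj[symmetric] inner_commute)
  finally show ?thesis .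
qed

lemma norm_sq_le_hs_norm_sq:
  fixes T :: "'a::{real_inner,complete_space,second_countable_topology} \<Rightarrow> 'a"
  assumes adj: "\<And>v w. T v \<bullet> w = v \<bullet> S w"
  shows "ennreal ((norm (T v))\<^sup>2) \<le> ennreal ((norm v)\<^sup>2) * hs_norm_sq T"
proof -
  have "ennreal ((norm (T v))\<^sup>2) = (\<integral>\<^sup>+f. ennreal ((f \<bullet> T v)\<^sup>2) \<partial>count_space some_basis)"
    by (rule parseval[OF complete_orthonormal_some_basis, symmetric])
  also have "\<dots> \<le> (\<integral>\<^sup>+f. ennreal ((norm v)\<^sup>2) * ennreal ((norm (S f))\<^sup>2) \<partial>count_space some_basis)"
  proof (intro nn_integral_mono)
    fix f :: 'a
    have "(f \<bullet> T v)\<^sup>2 \<le> (norm v * norm (S f))\<^sup>2"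
      using Cauchy_Schwarz_ineq2[of v "S f"] by (subst inner_commute) (simp add: adj abs_le_square_iff[symmetric])
    then show "ennreal ((f \<bullet> T v)\<^sup>2) \<le> ennreal ((norm v)\<^sup>2) * ennreal ((norm (S f))\<^sup>2)"
      by (simp add: ennreal_mult[symmetric] power_mult_distrib ennreal_leI)
  qed
  also have "\<dots> = ennreal ((norm v)\<^sup>2) * hs_norm_sq S"
    unfolding hs_norm_sq_some_basis by (simp add: nn_integral_cmult)
  finally show ?thesis by (simp add: hs_norm_sq_adjoint[OF adj])
qed

lemma measurable_hs_norm_sq:
  fixes T :: "'b \<Rightarrow> 'a::{real_inner,complete_space,second_countable_topology} \<Rightarrow> 'a"
  assumes [measurable]: "\<And>v. (\<lambda>\<omega>. T \<omega> v) \<in> borel_measurable M"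
  shows "(\<lambda>\<omega>. hs_norm_sq (T \<omega>)) \<in> borel_measurable M"
proof -
  interpret sigma_finite_measure "count_space (some_basis :: 'a set)"
    by (rule sigma_finite_measure_count_space_countable[OF countable_some_basis])
  have "(\<lambda>(e, \<omega>). ennreal ((norm (T \<omega> e))\<^sup>2)) \<in> borel_measurable (count_space some_basis \<Otimes>\<^sub>M M)"
    by (rule measurable_pair_measure_countable1[OF countable_some_basis]) simp
  from measurable_compose[OF measurable_pair_swap' this]
  have "(\<lambda>(\<omega>, e). ennreal ((norm (T \<omega> e))\<^sup>2)) \<in> borel_measurable (M \<Otimes>\<^sub>M count_space some_basis)"
    by (simp add: case_prod_beta')
  then show ?thesis unfolding hs_norm_sq_some_basis by (rule borel_measurable_nn_integral)
qed

lemma underdetermined_system_solvable: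
  fixes A :: "'i \<Rightarrow> 'l \<Rightarrow> real"
  assumes "finite L" "finite I" "card L < card I"
  shows "\<exists>c. (\<exists>i\<in>I. c i \<noteq> 0) \<and> (\<forall>l\<in>L. (\<Sum>i\<in>I. c i * A i l) = 0)"
  using assms
proof (induction L arbitrary: I A rule: finite_induct)
  case empty
  then have "I \<noteq> {}" by auto
  then show ?case by (intro exI[of _ "\<lambda>_. 1"]) auto
next
  case (insert l0 L)
  show ?case
  proof (cases "\<forall>i\<in>I. A i l0 = 0")
    case True
    have "card L < card I" using insert by simp
    then show ?thesis using insert.IH[of I A] True insert.prems by auto
  next
    case False
    then obtain i0 where i0: "i0 \<in> I" "A i0 l0 \<noteq> 0" by blast
    define A' where "A' i l = A i l - A i l0 / A i0 l0 * A i0 l" for i l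
    have "card L < card (I - {i0})" using insert i0 by simp
    then obtain c where c: "\<exists>i\<in>I - {i0}. c i \<noteq> 0" "\<forall>l\<in>L. (\<Sum>i\<in>I - {i0}. c i * A' i l) = 0"
      using insert.IH[of "I - {i0}" A'] insert.prems by auto
    define x where "x = - (\<Sum>i\<in>I - {i0}. c i * A i l0 / A i0 l0)"
    define c' where "c' = c(i0 := x)"
    have eq: "(\<Sum>i\<in>I. c' i * A i l) = (\<Sum>i\<in>I - {i0}. c i * A' i l)" for l
    proof -
      have "(\<Sum>i\<in>I. c' i * A i l) = x * A i0 l + (\<Sum>i\<in>I - {i0}. c i * A i l)"
        using insert.prems i0 by (simp add: sum.remove[of I i0] c'_def)
      then show ?thesis
        by (simp add: A'_def x_def sum_subtractf algebra_simps sum_distrib_left sum_distrib_right)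
    qed
    have "(\<Sum>i\<in>I. c' i * A i l0) = 0" unfolding eq using i0 by (simp add: A'_def)
    then have "\<forall>l\<in>insert l0 L. (\<Sum>i\<in>I. c' i * A i l) = 0" using c(2) eq by auto
    moreover have "\<exists>i\<in>I. c' i \<noteq> 0" using c(1) by (auto simp: c'_def)
    ultimately show ?thesis by blast
  qed
qed

section \<open>Spectral perturbation\<close>

definition self_adjoint :: "('a::real_inner \<Rightarrow> 'a) \<Rightarrow> bool" where
  "self_adjoint T \<longleftrightarrow> (\<forall>v w. T v \<bullet> w = v \<bullet> T w)"

lemma self_adjointD: "self_adjoint T \<Longrightarrow> T v \<bullet> w = v \<bullet> T w"
  by (simp add: self_adjoint_def)

lemma inner_eqI: "(\<And>w. x \<bullet> w = y \<bullet> w) \<Longrightarrow> x = (y::'a::real_inner)"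
  by (metis inner_diff_left inner_eq_zero_iff right_minus_eq)

lemma self_adjoint_diff:
  assumes "self_adjoint T" shows "T (x - y) = T x - T y"
  by (rule inner_eqI) (simp add: self_adjointD[OF assms] inner_diff_left)

lemma self_adjoint_scaleR:
  assumes "self_adjoint T" shows "T (a *\<^sub>R x) = a *\<^sub>R T x"
  by (rule inner_eqI) (simp add: self_adjointD[OF assms])

lemma spectral_orthonormal:
  "spectral_decomp T lam nu \<Longrightarrow> 1 \<le> i \<Longrightarrow> 1 \<le> j \<Longrightarrow> nu i \<bullet> nu j = (if i = j then 1 else 0)"
  by (simp add: spectral_decomp_def)

lemma spectral_inner:
  assumes "spectral_decomp T lam nu"
  shows "((\<lambda>j. lam j * (nu j \<bullet> v) * (nu j \<bullet> w)) has_sum (T v \<bullet> w)) {1..}"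
proof -
  have "((\<lambda>j. (lam j * (nu j \<bullet> v)) *\<^sub>R nu j) has_sum T v) {1..}"
    using assms by (simp add: spectral_decomp_def)
  from has_sum_bounded_linear[OF bounded_linear_inner_left this, of w]
  show ?thesis by simp
qed

lemma spectral_inner_eigenvector:
  assumes "spectral_decomp T lam nu" "1 \<le> i"
  shows "T v \<bullet> nu i = lam i * (nu i \<bullet> v)"
proof -
  have "((\<lambda>j. lam j * (nu j \<bullet> v) * (nu j \<bullet> nu i)) has_sum (lam i * (nu i \<bullet> v))) {1..}"
    by (rule has_sum_finite_neutralI[of "{i}"])
       (use assms in \<open>auto simp: spectral_orthonormal[OF assms(1)]\<close>)
  then show ?thesis using spectral_inner[OF assms(1), of v "nu i"] has_sum_unique by blast
qed

lemma spectral_eigenvector: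
  assumes "spectral_decomp T lam nu" "1 \<le> i"
  shows "T (nu i) = lam i *\<^sub>R nu i"
proof (rule inner_eqI)
  fix w
  have "((\<lambda>j. lam j * (nu j \<bullet> nu i) * (nu j \<bullet> w)) has_sum (lam i * (nu i \<bullet> w))) {1..}"
    by (rule has_sum_finite_neutralI[of "{i}"])
       (use assms in \<open>auto simp: spectral_orthonormal[OF assms(1)]\<close>)
  then show "T (nu i) \<bullet> w = lam i *\<^sub>R nu i \<bullet> w"
    using spectral_inner[OF assms(1), of "nu i" w] has_sum_unique by fastforce
qed

lemma has_sum_ge_of_finite_supersets:
  fixes f :: "'i \<Rightarrow> real"
  assumes "(f has_sum S) A" "finite G" "G \<subseteq> A"
    and "\<And>F. finite F \<Longrightarrow> G \<subseteq> F \<Longrightarrow> F \<subseteq> A \<Longrightarrow> c \<le> sum f F"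
  shows "c \<le> S"
proof (rule tendsto_lowerbound)
  show "(sum f \<longlongrightarrow> S) (finite_subsets_at_top A)" using assms(1) by (simp add: has_sum_def)
  show "\<forall>\<^sub>F F in finite_subsets_at_top A. c \<le> sum f F"
    unfolding eventually_finite_subsets_at_top using assms(2-4) by blast
qed simp

lemma spectral_form_le_orthogonal:
  fixes T :: "'a::real_inner \<Rightarrow> 'a"
  assumes sd: "spectral_decomp T lam nu" and dec: "\<And>i. i \<ge> j \<Longrightarrow> lam i \<le> lam j" and nn: "0 \<le> lam j" and "1 \<le> j"
    and orth: "\<And>i. 1 \<le> i \<Longrightarrow> i < j \<Longrightarrow> nu i \<bullet> v = 0"
  shows "T v \<bullet> v \<le> lam j * (norm v)\<^sup>2"
proof -
  have "- (lam j * (norm v)\<^sup>2) \<le> - (T v \<bullet> v)"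
  proof (rule has_sum_ge_of_finite_supersets[where G="{}"])
    show "((\<lambda>i. - (lam i * (nu i \<bullet> v) * (nu i \<bullet> v))) has_sum - (T v \<bullet> v)) {1..}"
      using spectral_inner[OF sd, of v v] by (simp add: has_sum_uminus)
    fix F :: "nat set" assume F: "finite F" "F \<subseteq> {1..}"
    have "(\<Sum>i\<in>F. lam i * (nu i \<bullet> v) * (nu i \<bullet> v)) \<le> (\<Sum>i\<in>F. lam j * (nu i \<bullet> v)\<^sup>2)"
    proof (rule sum_mono)
      fix i assume "i \<in> F"
      then have i: "1 \<le> i" using F by auto
      show "lam i * (nu i \<bullet> v) * (nu i \<bullet> v) \<le> lam j * (nu i \<bullet> v)\<^sup>2"
      proof (cases "i < j")
        case True then show ?thesis using orth i by simp
      next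
        case False then show ?thesis using dec[of i]
          by (simp add: power2_eq_square mult.assoc mult_right_mono)
      qed
    qed
    also have "\<dots> = lam j * (\<Sum>i\<in>F. (nu i \<bullet> v)\<^sup>2)" by (simp add: sum_distrib_left)
    also have "\<dots> \<le> lam j * (norm v)\<^sup>2"
      by (rule mult_left_mono[OF bessel_finite(1) nn]) (use F in \<open>auto simp: spectral_orthonormal[OF sd] subset_iff\<close>)
    finally show "- (lam j * (norm v)\<^sup>2) \<le> (\<Sum>i\<in>F. - (lam i * (nu i \<bullet> v) * (nu i \<bullet> v)))"
      by (simp add: sum_negf)
  qed auto
  then show ?thesis by simp
qed

text \<open>Weyl's inequality: the span of the first \<open>j\<close> eigenvectors of one operator contains a vector
  orthogonal to the first \<open>j - 1\<close> eigenvectors of the other.\<close>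

lemma weyl_eigenvalue_le:
  fixes T S :: "'a::real_inner \<Rightarrow> 'a"
  assumes sdT: "spectral_decomp T lamT nuT" and sdS: "spectral_decomp S lamS nuS"
    and decT: "\<And>i k. 1 \<le> i \<Longrightarrow> i \<le> k \<Longrightarrow> lamT k \<le> lamT i"
    and decS: "\<And>i k. 1 \<le> i \<Longrightarrow> i \<le> k \<Longrightarrow> lamS k \<le> lamS i"
    and nnS: "0 \<le> lamS j" and j: "1 \<le> j"
    and close: "\<And>v. T v \<bullet> v \<le> S v \<bullet> v + b * (norm v)\<^sup>2"
  shows "lamT j \<le> lamS j + b"
proof -
  obtain a where a: "\<exists>i\<in>{1..j}. a i \<noteq> 0" "\<And>l. l \<in> {1..<j} \<Longrightarrow> (\<Sum>i=1..j. a i * (nuT i \<bullet> nuS l)) = 0"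
    using underdetermined_system_solvable[of "{1..<j}" "{1..j}" "\<lambda>i l. nuT i \<bullet> nuS l"] j
    by (auto simp del: One_nat_def atLeastLessThan_iff)
  define v where "v = (\<Sum>i=1..j. a i *\<^sub>R nuT i)"
  have nv: "(norm v)\<^sup>2 = (\<Sum>i=1..j. (a i)\<^sup>2)"
    unfolding v_def by (rule norm_sum_orthonormal) (auto simp: spectral_orthonormal[OF sdT])
  have coef: "nuT i \<bullet> v = (if i \<le> j then a i else 0)" if "1 \<le> i" for i
  proof -
    have "nuT i \<bullet> v = (\<Sum>k=1..j. a k * (nuT i \<bullet> nuT k))" by (simp add: v_def inner_sum_right)
    also have "\<dots> = (\<Sum>k=1..j. if k = i then a k else 0)"
      using that by (intro sum.cong) (auto simp: spectral_orthonormal[OF sdT])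
    finally show ?thesis using that by simp
  qed
  have pos: "(norm v)\<^sup>2 > 0"
    unfolding nv using a(1) by (metis finite_atLeastAtMost sum_pos2 zero_le_power2 zero_less_power2)
  have "((\<lambda>i. lamT i * (nuT i \<bullet> v) * (nuT i \<bullet> v)) has_sum (\<Sum>i=1..j. lamT i * (a i)\<^sup>2)) {1..}"
    by (rule has_sum_finite_neutralI[of "{1..j}"]) (auto simp: coef power2_eq_square intro!: sum.cong)
  then have Tv: "T v \<bullet> v = (\<Sum>i=1..j. lamT i * (a i)\<^sup>2)"
    using spectral_inner[OF sdT, of v v] has_sum_unique by blast
  have "lamT j * (norm v)\<^sup>2 = (\<Sum>i=1..j. lamT j * (a i)\<^sup>2)" by (simp add: nv sum_distrib_left)
  also have "\<dots> \<le> (\<Sum>i=1..j. lamT i * (a i)\<^sup>2)"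
    by (intro sum_mono mult_right_mono decT) auto
  also have "\<dots> \<le> S v \<bullet> v + b * (norm v)\<^sup>2" using close[of v] by (simp add: Tv)
  also have "S v \<bullet> v \<le> lamS j * (norm v)\<^sup>2"
  proof (rule spectral_form_le_orthogonal[OF sdS _ nnS j])
    show "nuS i \<bullet> v = 0" if "1 \<le> i" "i < j" for i
      using a(2)[of i] that by (simp add: v_def inner_sum_right inner_commute)
  qed (use decS j in auto)
  finally have "lamT j * (norm v)\<^sup>2 \<le> (lamS j + b) * (norm v)\<^sup>2" by (simp add: algebra_simps)
  then show ?thesis using pos by (simp add: mult_le_cancel_right)
qed

lemma spectral_gap_norm:
  fixes T :: "'a::real_inner \<Rightarrow> 'a"
  assumes sd: "spectral_decomp T lam nu" and j: "1 \<le> j"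
    and gap: "\<And>i. 1 \<le> i \<Longrightarrow> i \<noteq> j \<Longrightarrow> \<gamma> \<le> \<bar>lam i - lam j\<bar>" and \<gamma>: "0 \<le> \<gamma>" "\<gamma> \<le> lam j"
  shows "\<gamma>\<^sup>2 * ((norm v)\<^sup>2 - (nu j \<bullet> v)\<^sup>2) \<le> (norm (T v - lam j *\<^sub>R v))\<^sup>2"
proof -
  let ?x = "\<lambda>i. (nu i \<bullet> v)\<^sup>2"
  have h1: "((\<lambda>i. (lam i)\<^sup>2 * ?x i) has_sum (T v \<bullet> T v)) {1..}"
    using spectral_inner[OF sd, of v "T v"]
    by (rule has_sum_cong[THEN iffD1, rotated])
       (simp add: inner_commute[of "nu _" "T v"] spectral_inner_eigenvector[OF sd] power2_eq_square)
  have h2: "((\<lambda>i. lam i * ?x i) has_sum (T v \<bullet> v)) {1..}"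
    using spectral_inner[OF sd, of v v] by (simp add: power2_eq_square mult.assoc)
  have h: "((\<lambda>i. (lam i)\<^sup>2 * ?x i + (- 2 * lam j) * (lam i * ?x i)) has_sum (T v \<bullet> T v + (- 2 * lam j) * (T v \<bullet> v))) {1..}"
    by (intro has_sum_add h1 has_sum_cmult_right h2)
  have "(\<gamma>\<^sup>2 - (lam j)\<^sup>2) * (norm v)\<^sup>2 - \<gamma>\<^sup>2 * ?x j \<le> T v \<bullet> T v + (- 2 * lam j) * (T v \<bullet> v)"
  proof (rule has_sum_ge_of_finite_supersets[OF h, of "{j}"])
    fix F assume F: "finite F" "{j} \<subseteq> F" "F \<subseteq> {1..}"
    have le: "\<gamma>\<^sup>2 - (lam j)\<^sup>2 \<le> 0" using \<gamma> by (simp add: power_mono)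
    have "(\<gamma>\<^sup>2 - (lam j)\<^sup>2) * (norm v)\<^sup>2 \<le> (\<gamma>\<^sup>2 - (lam j)\<^sup>2) * (\<Sum>i\<in>F. ?x i)"
      by (intro mult_left_mono_neg le bessel_finite(1) F(1))
         (use F in \<open>auto simp: spectral_orthonormal[OF sd] subset_iff\<close>)
    then have "(\<gamma>\<^sup>2 - (lam j)\<^sup>2) * (norm v)\<^sup>2 - \<gamma>\<^sup>2 * ?x j
        \<le> (\<Sum>i\<in>F. (\<gamma>\<^sup>2 - (lam j)\<^sup>2) * ?x i) - (\<Sum>i\<in>F. if i = j then \<gamma>\<^sup>2 * ?x j else 0)"
      using F by (simp add: sum_distrib_left)
    also have "\<dots> = (\<Sum>i\<in>F. (\<gamma>\<^sup>2 - (lam j)\<^sup>2) * ?x i - (if i = j then \<gamma>\<^sup>2 * ?x j else 0))"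
      by (simp add: sum_subtractf)
    also have "\<dots> \<le> (\<Sum>i\<in>F. (lam i)\<^sup>2 * ?x i + (- 2 * lam j) * (lam i * ?x i))"
    proof (rule sum_mono)
      fix i assume "i \<in> F"
      then have i: "1 \<le> i" using F by auto
      have eq: "(lam i)\<^sup>2 * ?x i + (- 2 * lam j) * (lam i * ?x i) = ((lam i - lam j)\<^sup>2 - (lam j)\<^sup>2) * ?x i"
        by (simp add: power2_eq_square algebra_simps)
      show "(\<gamma>\<^sup>2 - (lam j)\<^sup>2) * ?x i - (if i = j then \<gamma>\<^sup>2 * ?x j else 0)
          \<le> (lam i)\<^sup>2 * ?x i + (- 2 * lam j) * (lam i * ?x i)"
      proof (cases "i = j")
        case True then show ?thesis unfolding eq by (simp add: algebra_simps)
      next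
        case False
        have "\<gamma>\<^sup>2 \<le> (lam i - lam j)\<^sup>2" using gap[OF i False] \<gamma>(1) by (metis abs_of_nonneg abs_le_square_iff)
        then show ?thesis unfolding eq using False by (simp add: mult_right_mono)
      qed
    qed
    finally show "(\<gamma>\<^sup>2 - (lam j)\<^sup>2) * (norm v)\<^sup>2 - \<gamma>\<^sup>2 * ?x j
        \<le> (\<Sum>i\<in>F. (lam i)\<^sup>2 * ?x i + (- 2 * lam j) * (lam i * ?x i))" .
  qed (use j in auto)
  moreover have "(norm (T v - lam j *\<^sub>R v))\<^sup>2 = T v \<bullet> T v + (- 2 * lam j) * (T v \<bullet> v) + (lam j)\<^sup>2 * (norm v)\<^sup>2"
    unfolding power2_norm_eq_inner
    by (simp add: inner_diff inner_commute power2_eq_square algebra_simps)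
  ultimately show ?thesis by (simp add: algebra_simps)
qed

lemma eigenvector_perturbation:
  fixes T S :: "'a::real_inner \<Rightarrow> 'a"
  assumes sdT: "spectral_decomp T lamT nuT" and sdS: "spectral_decomp S lamS nuS"
    and decT: "\<And>i k. 1 \<le> i \<Longrightarrow> i \<le> k \<Longrightarrow> lamT k \<le> lamT i"
    and decS: "\<And>i k. 1 \<le> i \<Longrightarrow> i \<le> k \<Longrightarrow> lamS k \<le> lamS i"
    and nnT: "0 \<le> lamT j" and nnS: "0 \<le> lamS j" and j: "1 \<le> j"
    and close: "\<And>v. norm (T v - S v) \<le> b * norm v"
    and gap: "\<And>i. 1 \<le> i \<Longrightarrow> i \<noteq> j \<Longrightarrow> \<gamma> \<le> \<bar>lamS i - lamS j\<bar>" and \<gamma>: "0 < \<gamma>" "\<gamma> \<le> lamS j"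
  shows "\<exists>s\<in>{-1, 1::real}. (norm (nuT j - s *\<^sub>R nuS j))\<^sup>2 \<le> 8 * b\<^sup>2 / \<gamma>\<^sup>2"
proof -
  have form: "\<bar>T v \<bullet> v - S v \<bullet> v\<bar> \<le> b * (norm v)\<^sup>2" for v
  proof -
    have "\<bar>(T v - S v) \<bullet> v\<bar> \<le> norm (T v - S v) * norm v" by (rule Cauchy_Schwarz_ineq2)
    also have "\<dots> \<le> b * norm v * norm v" by (intro mult_right_mono close) simp
    finally show ?thesis by (simp add: inner_diff power2_eq_square mult.assoc)
  qed
  have f1: "T v \<bullet> v \<le> S v \<bullet> v + b * (norm v)\<^sup>2" and f2: "S v \<bullet> v \<le> T v \<bullet> v + b * (norm v)\<^sup>2" for v
    using form[of v] by auto
  have "lamT j \<le> lamS j + b" by (rule weyl_eigenvalue_le[OF sdT sdS decT decS nnS j f1])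
  moreover have "lamS j \<le> lamT j + b" by (rule weyl_eigenvalue_le[OF sdS sdT decS decT nnT j f2])
  ultimately have weyl: "\<bar>lamT j - lamS j\<bar> \<le> b" by auto
  let ?v = "nuT j" and ?u = "nuS j"
  have n1: "norm ?v = 1" "norm ?u = 1"
    using spectral_orthonormal[OF sdT j j] spectral_orthonormal[OF sdS j j] by (auto simp: norm_eq_1)
  have "S ?v - lamS j *\<^sub>R ?v = (lamT j - lamS j) *\<^sub>R ?v - (T ?v - S ?v)"
    by (simp add: spectral_eigenvector[OF sdT j] algebra_simps)
  then have "norm (S ?v - lamS j *\<^sub>R ?v) \<le> norm ((lamT j - lamS j) *\<^sub>R ?v) + norm (T ?v - S ?v)"
    by (metis norm_triangle_ineq4)
  also have "\<dots> \<le> 2 * b" using weyl close[of ?v] n1 by simp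
  finally have "(norm (S ?v - lamS j *\<^sub>R ?v))\<^sup>2 \<le> (2 * b)\<^sup>2" by (intro power_mono) auto
  with spectral_gap_norm[OF sdS j gap _ \<gamma>(2), of ?v] \<gamma>(1) n1
  have "\<gamma>\<^sup>2 * (1 - (?u \<bullet> ?v)\<^sup>2) \<le> 4 * b\<^sup>2" by (simp add: power_mult_distrib)
  then have sin: "1 - (?u \<bullet> ?v)\<^sup>2 \<le> 4 * b\<^sup>2 / \<gamma>\<^sup>2" using \<gamma>(1) by (simp add: field_simps)
  define s :: real where "s = (if ?u \<bullet> ?v \<ge> 0 then 1 else -1)"
  have s2: "s\<^sup>2 = 1" by (simp add: s_def)
  have "(norm (?v - s *\<^sub>R ?u))\<^sup>2 = (norm ?v)\<^sup>2 - 2 * s * (?u \<bullet> ?v) + s\<^sup>2 * (norm ?u)\<^sup>2"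
    unfolding power2_norm_eq_inner
    by (simp add: inner_diff inner_commute power2_eq_square algebra_simps)
  also have "\<dots> = 2 - 2 * \<bar>?u \<bullet> ?v\<bar>" using s2 n1 by (simp add: s_def)
  also have "\<dots> \<le> 2 * (1 - (?u \<bullet> ?v)\<^sup>2)"
  proof -
    have "\<bar>?u \<bullet> ?v\<bar> \<le> 1" using Cauchy_Schwarz_ineq2[of ?u ?v] n1 by simp
    then have "\<bar>?u \<bullet> ?v\<bar> * \<bar>?u \<bullet> ?v\<bar> \<le> \<bar>?u \<bullet> ?v\<bar>" by (intro mult_left_le) auto
    then show ?thesis by (simp add: power2_eq_square)
  qed
  also have "\<dots> \<le> 8 * b\<^sup>2 / \<gamma>\<^sup>2" using sin by simp
  finally show ?thesis by (intro bexI[of _ s]) (auto simp: s_def)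
qed

text \<open>\<open>D\<close> commutes with its square, hence preserves the one-dimensional eigenspaces of the latter.\<close>

lemma square_root_matrix_entries:
  fixes D :: "'a::real_inner \<Rightarrow> 'a"
  assumes sa: "self_adjoint D" and sd: "spectral_decomp (\<lambda>v. D (D v)) lam nu"
    and simple: "\<And>i j. 1 \<le> i \<Longrightarrow> 1 \<le> j \<Longrightarrow> i \<noteq> j \<Longrightarrow> lam i \<noteq> lam j"
  shows "(\<Sum>i=1..d. \<Sum>j=1..d. (D (nu i) \<bullet> nu j)\<^sup>2) = (\<Sum>j=1..d. lam j)"
proof -
  let ?R = "\<lambda>v. D (D v)"
  have nrm: "(norm (D (nu i)))\<^sup>2 = lam i" if i: "1 \<le> i" for i
  proof -
    have "(norm (D (nu i)))\<^sup>2 = ?R (nu i) \<bullet> nu i"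
      by (simp add: power2_norm_eq_inner self_adjointD[OF sa])
    then show ?thesis using spectral_inner_eigenvector[OF sd i, of "nu i"] spectral_orthonormal[OF sd i i] by simp
  qed
  have off: "D (nu i) \<bullet> nu j = 0" if i: "1 \<le> i" and j: "1 \<le> j" and ij: "i \<noteq> j" for i j
  proof -
    have "?R (D (nu i)) = lam i *\<^sub>R D (nu i)"
      using spectral_eigenvector[OF sd i] by (simp add: self_adjoint_scaleR[OF sa])
    then have "lam i * (D (nu i) \<bullet> nu j) = lam j * (D (nu i) \<bullet> nu j)"
      using spectral_inner_eigenvector[OF sd j, of "D (nu i)"] by (simp add: inner_commute)
    then show ?thesis using simple[OF i j ij] by simp
  qed
  have diag: "(D (nu i) \<bullet> nu i)\<^sup>2 = lam i" if i: "1 \<le> i" for i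
  proof (cases "lam i = 0")
    case True
    then have "D (nu i) = 0" using nrm[OF i] by simp
    then show ?thesis using True by simp
  next
    case False
    have "((\<lambda>j. lam j * (nu j \<bullet> D (nu i)) * (nu j \<bullet> D (nu i))) has_sum (lam i * (D (nu i) \<bullet> nu i)\<^sup>2)) {1..}"
      by (rule has_sum_finite_neutralI[of "{i}"])
         (use i off in \<open>auto simp: inner_commute power2_eq_square\<close>)
    then have "?R (D (nu i)) \<bullet> D (nu i) = lam i * (D (nu i) \<bullet> nu i)\<^sup>2"
      using spectral_inner[OF sd, of "D (nu i)" "D (nu i)"] has_sum_unique by blast
    moreover have "?R (D (nu i)) \<bullet> D (nu i) = lam i * lam i"
      using spectral_eigenvector[OF sd i] nrm[OF i] by (simp add: self_adjoint_scaleR[OF sa] power2_norm_eq_inner)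
    ultimately show ?thesis using False by simp
  qed
  have "(\<Sum>i=1..d. \<Sum>j=1..d. (D (nu i) \<bullet> nu j)\<^sup>2) = (\<Sum>i=1..d. \<Sum>j=1..d. if j = i then lam i else 0)"
    by (intro sum.cong refl) (use off diag in auto)
  then show ?thesis by simp
qed

lemma matrix_entries_perturbation:
  fixes T :: "'a::real_inner \<Rightarrow> 'a"
  assumes sa: "self_adjoint T" and b: "\<And>v. norm (T v) \<le> b * norm v"
    and u: "\<And>i j. i \<in> {1..d} \<Longrightarrow> j \<in> {1..d} \<Longrightarrow> u i \<bullet> u j = (if i = j then 1 else 0::real)"
    and w: "\<And>i j. i \<in> {1..d} \<Longrightarrow> j \<in> {1..d} \<Longrightarrow> w i \<bullet> w j = (if i = j then 1 else 0::real)"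
  shows "(\<Sum>i=1..d. \<Sum>j=1..d. (T (u i) \<bullet> u j - T (w i) \<bullet> w j)\<^sup>2) \<le> 4 * b\<^sup>2 * (\<Sum>i=1..d::nat. (norm (u i - w i))\<^sup>2)"
proof -
  have bsq: "(norm (T v))\<^sup>2 \<le> b\<^sup>2 * (norm v)\<^sup>2" for v
    using power_mono[OF b[of v], of 2] by (simp add: power_mult_distrib)
  have 1: "(\<Sum>j=1..d. (T (u i - w i) \<bullet> u j)\<^sup>2) \<le> b\<^sup>2 * (norm (u i - w i))\<^sup>2" for i
    using bessel_finite(1)[of "{1..d}" u "T (u i - w i)"] u bsq[of "u i - w i"]
    by (simp add: inner_commute)
  have 2: "(\<Sum>i=1..d. (T (w i) \<bullet> (u j - w j))\<^sup>2) \<le> b\<^sup>2 * (norm (u j - w j))\<^sup>2" for j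
    using bessel_finite(1)[of "{1..d}" w "T (u j - w j)"] w bsq[of "u j - w j"]
    by (simp add: self_adjointD[OF sa])
  have split: "T (u i) \<bullet> u j - T (w i) \<bullet> w j = T (u i - w i) \<bullet> u j + T (w i) \<bullet> (u j - w j)" for i j
    by (simp add: self_adjoint_diff[OF sa] inner_diff)
  have "(\<Sum>i=1..d. \<Sum>j=1..d. (T (u i) \<bullet> u j - T (w i) \<bullet> w j)\<^sup>2)
      \<le> (\<Sum>i=1..d. \<Sum>j=1..d. 2 * (T (u i - w i) \<bullet> u j)\<^sup>2 + 2 * (T (w i) \<bullet> (u j - w j))\<^sup>2)"
    unfolding split by (intro sum_mono) (smt (verit) sum_squares_bound power2_sum)
  also have "\<dots> = 2 * (\<Sum>i=1..d. \<Sum>j=1..d. (T (u i - w i) \<bullet> u j)\<^sup>2) + 2 * (\<Sum>j=1..d. \<Sum>i=1..d. (T (w i) \<bullet> (u j - w j))\<^sup>2)"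
    by (subst (2) sum.swap) (simp add: sum.distrib sum_distrib_left)
  also have "\<dots> \<le> 2 * (\<Sum>i=1..d. b\<^sup>2 * (norm (u i - w i))\<^sup>2) + 2 * (\<Sum>j=1..d. b\<^sup>2 * (norm (u j - w j))\<^sup>2)"
    by (intro add_mono mult_left_mono sum_mono 1 2) auto
  finally show ?thesis by (simp add: sum_distrib_left mult.assoc)
qed

lemma matrix_entries_le:
  fixes T :: "'a::real_inner \<Rightarrow> 'a"
  assumes b: "\<And>v. norm (T v) \<le> b * norm v"
    and u: "\<And>i j. i \<in> {1..d} \<Longrightarrow> j \<in> {1..d} \<Longrightarrow> u i \<bullet> u j = (if i = j then 1 else 0::real)"
  shows "(\<Sum>i=1..d::nat. \<Sum>j=1..d. (T (u i) \<bullet> u j)\<^sup>2) \<le> real d * b\<^sup>2"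
proof -
  have "(\<Sum>i=1..d. \<Sum>j=1..d. (T (u i) \<bullet> u j)\<^sup>2) \<le> (\<Sum>i=1..d. b\<^sup>2)"
  proof (rule sum_mono)
    fix i assume i: "i \<in> {1..d}"
    have "(\<Sum>j=1..d. (T (u i) \<bullet> u j)\<^sup>2) \<le> (norm (T (u i)))\<^sup>2"
      using bessel_finite(1)[of "{1..d}" u "T (u i)"] u by (simp add: inner_commute)
    also have "\<dots> \<le> (b * norm (u i))\<^sup>2" by (intro power_mono b) simp
    also have "norm (u i) = 1" using u[OF i i] by (simp add: norm_eq_1)
    finally show "(\<Sum>j=1..d. (T (u i) \<bullet> u j)\<^sup>2) \<le> b\<^sup>2" by simp
  qed
  then show ?thesis by simp
qed

section \<open>Covariance operators\<close>

lemma norm_le_of_inner: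
  assumes "\<And>w. \<bar>x \<bullet> w\<bar> \<le> c * norm w" and "0 \<le> c" shows "norm (x::'a::real_inner) \<le> c"
proof (cases "x = 0")
  case False
  have "norm x * norm x \<le> c * norm x"
    using assms(1)[of x] by (simp add: power2_norm_eq_inner[symmetric] power2_eq_square)
  then show ?thesis using False by simp
qed (use assms(2) in simp)

lemma Chat_inner:
  "Chat Xg m h \<omega> v \<bullet> w = (1 / real (m - h)) * (\<Sum>k = 1..m - h. (Xg (k + h) \<omega> \<bullet> v) * (Xg k \<omega> \<bullet> w))"
  by (simp add: Chat_def inner_sum_left)

lemma ChatRev_inner:
  "ChatRev Xg m h \<omega> v \<bullet> w = (1 / real (m - h)) * (\<Sum>k = 1..m - h. (Xg k \<omega> \<bullet> v) * (Xg (k + h) \<omega> \<bullet> w))"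
  by (simp add: ChatRev_def inner_sum_left)

lemma Chat_adjoint: "Chat Xg m h \<omega> v \<bullet> w = v \<bullet> ChatRev Xg m h \<omega> w"
  by (simp add: Chat_inner inner_commute[of v] ChatRev_inner mult.commute)

lemma self_adjoint_add_adjoint:
  assumes "\<And>v w. T v \<bullet> w = v \<bullet> S w" shows "self_adjoint (\<lambda>v. T v + S v)"
  unfolding self_adjoint_def by (metis assms inner_add_left inner_add_right inner_commute add.commute)

lemma self_adjoint_minus:
  "self_adjoint T \<Longrightarrow> self_adjoint S \<Longrightarrow> self_adjoint (\<lambda>v. T v - S v)"
  by (simp add: self_adjoint_def inner_diff)

lemma self_adjoint_kappahat: "self_adjoint (kappahat Xg m h \<omega>)"
  using self_adjoint_add_adjoint[OF Chat_adjoint] by (simp add: kappahat_def[abs_def])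

lemma measurable_Chat:
  fixes Xg :: "nat \<Rightarrow> 'b \<Rightarrow> 'a::{real_inner,second_countable_topology}"
  assumes "\<And>k. k \<in> {1..m} \<Longrightarrow> Xg k \<in> borel_measurable M"
  shows "(\<lambda>\<omega>. Chat Xg m h \<omega> v) \<in> borel_measurable M"
  unfolding Chat_def
  by (intro borel_measurable_scaleR borel_measurable_sum borel_measurable_inner borel_measurable_const assms) auto

text \<open>The sort of \<open>'a\<close> does not entail the class \<open>banach\<close>, so the library's criterion for
  Bochner integrability does not apply; only completeness enters.\<close>

lemma integrable_of_norm_bound:
  fixes f :: "'b \<Rightarrow> 'a::{real_inner,complete_space,second_countable_topology}"
  assumes f [measurable]: "f \<in> borel_measurable M" and g: "integrable M g"
    and le: "\<And>x. norm (f x) \<le> g x"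
  shows "integrable M f"
proof -
  have [measurable]: "g \<in> borel_measurable M" using g by simp
  have "(\<integral>\<^sup>+x. ennreal (norm (g x)) \<partial>M) < \<infinity>" using g by (simp add: integrable_iff_bounded)
  moreover have "norm (2 * g x) = 2 * norm (g x)" for x by (simp add: abs_mult)
  ultimately have fin: "(\<integral>\<^sup>+x. ennreal (2 * norm (g x)) \<partial>M) < \<infinity>"
    by (simp add: nn_integral_cmult ennreal_mult ennreal_mult_less_top)
  obtain s where simple: "\<And>i. simple_function M (s i)"
    and lim: "\<And>x. x \<in> space M \<Longrightarrow> (\<lambda>i. s i x) \<longlonglongrightarrow> f x"
    and dom: "\<And>i x. x \<in> space M \<Longrightarrow> dist (s i x) 0 \<le> 2 * dist (f x) 0"
    using borel_measurable_implies_sequence_metric[OF f, of 0] by blast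
  have [measurable]: "s i \<in> borel_measurable M" for i
    by (rule borel_measurable_simple_function[OF simple])
  have bd: "norm (s i x) \<le> 2 * norm (g x)" if "x \<in> space M" for i x
    using dom[OF that, of i] le[of x] by simp
  have sbi: "Bochner_Integration.simple_bochner_integrable M (s i)" for i
  proof (rule simple_bochner_integrableI_bounded[OF simple])
    have "(\<integral>\<^sup>+x. ennreal (norm (s i x)) \<partial>M) \<le> (\<integral>\<^sup>+x. ennreal (2 * norm (g x)) \<partial>M)"
      by (intro nn_integral_mono ennreal_leI bd)
    then show "(\<integral>\<^sup>+x. ennreal (norm (s i x)) \<partial>M) < \<infinity>" using fin by (rule le_less_trans)
  qed
  define \<Delta> where "\<Delta> i = (\<integral>\<^sup>+x. ennreal (norm (f x - s i x)) \<partial>M)" for i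
  have L1: "\<Delta> \<longlonglongrightarrow> 0"
    unfolding \<Delta>_def
    by (rule nn_integral_dominated_convergence_norm[where w="\<lambda>x. 2 * norm (g x)"])
       (use bd lim fin in auto)
  have "Cauchy (\<lambda>i. Bochner_Integration.simple_bochner_integral M (s i))"
  proof (rule metric_CauchyI)
    fix e :: real assume e: "0 < e"
    then have "\<forall>\<^sub>F i in sequentially. \<Delta> i < ennreal (e / 2)" by (intro order_tendstoD(2)[OF L1]) simp
    then obtain k where k: "\<And>i. k \<le> i \<Longrightarrow> \<Delta> i < ennreal (e / 2)" by (auto simp: eventually_sequentially)
    have "dist (Bochner_Integration.simple_bochner_integral M (s m)) (Bochner_Integration.simple_bochner_integral M (s n)) < e" if "k \<le> m" "k \<le> n" for m n
    proof -
      have "ennreal (norm (Bochner_Integration.simple_bochner_integral M (s m) - Bochner_Integration.simple_bochner_integral M (s n))) \<le> \<Delta> m + \<Delta> n"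
        unfolding \<Delta>_def by (rule simple_bochner_integral_bounded[OF f sbi sbi])
      also have "\<dots> < ennreal (e / 2) + ennreal (e / 2)" using k that by (intro add_strict_mono) auto
      also have "\<dots> = ennreal e" using e by (simp flip: ennreal_plus)
      finally show ?thesis using e by (simp add: dist_norm ennreal_less_iff)
    qed
    then show "\<exists>k. \<forall>m\<ge>k. \<forall>n\<ge>k. dist (Bochner_Integration.simple_bochner_integral M (s m)) (Bochner_Integration.simple_bochner_integral M (s n)) < e"
      by blast
  qed
  then obtain y where "(\<lambda>i. Bochner_Integration.simple_bochner_integral M (s i)) \<longlonglongrightarrow> y"
    using Cauchy_convergent_iff convergent_def by blast
  then have "has_bochner_integral M f y"
    using f sbi L1 unfolding \<Delta>_def by (intro has_bochner_integral.intros)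
  then show ?thesis by (auto simp: integrable.simps)
qed

locale stationary_process =
  fixes M :: "'b measure" and Xg :: "nat \<Rightarrow> 'b \<Rightarrow> 'a::{real_inner,complete_space,second_countable_topology}"
  assumes stationary: "weakly_stationary_zm M Xg"
begin

definition "second_moment = (\<integral>\<omega>. (norm (Xg 1 \<omega>))\<^sup>2 \<partial>M)"

lemma measurable_X: "1 \<le> k \<Longrightarrow> Xg k \<in> borel_measurable M"
  using stationary by (simp add: weakly_stationary_zm_def)

lemma integrable_norm_sq: "1 \<le> k \<Longrightarrow> integrable M (\<lambda>\<omega>. (norm (Xg k \<omega>))\<^sup>2)"
  using stationary by (simp add: weakly_stationary_zm_def)

lemma second_moment_nonneg: "0 \<le> second_moment"
  by (simp add: second_moment_def)

lemma nn_second_moment: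
  assumes k: "1 \<le> k"
  shows "(\<integral>\<^sup>+\<omega>. ennreal ((norm (Xg k \<omega>))\<^sup>2) \<partial>M) = ennreal second_moment"
proof -
  have coord: "(\<integral>\<^sup>+\<omega>. ennreal ((e \<bullet> Xg k \<omega>)\<^sup>2) \<partial>M) = ennreal (\<integral>\<omega>. (Xg k \<omega> \<bullet> e) * (Xg k \<omega> \<bullet> e) \<partial>M)" 
    if k: "1 \<le> k" for k and e :: 'a
  proof -
    have "integrable M (\<lambda>\<omega>. (Xg k \<omega> \<bullet> e) * (Xg k \<omega> \<bullet> e))"
    proof (rule Bochner_Integration.integrable_bound)
      show "integrable M (\<lambda>\<omega>. (norm e)\<^sup>2 * (norm (Xg k \<omega>))\<^sup>2)" using integrable_norm_sq[OF k] by simp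
      show "(\<lambda>\<omega>. (Xg k \<omega> \<bullet> e) * (Xg k \<omega> \<bullet> e)) \<in> borel_measurable M"
        using measurable_X[OF k] by simp
      show "AE \<omega> in M. norm ((Xg k \<omega> \<bullet> e) * (Xg k \<omega> \<bullet> e)) \<le> norm ((norm e)\<^sup>2 * (norm (Xg k \<omega>))\<^sup>2)"
      proof (rule AE_I2)
        fix \<omega>
        have "\<bar>Xg k \<omega> \<bullet> e\<bar> * \<bar>Xg k \<omega> \<bullet> e\<bar> \<le> (norm (Xg k \<omega>) * norm e) * (norm (Xg k \<omega>) * norm e)"
          by (intro mult_mono Cauchy_Schwarz_ineq2) auto
        then show "norm ((Xg k \<omega> \<bullet> e) * (Xg k \<omega> \<bullet> e)) \<le> norm ((norm e)\<^sup>2 * (norm (Xg k \<omega>))\<^sup>2)"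
          by (simp add: abs_mult power2_eq_square mult_ac)
      qed
    qed
    then show ?thesis
      by (subst nn_integral_eq_integral[symmetric]) (auto simp: power2_eq_square inner_commute)
  qed
  have sum: "(\<integral>\<^sup>+\<omega>. ennreal ((norm (Xg k \<omega>))\<^sup>2) \<partial>M)
      = (\<integral>\<^sup>+e. ennreal (\<integral>\<omega>. (Xg k \<omega> \<bullet> e) * (Xg k \<omega> \<bullet> e) \<partial>M) \<partial>count_space some_basis)" if k: "1 \<le> k" for k
  proof -
    have [measurable]: "Xg k \<in> borel_measurable M" by (rule measurable_X[OF k])
    have "(\<integral>\<^sup>+\<omega>. ennreal ((norm (Xg k \<omega>))\<^sup>2) \<partial>M)
        = (\<integral>\<^sup>+\<omega>. \<integral>\<^sup>+e. ennreal ((e \<bullet> Xg k \<omega>)\<^sup>2) \<partial>count_space some_basis \<partial>M)"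
      by (simp only: parseval[OF complete_orthonormal_some_basis])
    also have "\<dots> = (\<integral>\<^sup>+e. \<integral>\<^sup>+\<omega>. ennreal ((e \<bullet> Xg k \<omega>)\<^sup>2) \<partial>M \<partial>count_space some_basis)"
      by (rule nn_integral_count_space_nn_integral[OF countable_some_basis]) simp
    finally show ?thesis by (simp add: coord[OF k])
  qed
  have "(\<integral>\<omega>. (Xg k \<omega> \<bullet> e) * (Xg k \<omega> \<bullet> e) \<partial>M) = (\<integral>\<omega>. (Xg 1 \<omega> \<bullet> e) * (Xg 1 \<omega> \<bullet> e) \<partial>M)" for e
  proof -
    have "\<forall>k\<ge>1. \<forall>h u v. (\<integral>\<omega>. (Xg k \<omega> \<bullet> u) * (Xg (k + h) \<omega> \<bullet> v) \<partial>M)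
        = (\<integral>\<omega>. (Xg 1 \<omega> \<bullet> u) * (Xg (1 + h) \<omega> \<bullet> v) \<partial>M)"
      using stationary unfolding weakly_stationary_zm_def by (rule conjunct2)
    from this[rule_format, of k e 0 e] show ?thesis using k by simp
  qed
  then have "(\<integral>\<^sup>+\<omega>. ennreal ((norm (Xg k \<omega>))\<^sup>2) \<partial>M) = (\<integral>\<^sup>+\<omega>. ennreal ((norm (Xg 1 \<omega>))\<^sup>2) \<partial>M)"
    using sum[OF k] sum[of 1] by simp
  then show ?thesis
    using integrable_norm_sq[of 1] by (simp add: second_moment_def nn_integral_eq_integral)
qed

lemma integral_norm_sq: "1 \<le> k \<Longrightarrow> (\<integral>\<omega>. (norm (Xg k \<omega>))\<^sup>2 \<partial>M) = second_moment"
  using nn_second_moment[of k] integrable_norm_sq[of k] second_moment_nonneg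
  by (simp add: nn_integral_eq_integral)

lemma
  assumes k: "1 \<le> k" and l: "1 \<le> l"
  shows integrable_cross: "integrable M (\<lambda>\<omega>. (Xg k \<omega> \<bullet> v) *\<^sub>R Xg l \<omega>)"
    and norm_cross_le: "norm (\<integral>\<omega>. (Xg k \<omega> \<bullet> v) *\<^sub>R Xg l \<omega> \<partial>M) \<le> second_moment * norm v"
proof -
  have [measurable]: "Xg k \<in> borel_measurable M" "Xg l \<in> borel_measurable M"
    using measurable_X k l by auto
  let ?f = "\<lambda>\<omega>. norm v * (((norm (Xg k \<omega>))\<^sup>2 + (norm (Xg l \<omega>))\<^sup>2) / 2)"
  have le: "norm ((Xg k \<omega> \<bullet> v) *\<^sub>R Xg l \<omega>) \<le> ?f \<omega>" for \<omega>
  proof -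
    have "norm ((Xg k \<omega> \<bullet> v) *\<^sub>R Xg l \<omega>) \<le> (norm (Xg k \<omega>) * norm v) * norm (Xg l \<omega>)"
      by (simp add: mult_right_mono Cauchy_Schwarz_ineq2)
    also have "\<dots> = norm v * (norm (Xg k \<omega>) * norm (Xg l \<omega>))" by simp
    also have "\<dots> \<le> ?f \<omega>"
      using sum_squares_bound[of "norm (Xg k \<omega>)" "norm (Xg l \<omega>)"] by (intro mult_left_mono) auto
    finally show ?thesis .
  qed
  have intf: "integrable M ?f" using integrable_norm_sq k l by simp
  show int: "integrable M (\<lambda>\<omega>. (Xg k \<omega> \<bullet> v) *\<^sub>R Xg l \<omega>)"
    by (rule integrable_of_norm_bound[OF _ intf le]) measurable
  show "norm (\<integral>\<omega>. (Xg k \<omega> \<bullet> v) *\<^sub>R Xg l \<omega> \<partial>M) \<le> second_moment * norm v"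
  proof (rule norm_le_of_inner)
    fix w
    have le': "\<bar>((Xg k \<omega> \<bullet> v) *\<^sub>R Xg l \<omega>) \<bullet> w\<bar> \<le> ?f \<omega> * norm w" for \<omega>
      by (rule order_trans[OF Cauchy_Schwarz_ineq2]) (intro mult_right_mono le, simp)
    have "\<bar>(\<integral>\<omega>. (Xg k \<omega> \<bullet> v) *\<^sub>R Xg l \<omega> \<partial>M) \<bullet> w\<bar> = \<bar>\<integral>\<omega>. ((Xg k \<omega> \<bullet> v) *\<^sub>R Xg l \<omega>) \<bullet> w \<partial>M\<bar>"
      using int by (subst integral_inner_left) auto
    also have "\<dots> \<le> (\<integral>\<omega>. \<bar>((Xg k \<omega> \<bullet> v) *\<^sub>R Xg l \<omega>) \<bullet> w\<bar> \<partial>M)" by (rule integral_abs_bound)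
    also have "\<dots> \<le> (\<integral>\<omega>. ?f \<omega> * norm w \<partial>M)"
      using int intf by (intro integral_mono le' integrable_abs integrable_inner_left integrable_mult_left) auto
    also have "\<dots> = second_moment * norm v * norm w"
      using integrable_norm_sq k l by (simp add: integral_norm_sq)
    finally show "\<bar>(\<integral>\<omega>. (Xg k \<omega> \<bullet> v) *\<^sub>R Xg l \<omega> \<partial>M) \<bullet> w\<bar> \<le> second_moment * norm v * norm w" .
  qed (simp add: second_moment_nonneg)
qed

lemma norm_Cov_le: "norm (Cov M Xg h v) \<le> second_moment * norm v"
  unfolding Cov_def by (rule norm_cross_le) auto

lemma norm_CovRev_le: "norm (CovRev M Xg h v) \<le> second_moment * norm v"
  unfolding CovRev_def by (rule norm_cross_le) auto

lemma Cov_adjoint: "Cov M Xg h v \<bullet> w = v \<bullet> CovRev M Xg h w"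
proof -
  have "Cov M Xg h v \<bullet> w = (\<integral>\<omega>. ((Xg (1 + h) \<omega> \<bullet> v) *\<^sub>R Xg 1 \<omega>) \<bullet> w \<partial>M)"
    unfolding Cov_def using integrable_cross[of "1 + h" 1 v] by (subst integral_inner_left) auto
  also have "\<dots> = (\<integral>\<omega>. v \<bullet> ((Xg 1 \<omega> \<bullet> w) *\<^sub>R Xg (1 + h) \<omega>) \<partial>M)"
    by (simp add: inner_commute mult.commute)
  also have "\<dots> = v \<bullet> CovRev M Xg h w"
    unfolding CovRev_def using integrable_cross[of 1 "1 + h" w] by (subst integral_inner_right) auto
  finally show ?thesis .
qed

lemma self_adjoint_kappa: "self_adjoint (kappa M Xg h)"
  using self_adjoint_add_adjoint[OF Cov_adjoint] by (simp add: kappa_def[abs_def])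

lemma norm_kappa_le: "norm (kappa M Xg h v) \<le> 2 * second_moment * norm v"
  unfolding kappa_def
  using norm_triangle_ineq[of "Cov M Xg h v" "CovRev M Xg h v"] norm_Cov_le[of h v] norm_CovRev_le[of h v] by simp

lemma
  assumes fin: "hs_norm_sq (\<lambda>v. Chat Yg m h \<eta> v - Cov M Xg h v) \<le> ennreal z" and z: "0 \<le> z"
  shows norm_Chat_diff_le: "norm (Chat Yg m h \<eta> v - Cov M Xg h v) \<le> sqrt z * norm v"
    and norm_kappahat_diff_le: "norm (kappahat Yg m h \<eta> v - kappa M Xg h v) \<le> 2 * sqrt z * norm v"
proof -
  let ?T = "\<lambda>v. Chat Yg m h \<eta> v - Cov M Xg h v" and ?S = "\<lambda>v. ChatRev Yg m h \<eta> v - CovRev M Xg h v"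
  have adj: "?T v \<bullet> w = v \<bullet> ?S w" for v w by (simp add: inner_diff Chat_adjoint Cov_adjoint)
  have adj': "?S v \<bullet> w = v \<bullet> ?T w" for v w using adj[of w v] by (simp add: inner_commute)
  have *: "norm (T v) \<le> sqrt z * norm v" 
    if "\<And>v w. T v \<bullet> w = v \<bullet> S w" "hs_norm_sq T \<le> ennreal z" for T S :: "'a \<Rightarrow> 'a" and v
  proof -
    have "ennreal ((norm (T v))\<^sup>2) \<le> ennreal ((norm v)\<^sup>2) * ennreal z"
      by (rule order_trans[OF norm_sq_le_hs_norm_sq[OF that(1)]]) (rule mult_left_mono[OF that(2)], simp)
    then have "(norm (T v))\<^sup>2 \<le> (sqrt z * norm v)\<^sup>2"
      using z by (simp add: ennreal_mult[symmetric] power_mult_distrib mult.commute)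
    then show ?thesis using z by (auto intro: power2_le_imp_le)
  qed
  show 1: "norm (?T v) \<le> sqrt z * norm v" by (rule *[OF adj fin])
  have "hs_norm_sq ?S \<le> ennreal z" using fin hs_norm_sq_adjoint[OF adj] by simp
  then have 2: "norm (?S v) \<le> sqrt z * norm v" by (rule *[OF adj'])
  have "kappahat Yg m h \<eta> v - kappa M Xg h v = ?T v + ?S v" by (simp add: kappahat_def kappa_def)
  then show "norm (kappahat Yg m h \<eta> v - kappa M Xg h v) \<le> 2 * sqrt z * norm v"
    using norm_triangle_ineq[of "?T v" "?S v"] 1 2 by simp
qed

lemma initial_form_le:
  assumes fin: "hs_norm_sq (\<lambda>v. Chat Yg m 0 \<eta> v - Cov M Xg 0 v) \<le> ennreal z" and z: "0 \<le> z"
    and r: "1 \<le> r" "r \<le> m" "real m \<le> q * real r"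
  shows "(\<Sum>k=1..r. (Yg k \<eta> \<bullet> v)\<^sup>2) \<le> real r * (q * (second_moment + sqrt z)) * (norm v)\<^sup>2"
proof -
  have "(\<Sum>k=1..r. (Yg k \<eta> \<bullet> v)\<^sup>2) \<le> (\<Sum>k=1..m. (Yg k \<eta> \<bullet> v)\<^sup>2)"
    using r by (intro sum_mono2) auto
  also have "\<dots> = real m * (Chat Yg m 0 \<eta> v \<bullet> v)"
    using r by (simp add: Chat_inner power2_eq_square)
  also have "\<dots> \<le> real m * ((second_moment + sqrt z) * (norm v)\<^sup>2)"
  proof (rule mult_left_mono)
    have "Chat Yg m 0 \<eta> v \<bullet> v \<le> norm (Chat Yg m 0 \<eta> v) * norm v" by (rule norm_cauchy_schwarz)
    also have "\<dots> \<le> ((second_moment + sqrt z) * norm v) * norm v"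
    proof (rule mult_right_mono)
      have "norm (Chat Yg m 0 \<eta> v) \<le> norm (Cov M Xg 0 v) + norm (Chat Yg m 0 \<eta> v - Cov M Xg 0 v)"
        by (metis add.commute diff_add_cancel norm_triangle_ineq)
      then show "norm (Chat Yg m 0 \<eta> v) \<le> (second_moment + sqrt z) * norm v"
        using norm_Cov_le[of 0 v] norm_Chat_diff_le[OF fin z, of v] by (simp add: algebra_simps)
    qed simp
    finally show "Chat Yg m 0 \<eta> v \<bullet> v \<le> (second_moment + sqrt z) * (norm v)\<^sup>2"
      by (simp add: power2_eq_square mult.assoc)
  qed simp
  also have "\<dots> \<le> (q * real r) * ((second_moment + sqrt z) * (norm v)\<^sup>2)"
    using r(3) second_moment_nonneg z by (intro mult_right_mono) auto
  finally show ?thesis by (simp add: mult_ac)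
qed

end

lemma norm_kappahat_le:
  fixes Yg :: "nat \<Rightarrow> 'c \<Rightarrow> 'a::real_inner"
  assumes h: "h < m"
    and A: "\<And>v. (\<Sum>k=1..m - h. (Yg k \<eta> \<bullet> v)\<^sup>2) \<le> real (m - h) * A * (norm v)\<^sup>2" and A0: "0 \<le> A"
    and B: "B = (\<Sum>k=1..m - h. (norm (Yg (k + h) \<eta>))\<^sup>2) / real (m - h)"
  shows "norm (kappahat Yg m h \<eta> v) \<le> 2 * sqrt (A * B) * norm v"
proof -
  let ?r = "m - h"
  have r: "real ?r > 0" using h by simp
  have B0: "0 \<le> B" unfolding B by (simp add: sum_nonneg)
  have C: "\<bar>Chat Yg m h \<eta> v \<bullet> w\<bar> \<le> sqrt (A * B) * norm v * norm w" for v w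
  proof -
    have "(\<Sum>k=1..?r. (Yg (k + h) \<eta> \<bullet> v)\<^sup>2) \<le> (\<Sum>k=1..?r. (norm (Yg (k + h) \<eta>))\<^sup>2 * (norm v)\<^sup>2)"
      by (intro sum_mono) (metis Cauchy_Schwarz_ineq2 abs_le_square_iff abs_mult abs_norm_cancel power_mult_distrib)
    also have "\<dots> = real ?r * B * (norm v)\<^sup>2" using r by (simp add: B sum_distrib_right[symmetric])
    finally have vB: "(\<Sum>k=1..?r. (Yg (k + h) \<eta> \<bullet> v)\<^sup>2) \<le> real ?r * B * (norm v)\<^sup>2" .
    have "(\<Sum>k=1..?r. (Yg (k + h) \<eta> \<bullet> v) * (Yg k \<eta> \<bullet> w))\<^sup>2
        \<le> (\<Sum>k=1..?r. (Yg (k + h) \<eta> \<bullet> v)\<^sup>2) * (\<Sum>k=1..?r. (Yg k \<eta> \<bullet> w)\<^sup>2)"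
      by (rule Cauchy_Schwarz_ineq_sum)
    also have "\<dots> \<le> (real ?r * B * (norm v)\<^sup>2) * (real ?r * A * (norm w)\<^sup>2)"
      using r B0 by (intro mult_mono vB A) (auto intro!: sum_nonneg)
    also have "\<dots> = (real ?r * (sqrt (A * B) * norm v * norm w))\<^sup>2"
      using A0 B0 by (simp add: power_mult_distrib real_sqrt_mult power2_eq_square[of "real ?r"] mult_ac)
    finally have "\<bar>\<Sum>k=1..?r. (Yg (k + h) \<eta> \<bullet> v) * (Yg k \<eta> \<bullet> w)\<bar> \<le> \<bar>real ?r * (sqrt (A * B) * norm v * norm w)\<bar>"
      by (simp only: abs_le_square_iff)
    also have "\<dots> = real ?r * (sqrt (A * B) * norm v * norm w)" using A0 B0 by simp
    finally show ?thesis using r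
      by (simp add: Chat_inner abs_mult pos_divide_le_eq mult.commute)
  qed
  show ?thesis
  proof (rule norm_le_of_inner)
    fix w
    have "kappahat Yg m h \<eta> v \<bullet> w = Chat Yg m h \<eta> v \<bullet> w + Chat Yg m h \<eta> w \<bullet> v"
      unfolding kappahat_def inner_add_left Chat_adjoint[of _ _ _ _ w] by (simp add: inner_commute)
    then show "\<bar>kappahat Yg m h \<eta> v \<bullet> w\<bar> \<le> 2 * sqrt (A * B) * norm v * norm w"
      using C[of v w] C[of w v] by (simp add: mult_ac)
  qed (use A0 B0 in simp)
qed

lemma Chat_restrict: "Chat (\<lambda>k x. x k) m h (\<lambda>k\<in>{1..m}. Zg k \<zeta>) v = Chat Zg m h \<zeta> v"
  unfolding Chat_def by (intro arg_cong2[where f=scaleR] refl sum.cong) auto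

locale process_copy = stationary_process M Xg
  for M :: "'b measure" and Xg :: "nat \<Rightarrow> 'b \<Rightarrow> 'a::{real_inner,complete_space,second_countable_topology}" +
  fixes N :: "'c measure" and Yg :: "nat \<Rightarrow> 'c \<Rightarrow> 'a"
  assumes measurable_Y: "\<And>k. 1 \<le> k \<Longrightarrow> Yg k \<in> borel_measurable N"
    and law: "\<And>m. distr N (Pi\<^sub>M {1..m} (\<lambda>_. borel)) (\<lambda>\<eta>. \<lambda>k\<in>{1..m}. Yg k \<eta>)
                = distr M (Pi\<^sub>M {1..m} (\<lambda>_. borel)) (\<lambda>\<omega>. \<lambda>k\<in>{1..m}. Xg k \<omega>)"
begin

lemma nn_integral_law:
  assumes F: "F \<in> borel_measurable (Pi\<^sub>M {1..m} (\<lambda>_. borel))"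
  shows "(\<integral>\<^sup>+\<eta>. F (\<lambda>k\<in>{1..m}. Yg k \<eta>) \<partial>N) = (\<integral>\<^sup>+\<omega>. F (\<lambda>k\<in>{1..m}. Xg k \<omega>) \<partial>M)"
proof -
  have "(\<integral>\<^sup>+\<eta>. F (\<lambda>k\<in>{1..m}. Yg k \<eta>) \<partial>N) = (\<integral>\<^sup>+x. F x \<partial>distr N (Pi\<^sub>M {1..m} (\<lambda>_. borel)) (\<lambda>\<eta>. \<lambda>k\<in>{1..m}. Yg k \<eta>))"
    by (rule nn_integral_distr[symmetric, OF measurable_restrict]) (auto intro: measurable_Y F simp del: One_nat_def)
  also have "\<dots> = (\<integral>\<^sup>+\<omega>. F (\<lambda>k\<in>{1..m}. Xg k \<omega>) \<partial>M)"
    unfolding law by (rule nn_integral_distr[OF measurable_restrict]) (auto intro: measurable_X F simp del: One_nat_def)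
  finally show ?thesis .
qed

lemma nn_integral_norm_law:
  assumes "1 \<le> k"
  shows "(\<integral>\<^sup>+\<eta>. ennreal (norm (Yg k \<eta>) ^ q) \<partial>N) = (\<integral>\<^sup>+\<omega>. ennreal (norm (Xg k \<omega>) ^ q) \<partial>M)"
proof -
  have k: "k \<in> {1..k}" using assms by simp
  have [measurable]: "(\<lambda>x. x k) \<in> borel_measurable (Pi\<^sub>M {1..k} (\<lambda>_. borel :: 'a measure))"
    by (rule measurable_component_singleton[OF k])
  have "(\<lambda>x. ennreal (norm (x k) ^ q)) \<in> borel_measurable (Pi\<^sub>M {1..k} (\<lambda>_. borel :: 'a measure))"
    by measurable
  from nn_integral_law[OF this] show ?thesis using k by (simp del: atLeastAtMost_iff)
qed

lemma nn_integral_hs_law: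
  assumes h: "h < m"
  shows "(\<integral>\<^sup>+\<eta>. hs_norm_sq (\<lambda>v. Chat Yg m h \<eta> v - Cov M Xg h v) \<partial>N)
       = (\<integral>\<^sup>+\<omega>. hs_norm_sq (\<lambda>v. Chat Xg m h \<omega> v - Cov M Xg h v) \<partial>M)"
proof -
  let ?F = "\<lambda>x. hs_norm_sq (\<lambda>v. Chat (\<lambda>k x. x k) m h x v - Cov M Xg h v)"
  have "?F \<in> borel_measurable (Pi\<^sub>M {1..m} (\<lambda>_. borel))"
    by (intro measurable_hs_norm_sq borel_measurable_diff borel_measurable_const measurable_Chat
        measurable_component_singleton)
  from nn_integral_law[OF this] show ?thesis by (simp only: Chat_restrict)
qed

lemma integrable_norm_four:
  assumes "1 \<le> k" "integrable M (\<lambda>\<omega>. norm (Xg k \<omega>) ^ 4)"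
  shows "integrable N (\<lambda>\<eta>. norm (Yg k \<eta>) ^ 4)"
proof -
  have "(\<integral>\<^sup>+\<eta>. ennreal (norm (Yg k \<eta>) ^ 4) \<partial>N) < \<infinity>"
    unfolding nn_integral_norm_law[OF assms(1)] using assms(2) by (simp add: integrable_iff_bounded)
  then show ?thesis using measurable_Y[OF assms(1)] by (simp add: integrable_iff_bounded)
qed

lemma integrable_matrix_entry_sq:
  assumes N: "prob_space N"
    and four: "\<And>k. 1 \<le> k \<Longrightarrow> integrable M (\<lambda>\<omega>. norm (Xg k \<omega>) ^ 4)"
  shows "integrable N (\<lambda>\<eta>. (kappahat Yg m h \<eta> u \<bullet> v - a)\<^sup>2)"
proof -
  interpret prob_space N by fact
  define L where "L = {f :: 'c \<Rightarrow> real. f \<in> borel_measurable N \<and> integrable N (\<lambda>\<eta>. (f \<eta>)\<^sup>2)}"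
  have add: "(\<lambda>\<eta>. f \<eta> + g \<eta>) \<in> L" if "f \<in> L" "g \<in> L" for f g
  proof -
    have [measurable]: "f \<in> borel_measurable N" "g \<in> borel_measurable N" using that by (auto simp: L_def)
    have "integrable N (\<lambda>\<eta>. (f \<eta> + g \<eta>)\<^sup>2)"
    proof (rule Bochner_Integration.integrable_bound)
      show "integrable N (\<lambda>\<eta>. 2 * (f \<eta>)\<^sup>2 + 2 * (g \<eta>)\<^sup>2)" using that by (auto simp: L_def)
      show "AE \<eta> in N. norm ((f \<eta> + g \<eta>)\<^sup>2) \<le> norm (2 * (f \<eta>)\<^sup>2 + 2 * (g \<eta>)\<^sup>2)"
      proof (rule AE_I2)
        fix \<eta>
        have "(f \<eta> + g \<eta>)\<^sup>2 \<le> 2 * (f \<eta>)\<^sup>2 + 2 * (g \<eta>)\<^sup>2"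
          using sum_squares_bound[of "f \<eta>" "g \<eta>"] power2_sum[of "f \<eta>" "g \<eta>"] by linarith
        then show "norm ((f \<eta> + g \<eta>)\<^sup>2) \<le> norm (2 * (f \<eta>)\<^sup>2 + 2 * (g \<eta>)\<^sup>2)" by simp
      qed
    qed measurable
    then show ?thesis by (simp add: L_def)
  qed
  have const: "(\<lambda>_. c) \<in> L" for c by (simp add: L_def)
  have cmult: "(\<lambda>\<eta>. c * f \<eta>) \<in> L" if "f \<in> L" for c f
    using that by (auto simp: L_def power_mult_distrib)
  have sum: "(\<lambda>\<eta>. \<Sum>i\<in>I. f i \<eta>) \<in> L" if "\<And>i. i \<in> I \<Longrightarrow> f i \<in> L" for f and I :: "nat set"
    using that by (induction I rule: infinite_finite_induct) (auto intro: add const)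
  have prod: "(\<lambda>\<eta>. (Yg k \<eta> \<bullet> x) * (Yg l \<eta> \<bullet> y)) \<in> L" if k: "1 \<le> k" and l: "1 \<le> l" for k l x y
  proof -
    have [measurable]: "Yg k \<in> borel_measurable N" "Yg l \<in> borel_measurable N" using measurable_Y k l by auto
    have "integrable N (\<lambda>\<eta>. ((Yg k \<eta> \<bullet> x) * (Yg l \<eta> \<bullet> y))\<^sup>2)"
    proof (rule Bochner_Integration.integrable_bound)
      show "integrable N (\<lambda>\<eta>. (norm x * norm y)\<^sup>2 * (norm (Yg k \<eta>) ^ 4 + norm (Yg l \<eta>) ^ 4))"
        using integrable_norm_four[OF _ four] k l by simp
      show "AE \<eta> in N. norm (((Yg k \<eta> \<bullet> x) * (Yg l \<eta> \<bullet> y))\<^sup>2)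
          \<le> norm ((norm x * norm y)\<^sup>2 * (norm (Yg k \<eta>) ^ 4 + norm (Yg l \<eta>) ^ 4))"
      proof (rule AE_I2)
        fix \<eta>
        let ?a = "norm (Yg k \<eta>)" and ?b = "norm (Yg l \<eta>)"
        have "\<bar>(Yg k \<eta> \<bullet> x) * (Yg l \<eta> \<bullet> y)\<bar> \<le> (?a * norm x) * (?b * norm y)"
          unfolding abs_mult by (intro mult_mono Cauchy_Schwarz_ineq2) auto
        then have "((Yg k \<eta> \<bullet> x) * (Yg l \<eta> \<bullet> y))\<^sup>2 \<le> ((?a * norm x) * (?b * norm y))\<^sup>2"
          by (metis abs_ge_zero power2_abs power_mono)
        also have "\<dots> = (norm x * norm y)\<^sup>2 * (?a\<^sup>2 * ?b\<^sup>2)" by (simp add: power_mult_distrib mult_ac)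
        also have "\<dots> \<le> (norm x * norm y)\<^sup>2 * (?a ^ 4 + ?b ^ 4)"
        proof (rule mult_left_mono)
          have "2 * (?a\<^sup>2 * ?b\<^sup>2) \<le> ?a ^ 4 + ?b ^ 4"
            using sum_squares_bound[of "?a\<^sup>2" "?b\<^sup>2"] by (simp add: mult.assoc flip: power_mult)
          then show "?a\<^sup>2 * ?b\<^sup>2 \<le> ?a ^ 4 + ?b ^ 4" by (smt (verit) mult_nonneg_nonneg zero_le_power2)
        qed simp
        finally show "norm (((Yg k \<eta> \<bullet> x) * (Yg l \<eta> \<bullet> y))\<^sup>2)
            \<le> norm ((norm x * norm y)\<^sup>2 * (?a ^ 4 + ?b ^ 4))" by simp
      qed
    qed measurable
    then show ?thesis by (simp add: L_def)
  qed
  have "(\<lambda>\<eta>. (Chat Yg m h \<eta> u \<bullet> v + ChatRev Yg m h \<eta> u \<bullet> v) + - a) \<in> L"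
    unfolding Chat_inner ChatRev_inner by (intro add cmult sum prod const) auto
  then show ?thesis by (simp add: L_def kappahat_def inner_add_left)
qed

end

section \<open>Coefficient matrices\<close>

lemma power2_add_le: "(a + b)\<^sup>2 \<le> 2 * a\<^sup>2 + 2 * (b::real)\<^sup>2"
  using sum_squares_bound[of a b] power2_sum[of a b] by linarith

lemma double_sum_power2_add_le:
  fixes a b :: "nat \<Rightarrow> nat \<Rightarrow> real"
  shows "(\<Sum>i=1..d. \<Sum>j=1..d. (a i j + b i j)\<^sup>2)
    \<le> 2 * (\<Sum>i=1..d. \<Sum>j=1..d. (a i j)\<^sup>2) + 2 * (\<Sum>i=1..d. \<Sum>j=1..d. (b i j)\<^sup>2)"
proof -
  have "(\<Sum>i=1..d. \<Sum>j=1..d. (a i j + b i j)\<^sup>2) \<le> (\<Sum>i=1..d. \<Sum>j=1..d. 2 * (a i j)\<^sup>2 + 2 * (b i j)\<^sup>2)"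
    by (intro sum_mono power2_add_le)
  then show ?thesis by (simp add: sum.distrib sum_distrib_left)
qed

lemma double_sum_power2_diff_le:
  fixes a b :: "nat \<Rightarrow> nat \<Rightarrow> real"
  shows "(\<Sum>i=1..d. \<Sum>j=1..d. (a i j - b i j)\<^sup>2)
    \<le> 2 * (\<Sum>i=1..d. \<Sum>j=1..d. (a i j)\<^sup>2) + 2 * (\<Sum>i=1..d. \<Sum>j=1..d. (b i j)\<^sup>2)"
  using double_sum_power2_add_le[of a "\<lambda>i j. - b i j" d] by simp

lemma matrix_entries_sign:
  assumes "self_adjoint T" and "\<And>i. s i \<in> {-1, 1::real}"
  shows "(T (s i *\<^sub>R v i) \<bullet> s j *\<^sub>R v j)\<^sup>2 = (T (v i) \<bullet> v j)\<^sup>2"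
proof -
  have "(s i)\<^sup>2 = 1" for i using assms(2)[of i] by auto
  then show ?thesis by (simp add: self_adjoint_scaleR[OF assms(1)] power_mult_distrib)
qed

lemma signal_lower_bound:
  fixes D D' :: "'a::real_inner \<Rightarrow> 'a"
  assumes sa: "self_adjoint D" and b: "\<And>v. norm (D v) \<le> b * norm v"
    and close: "\<And>v. norm (D' v - D v) \<le> \<epsilon> * norm v"
    and u: "\<And>i j. i \<in> {1..d} \<Longrightarrow> j \<in> {1..d} \<Longrightarrow> u i \<bullet> u j = (if i = j then 1 else 0::real)"
    and w: "\<And>i j. i \<in> {1..d} \<Longrightarrow> j \<in> {1..d} \<Longrightarrow> w i \<bullet> w j = (if i = j then 1 else 0::real)"
  shows "(\<Sum>i=1..d. \<Sum>j=1..d. (D (w i) \<bullet> w j)\<^sup>2) \<le> 2 * (\<Sum>i=1..d. \<Sum>j=1..d. (D' (u i) \<bullet> u j)\<^sup>2)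
    + 4 * real d * \<epsilon>\<^sup>2 + 16 * b\<^sup>2 * (\<Sum>i=1..d. (norm (u i - w i))\<^sup>2)"
proof -
  have "(\<Sum>i=1..d. \<Sum>j=1..d. (D (w i) \<bullet> w j)\<^sup>2)
      \<le> 2 * (\<Sum>i=1..d. \<Sum>j=1..d. (D' (u i) \<bullet> u j)\<^sup>2)
        + 2 * (\<Sum>i=1..d. \<Sum>j=1..d. ((D' (u i) - D (u i)) \<bullet> u j + (D (u i) \<bullet> u j - D (w i) \<bullet> w j))\<^sup>2)"
    using double_sum_power2_diff_le[of "\<lambda>i j. D' (u i) \<bullet> u j"
      "\<lambda>i j. (D' (u i) - D (u i)) \<bullet> u j + (D (u i) \<bullet> u j - D (w i) \<bullet> w j)" d]
    by (simp add: inner_diff_left)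
  moreover have "(\<Sum>i=1..d. \<Sum>j=1..d. ((D' (u i) - D (u i)) \<bullet> u j + (D (u i) \<bullet> u j - D (w i) \<bullet> w j))\<^sup>2)
      \<le> 2 * (\<Sum>i=1..d. \<Sum>j=1..d. ((D' (u i) - D (u i)) \<bullet> u j)\<^sup>2)
        + 2 * (\<Sum>i=1..d. \<Sum>j=1..d. (D (u i) \<bullet> u j - D (w i) \<bullet> w j)\<^sup>2)"
    by (rule double_sum_power2_add_le)
  moreover have "(\<Sum>i=1..d. \<Sum>j=1..d. ((D' (u i) - D (u i)) \<bullet> u j)\<^sup>2) \<le> real d * \<epsilon>\<^sup>2"
    by (rule matrix_entries_le[of "\<lambda>v. D' v - D v", OF close u])
  moreover have "(\<Sum>i=1..d. \<Sum>j=1..d. (D (u i) \<bullet> u j - D (w i) \<bullet> w j)\<^sup>2)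
      \<le> 4 * b\<^sup>2 * (\<Sum>i=1..d. (norm (u i - w i))\<^sup>2)"
    by (rule matrix_entries_perturbation[OF sa b u w])
  ultimately show ?thesis by linarith
qed

lemma noise_upper_bound:
  fixes E T :: "'a::real_inner \<Rightarrow> 'a"
  assumes sa: "self_adjoint T" and b: "\<And>v. norm (T v) \<le> b * norm v"
    and E: "\<And>v. norm (E v) \<le> \<epsilon> * norm v"
    and u: "\<And>i j. i \<in> {1..d} \<Longrightarrow> j \<in> {1..d} \<Longrightarrow> u i \<bullet> u j = (if i = j then 1 else 0::real)"
    and w: "\<And>i j. i \<in> {1..d} \<Longrightarrow> j \<in> {1..d} \<Longrightarrow> w i \<bullet> w j = (if i = j then 1 else 0::real)"
  shows "(\<Sum>i=1..d. \<Sum>j=1..d. (E (u i) \<bullet> u j - T (u i) \<bullet> u j)\<^sup>2)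
    \<le> 2 * real d * \<epsilon>\<^sup>2 + 4 * (\<Sum>i=1..d. \<Sum>j=1..d. (T (w i) \<bullet> w j)\<^sup>2) + 16 * b\<^sup>2 * (\<Sum>i=1..d. (norm (u i - w i))\<^sup>2)"
proof -
  have "(\<Sum>i=1..d. \<Sum>j=1..d. (E (u i) \<bullet> u j - T (u i) \<bullet> u j)\<^sup>2)
      \<le> 2 * (\<Sum>i=1..d. \<Sum>j=1..d. (E (u i) \<bullet> u j)\<^sup>2) + 2 * (\<Sum>i=1..d. \<Sum>j=1..d. (T (u i) \<bullet> u j)\<^sup>2)"
    by (rule double_sum_power2_diff_le)
  moreover have "(\<Sum>i=1..d. \<Sum>j=1..d. (E (u i) \<bullet> u j)\<^sup>2) \<le> real d * \<epsilon>\<^sup>2"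
    by (rule matrix_entries_le[OF E u])
  moreover have "(\<Sum>i=1..d. \<Sum>j=1..d. (T (u i) \<bullet> u j)\<^sup>2) \<le> 2 * (\<Sum>i=1..d. \<Sum>j=1..d. (T (w i) \<bullet> w j)\<^sup>2)
      + 2 * (\<Sum>i=1..d. \<Sum>j=1..d. (T (u i) \<bullet> u j - T (w i) \<bullet> w j)\<^sup>2)"
    using double_sum_power2_add_le[of "\<lambda>i j. T (w i) \<bullet> w j" "\<lambda>i j. T (u i) \<bullet> u j - T (w i) \<bullet> w j" d] by simp
  moreover have "(\<Sum>i=1..d. \<Sum>j=1..d. (T (u i) \<bullet> u j - T (w i) \<bullet> w j)\<^sup>2)
      \<le> 4 * b\<^sup>2 * (\<Sum>i=1..d. (norm (u i - w i))\<^sup>2)"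
    by (rule matrix_entries_perturbation[OF sa b u w])
  ultimately show ?thesis by linarith
qed

lemma classif_stat_triangle:
  assumes W: "\<And>h. 0 \<le> W h"
    and le: "classif_stat P W dd nu K' Ky \<le> classif_stat P W dd nu K Ky"
  shows "(\<Sum>h=0..P. W h * (\<Sum>i=1..dd h. \<Sum>j=1..dd h. ((K h (nu h i) - K' h (nu h i)) \<bullet> nu h j)\<^sup>2))
    \<le> 4 * classif_stat P W dd nu K Ky"
proof -
  have "(\<Sum>h=0..P. W h * (\<Sum>i=1..dd h. \<Sum>j=1..dd h. ((K h (nu h i) - K' h (nu h i)) \<bullet> nu h j)\<^sup>2))
      \<le> (\<Sum>h=0..P. W h * (2 * (\<Sum>i=1..dd h. \<Sum>j=1..dd h. (K h (nu h i) \<bullet> nu h j - Ky h (nu h i) \<bullet> nu h j)\<^sup>2)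
        + 2 * (\<Sum>i=1..dd h. \<Sum>j=1..dd h. (K' h (nu h i) \<bullet> nu h j - Ky h (nu h i) \<bullet> nu h j)\<^sup>2)))"
    (is "_ \<le> ?r")
  proof (intro sum_mono mult_left_mono W)
    fix h
    show "(\<Sum>i=1..dd h. \<Sum>j=1..dd h. ((K h (nu h i) - K' h (nu h i)) \<bullet> nu h j)\<^sup>2)
      \<le> 2 * (\<Sum>i=1..dd h. \<Sum>j=1..dd h. (K h (nu h i) \<bullet> nu h j - Ky h (nu h i) \<bullet> nu h j)\<^sup>2)
        + 2 * (\<Sum>i=1..dd h. \<Sum>j=1..dd h. (K' h (nu h i) \<bullet> nu h j - Ky h (nu h i) \<bullet> nu h j)\<^sup>2)"
      using double_sum_power2_diff_le[of "\<lambda>i j. K h (nu h i) \<bullet> nu h j - Ky h (nu h i) \<bullet> nu h j"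
        "\<lambda>i j. K' h (nu h i) \<bullet> nu h j - Ky h (nu h i) \<bullet> nu h j" "dd h"] by (simp add: inner_diff_left)
  qed
  also have "?r = 2 * classif_stat P W dd nu K Ky + 2 * classif_stat P W dd nu K' Ky"
  proof -
    have "(\<Sum>h=0..P. W h * (2 * a h + 2 * b h)) = 2 * (\<Sum>h=0..P. W h * a h) + 2 * (\<Sum>h=0..P. W h * b h)" for a b
      unfolding sum_distrib_left sum.distrib[symmetric] by (intro sum.cong) (simp_all add: algebra_simps)
    then show ?thesis unfolding classif_stat_def .
  qed
  finally show ?thesis using le by simp
qed

lemma decreasing_from_1:
  fixes f :: "nat \<Rightarrow> real"
  assumes "\<And>j. 1 \<le> j \<Longrightarrow> f (j + 1) \<le> f j" "1 \<le> i" "i \<le> k"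
  shows "f k \<le> f i"
  using assms(3)
proof (induction rule: dec_induct)
  case (step n)
  then show ?case using assms(1)[of n] assms(2) by simp
qed simp

lemma square_eigenvalue_nonneg:
  assumes "self_adjoint D" "spectral_decomp (\<lambda>v. D (D v)) lam nu" "1 \<le> j"
  shows "0 \<le> lam j"
proof -
  have "lam j = D (D (nu j)) \<bullet> nu j"
    using spectral_inner_eigenvector[OF assms(2,3), of "nu j"] spectral_orthonormal[OF assms(2,3,3)] by simp
  also have "\<dots> = D (nu j) \<bullet> D (nu j)" by (rule self_adjointD[OF assms(1)])
  finally show ?thesis by simp
qed

lemma eigenbasis_perturbation:
  fixes T S :: "'a::real_inner \<Rightarrow> 'a"
  assumes sdT: "spectral_decomp T lamT nuT" and sdS: "spectral_decomp S lamS nuS"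
    and decT: "\<And>j. 1 \<le> j \<Longrightarrow> 0 \<le> lamT (j + 1) \<and> lamT (j + 1) \<le> lamT j"
    and nnS: "\<And>j. 1 \<le> j \<Longrightarrow> 0 \<le> lamS j"
    and gapS: "\<And>j. 1 \<le> j \<Longrightarrow> c * real j powr (- \<alpha>) \<le> lamS j - lamS (j + 1)"
    and c: "0 < c" and \<alpha>: "0 < \<alpha>"
    and close: "\<And>v. norm (T v - S v) \<le> b * norm v"
  shows "\<exists>s. (\<forall>i. s i \<in> {-1, 1::real}) \<and>
    (\<Sum>i=1..d. (norm (nuT i - s i *\<^sub>R nuS i))\<^sup>2) \<le> 8 * b\<^sup>2 / c\<^sup>2 * real d powr (2 * \<alpha> + 1)"
proof -
  have pos: "0 < c * real j powr (- \<alpha>)" if "1 \<le> j" for j using c that by simp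
  have decS: "lamS k \<le> lamS i" if "1 \<le> i" "i \<le> k" for i k
    by (rule decreasing_from_1[OF _ that]) (use gapS pos in \<open>smt (verit)\<close>)
  have decT': "lamT k \<le> lamT i" if "1 \<le> i" "i \<le> k" for i k
    by (rule decreasing_from_1[OF _ that]) (use decT in auto)
  have nnT: "0 \<le> lamT j" if "1 \<le> j" for j using decT[OF that] by linarith
  have ex: "\<exists>s\<in>{-1, 1::real}. (norm (nuT j - s *\<^sub>R nuS j))\<^sup>2 \<le> 8 * b\<^sup>2 / (c * real j powr (- \<alpha>))\<^sup>2" if j: "1 \<le> j" for j
  proof (rule eigenvector_perturbation[OF sdT sdS decT' decS nnT[OF j] nnS[OF j] j close _ pos[OF j]])
    show "c * real j powr - \<alpha> \<le> lamS j" using gapS[OF j] nnS[of "j + 1"] by simp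
    fix i :: nat assume i: "1 \<le> i" "i \<noteq> j"
    show "c * real j powr - \<alpha> \<le> \<bar>lamS i - lamS j\<bar>"
    proof (cases "i < j")
      case True
      have "c * real j powr - \<alpha> \<le> c * real (j - 1) powr - \<alpha>"
        using True i c \<alpha> by (intro mult_left_mono powr_mono2') auto
      also have "\<dots> \<le> lamS (j - 1) - lamS j" using gapS[of "j - 1"] True i by simp
      also have "\<dots> \<le> lamS i - lamS j" using decS[of i "j - 1"] True i by simp
      finally show ?thesis by simp
    next
      case False
      then have "lamS i \<le> lamS (j + 1)" using i by (intro decS) auto
      then show ?thesis using gapS[OF j] by simp
    qed
  qed
  then obtain s0 where s0: "\<And>j. 1 \<le> j \<Longrightarrow> s0 j \<in> {-1, 1::real}"
    "\<And>j. 1 \<le> j \<Longrightarrow> (norm (nuT j - s0 j *\<^sub>R nuS j))\<^sup>2 \<le> 8 * b\<^sup>2 / (c * real j powr (- \<alpha>))\<^sup>2" by metis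
  define s where "s j = (if 1 \<le> j then s0 j else 1)" for j
  have "(\<Sum>i=1..d. (norm (nuT i - s i *\<^sub>R nuS i))\<^sup>2) \<le> (\<Sum>i=1..d. 8 * b\<^sup>2 / c\<^sup>2 * real d powr (2 * \<alpha>))"
  proof (rule sum_mono)
    fix i assume i: "i \<in> {1..d}"
    have "(norm (nuT i - s i *\<^sub>R nuS i))\<^sup>2 \<le> 8 * b\<^sup>2 / (c * real i powr (- \<alpha>))\<^sup>2"
      using s0(2)[of i] i by (simp add: s_def)
    also have "(real i powr (- \<alpha>))\<^sup>2 = real i powr (- (2 * \<alpha>))"
      using i by (simp add: powr_power mult.commute)
    then have "8 * b\<^sup>2 / (c * real i powr (- \<alpha>))\<^sup>2 = 8 * b\<^sup>2 / c\<^sup>2 * real i powr (2 * \<alpha>)"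
      using i by (simp add: power_mult_distrib powr_minus field_simps)
    also have "\<dots> \<le> 8 * b\<^sup>2 / c\<^sup>2 * real d powr (2 * \<alpha>)"
      using i \<alpha> by (intro mult_left_mono powr_mono2) auto
    finally show "(norm (nuT i - s i *\<^sub>R nuS i))\<^sup>2 \<le> 8 * b\<^sup>2 / c\<^sup>2 * real d powr (2 * \<alpha>)" .
  qed
  also have "\<dots> = 8 * b\<^sup>2 / c\<^sup>2 * real d powr (2 * \<alpha> + 1)" by (simp add: powr_add)
  finally show ?thesis using s0(1) by (intro exI[of _ s]) (auto simp: s_def)
qed

lemma norm_square_diff_le:
  fixes D D' :: "'a::real_inner \<Rightarrow> 'a"
  assumes sa: "self_adjoint D" and b: "\<And>v. norm (D v) \<le> b * norm v"
    and close: "\<And>v. norm (D' v - D v) \<le> \<epsilon> * norm v" and nn: "0 \<le> b" "0 \<le> \<epsilon>"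
  shows "norm (D' (D' v) - D (D v)) \<le> (2 * b * \<epsilon> + \<epsilon>\<^sup>2) * norm v"
proof -
  have D': "norm (D' v) \<le> (b + \<epsilon>) * norm v"
    using norm_triangle_ineq[of "D v" "D' v - D v"] b[of v] close[of v] by (simp add: algebra_simps)
  have "D' (D' v) - D (D v) = (D' (D' v) - D (D' v)) + D (D' v - D v)"
    by (simp add: self_adjoint_diff[OF sa])
  then have "norm (D' (D' v) - D (D v)) \<le> norm (D' (D' v) - D (D' v)) + norm (D (D' v - D v))"
    by (metis norm_triangle_ineq)
  also have "\<dots> \<le> \<epsilon> * norm (D' v) + b * norm (D' v - D v)" by (intro add_mono close b)
  also have "\<dots> \<le> \<epsilon> * ((b + \<epsilon>) * norm v) + b * (\<epsilon> * norm v)"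
    using nn by (intro add_mono mult_left_mono D' close) auto
  finally show ?thesis by (simp add: algebra_simps power2_eq_square)
qed

lemma Rop_square: "Rop M X h = (\<lambda>v. (\<lambda>u. kappa M (X 0) h u - kappa M (X 1) h u) ((\<lambda>u. kappa M (X 0) h u - kappa M (X 1) h u) v))"
  by (simp add: Rop_def Let_def fun_eq_iff)

lemma Rhat_square: "Rhat X ns n h \<omega> = (\<lambda>v. (\<lambda>u. kappahat (X 0) (ns 0 n) h \<omega> u - kappahat (X 1) (ns 1 n) h \<omega> u)
    ((\<lambda>u. kappahat (X 0) (ns 0 n) h \<omega> u - kappahat (X 1) (ns 1 n) h \<omega> u) v))"
  by (simp add: Rhat_def Let_def fun_eq_iff)

lemma lag_perturbation:
  fixes X :: "nat \<Rightarrow> nat \<Rightarrow> 'b \<Rightarrow> 'a::{real_inner,complete_space,second_countable_topology}"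
  assumes stat: "weakly_stationary_zm M (X 0)" "weakly_stationary_zm M (X 1)"
    and sigma: "\<sigma> = stationary_process.second_moment M (X 0) + stationary_process.second_moment M (X 1)"
    and hs: "\<And>g. g \<in> {0,1} \<Longrightarrow> hs_norm_sq (\<lambda>v. Chat (X g) (ns g n) h \<omega> v - Cov M (X g) h v) \<le> ennreal (z g)"
    and z0: "\<And>g. g \<in> {0,1} \<Longrightarrow> 0 \<le> z g" and zz: "zz = z 0 + z 1"
    and sd: "spectral_decomp (Rop M X h) lam nu"
    and gap: "\<And>j. 1 \<le> j \<Longrightarrow> c * real j powr (- \<alpha>) \<le> lam j - lam (j + 1)"
    and c: "0 < c" and \<alpha>: "0 < \<alpha>"
    and sdh: "spectral_decomp (Rhat X ns n h \<omega>) lamhat nuhat"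
    and dech: "\<And>j. 1 \<le> j \<Longrightarrow> 0 \<le> lamhat (j + 1) \<and> lamhat (j + 1) \<le> lamhat j"
  obtains e where "0 \<le> e" "e \<le> 8 * (256 * \<sigma>\<^sup>2 + 128) / c\<^sup>2 * real d powr (2 * \<alpha> + 1) * (zz + zz\<^sup>2)"
    and "(\<Sum>j=1..d. lam j) \<le> 2 * (\<Sum>i=1..d. \<Sum>j=1..d.
        ((kappahat (X 0) (ns 0 n) h \<omega> (nuhat i) - kappahat (X 1) (ns 1 n) h \<omega> (nuhat i)) \<bullet> nuhat j)\<^sup>2)
      + 32 * real d * zz + 64 * \<sigma>\<^sup>2 * e"
    and "\<forall>g T b. g \<in> {0,1} \<longrightarrow> self_adjoint T \<longrightarrow> (\<forall>v. norm (T v) \<le> b * norm v) \<longrightarrow>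
      (\<Sum>i=1..d. \<Sum>j=1..d. ((kappahat (X g) (ns g n) h \<omega> (nuhat i) - kappa M (X g) h (nuhat i)) \<bullet> nuhat j
          - T (nuhat i) \<bullet> nuhat j)\<^sup>2)
      \<le> 8 * real d * zz + 4 * (\<Sum>i=1..d. \<Sum>j=1..d. (T (nu i) \<bullet> nu j)\<^sup>2) + 16 * b\<^sup>2 * e"
proof -
  interpret X0: stationary_process M "X 0" by unfold_locales (rule stat)
  interpret X1: stationary_process M "X 1" by unfold_locales (rule stat)
  let ?D = "\<lambda>u. kappa M (X 0) h u - kappa M (X 1) h u"
  let ?D' = "\<lambda>u. kappahat (X 0) (ns 0 n) h \<omega> u - kappahat (X 1) (ns 1 n) h \<omega> u"
  have \<sigma>0: "0 \<le> \<sigma>" unfolding sigma using X0.second_moment_nonneg X1.second_moment_nonneg by simp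
  have zz0: "0 \<le> zz" unfolding zz using z0 by simp
  have saD: "self_adjoint ?D" by (intro self_adjoint_minus X0.self_adjoint_kappa X1.self_adjoint_kappa)
  have bD: "norm (?D v) \<le> 2 * \<sigma> * norm v" for v
    using norm_triangle_ineq4[of "kappa M (X 0) h v" "kappa M (X 1) h v"] X0.norm_kappa_le[of h v] X1.norm_kappa_le[of h v]
    by (simp add: sigma algebra_simps)
  have kd: "norm (kappahat (X g) (ns g n) h \<omega> v - kappa M (X g) h v) \<le> 2 * sqrt (z g) * norm v" if g: "g \<in> {0,1}" for g v
    using g X0.norm_kappahat_diff_le[OF hs[of 0] z0[of 0]] X1.norm_kappahat_diff_le[OF hs[of 1] z0[of 1]] by auto
  define \<epsilon> where "\<epsilon> = sqrt (8 * zz)"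
  have \<epsilon>0: "0 \<le> \<epsilon>" and \<epsilon>2: "\<epsilon>\<^sup>2 = 8 * zz" using zz0 by (auto simp: \<epsilon>_def)
  have close: "norm (?D' v - ?D v) \<le> \<epsilon> * norm v" for v
  proof -
    have "?D' v - ?D v = (kappahat (X 0) (ns 0 n) h \<omega> v - kappa M (X 0) h v) - (kappahat (X 1) (ns 1 n) h \<omega> v - kappa M (X 1) h v)"
      by simp
    then have "norm (?D' v - ?D v) \<le> 2 * sqrt (z 0) * norm v + 2 * sqrt (z 1) * norm v"
      using kd[of 0 v] kd[of 1 v] norm_triangle_ineq4 by (smt (verit) insertCI)
    also have "\<dots> = (2 * sqrt (z 0) + 2 * sqrt (z 1)) * norm v" by (simp add: algebra_simps)
    also have "2 * sqrt (z 0) + 2 * sqrt (z 1) \<le> \<epsilon>"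
    proof (rule power2_le_imp_le[OF _ \<epsilon>0])
      show "(2 * sqrt (z 0) + 2 * sqrt (z 1))\<^sup>2 \<le> \<epsilon>\<^sup>2"
        using power2_add_le[of "2 * sqrt (z 0)" "2 * sqrt (z 1)"] z0 by (simp add: \<epsilon>2 zz power_mult_distrib)
    qed
    finally show ?thesis by (simp add: mult_right_mono)
  qed
  have sd': "spectral_decomp (\<lambda>v. ?D (?D v)) lam nu" using sd unfolding Rop_square .
  have sdh': "spectral_decomp (\<lambda>v. ?D' (?D' v)) lamhat nuhat" using sdh unfolding Rhat_square .
  define b where "b = 2 * (2 * \<sigma>) * \<epsilon> + \<epsilon>\<^sup>2"
  have b2: "b\<^sup>2 \<le> (256 * \<sigma>\<^sup>2 + 128) * (zz + zz\<^sup>2)"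
  proof -
    have "b\<^sup>2 \<le> 2 * (2 * (2 * \<sigma>) * \<epsilon>)\<^sup>2 + 2 * (\<epsilon>\<^sup>2)\<^sup>2" unfolding b_def by (rule power2_add_le)
    also have "\<dots> = 256 * \<sigma>\<^sup>2 * zz + 128 * zz\<^sup>2" by (simp add: power_mult_distrib \<epsilon>2)
    also have "\<dots> \<le> (256 * \<sigma>\<^sup>2 + 128) * (zz + zz\<^sup>2)" using zz0 by (simp add: algebra_simps)
    finally show ?thesis .
  qed
  have nn: "0 \<le> lam j" if "1 \<le> j" for j by (rule square_eigenvalue_nonneg[OF saD sd' that])
  obtain s where s: "\<And>i. s i \<in> {-1, 1::real}"
    and es: "(\<Sum>i=1..d. (norm (nuhat i - s i *\<^sub>R nu i))\<^sup>2) \<le> 8 * b\<^sup>2 / c\<^sup>2 * real d powr (2 * \<alpha> + 1)"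
    using eigenbasis_perturbation[OF sdh' sd' dech nn gap c \<alpha>
        norm_square_diff_le[OF saD bD close _ \<epsilon>0, folded b_def], of d] \<sigma>0 by auto
  define w where "w i = s i *\<^sub>R nu i" for i
  define e where "e = (\<Sum>i=1..d. (norm (nuhat i - w i))\<^sup>2)"
  have ss: "s i * s i = 1" for i using s[of i] by auto
  have uo: "nuhat i \<bullet> nuhat j = (if i = j then 1 else 0)" if "i \<in> {1..d}" "j \<in> {1..d}" for i j
    using spectral_orthonormal[OF sdh, of i j] that by simp
  have wo: "w i \<bullet> w j = (if i = j then 1 else 0)" if "i \<in> {1..d}" "j \<in> {1..d}" for i j
    using spectral_orthonormal[OF sd, of i j] that ss[of j] by (simp add: w_def)
  have Mw: "(\<Sum>i=1..d. \<Sum>j=1..d. (T (w i) \<bullet> w j)\<^sup>2) = (\<Sum>i=1..d. \<Sum>j=1..d. (T (nu i) \<bullet> nu j)\<^sup>2)"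
    if "self_adjoint T" for T
    unfolding w_def by (intro sum.cong refl matrix_entries_sign[where v=nu, OF that s])
  have strict: "lam k < lam i" if "1 \<le> i" "i < k" for i k
  proof -
    have st: "lam (j + 1) < lam j" if j: "1 \<le> j" for j
    proof -
      have "0 < c * real j powr (- \<alpha>)" using c j by simp
      then show ?thesis using gap[OF j] by linarith
    qed
    have "lam k \<le> lam (i + 1)"
    proof (rule decreasing_from_1[where f=lam])
      show "lam (j + 1) \<le> lam j" if "1 \<le> j" for j using st[OF that] by simp
      show "1 \<le> i + 1" "i + 1 \<le> k" using \<open>i < k\<close> by auto
    qed
    then show ?thesis using st[OF that(1)] by simp
  qed
  have simple: "lam i \<noteq> lam j" if "1 \<le> i" "1 \<le> j" "i \<noteq> j" for i j
    using strict[of i j] strict[of j i] that by (metis less_irrefl linorder_neqE_nat)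
  show ?thesis
  proof (rule that[of e])
    show "0 \<le> e" by (simp add: e_def sum_nonneg)
    have "e \<le> 8 * b\<^sup>2 / c\<^sup>2 * real d powr (2 * \<alpha> + 1)" using es by (simp add: e_def w_def)
    also have "\<dots> \<le> 8 * ((256 * \<sigma>\<^sup>2 + 128) * (zz + zz\<^sup>2)) / c\<^sup>2 * real d powr (2 * \<alpha> + 1)"
      by (intro mult_right_mono divide_right_mono mult_left_mono b2) auto
    finally show "e \<le> 8 * (256 * \<sigma>\<^sup>2 + 128) / c\<^sup>2 * real d powr (2 * \<alpha> + 1) * (zz + zz\<^sup>2)"
      by (simp only: mult_ac times_divide_eq_left times_divide_eq_right)
    have "(\<Sum>j=1..d. lam j) = (\<Sum>i=1..d. \<Sum>j=1..d. (?D (w i) \<bullet> w j)\<^sup>2)"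
      unfolding Mw[OF saD] by (rule square_root_matrix_entries[OF saD sd' simple, symmetric])
    also have "\<dots> \<le> 2 * (\<Sum>i=1..d. \<Sum>j=1..d. (?D' (nuhat i) \<bullet> nuhat j)\<^sup>2) + 4 * real d * \<epsilon>\<^sup>2 + 16 * (2 * \<sigma>)\<^sup>2 * e"
      unfolding e_def by (rule signal_lower_bound[OF saD bD close uo wo])
    finally show "(\<Sum>j=1..d. lam j) \<le> 2 * (\<Sum>i=1..d. \<Sum>j=1..d. (?D' (nuhat i) \<bullet> nuhat j)\<^sup>2) + 32 * real d * zz + 64 * \<sigma>\<^sup>2 * e"
      by (simp add: \<epsilon>2 power_mult_distrib)
    have noise: "(\<Sum>i=1..d. \<Sum>j=1..d. ((kappahat (X g) (ns g n) h \<omega> (nuhat i) - kappa M (X g) h (nuhat i)) \<bullet> nuhat j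
          - T (nuhat i) \<bullet> nuhat j)\<^sup>2)
      \<le> 8 * real d * zz + 4 * (\<Sum>i=1..d. \<Sum>j=1..d. (T (nu i) \<bullet> nu j)\<^sup>2) + 16 * b\<^sup>2 * e"
      if g: "g \<in> {0,1}" and T: "self_adjoint T" "\<And>v. norm (T v) \<le> b * norm v" for g b and T :: "'a \<Rightarrow> 'a"
    proof -
      have "(\<Sum>i=1..d. \<Sum>j=1..d. ((kappahat (X g) (ns g n) h \<omega> (nuhat i) - kappa M (X g) h (nuhat i)) \<bullet> nuhat j
            - T (nuhat i) \<bullet> nuhat j)\<^sup>2)
        \<le> 2 * real d * (2 * sqrt (z g))\<^sup>2 + 4 * (\<Sum>i=1..d. \<Sum>j=1..d. (T (w i) \<bullet> w j)\<^sup>2) + 16 * b\<^sup>2 * e"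
        unfolding e_def by (rule noise_upper_bound[OF T kd[OF g] uo wo])
      moreover have "2 * real d * (2 * sqrt (z g))\<^sup>2 \<le> 8 * real d * zz"
      proof -
        have "z g \<le> zz" using g z0 by (auto simp: zz)
        then have "real d * z g \<le> real d * zz" by (intro mult_left_mono) auto
        then show ?thesis using z0[OF g] by (simp add: power_mult_distrib)
      qed
      ultimately show ?thesis unfolding Mw[OF T(1)] by linarith
    qed
    then show "\<forall>g T b. g \<in> {0,1} \<longrightarrow> self_adjoint T \<longrightarrow> (\<forall>v. norm (T v) \<le> b * norm v) \<longrightarrow>
      (\<Sum>i=1..d. \<Sum>j=1..d. ((kappahat (X g) (ns g n) h \<omega> (nuhat i) - kappa M (X g) h (nuhat i)) \<bullet> nuhat j
          - T (nuhat i) \<bullet> nuhat j)\<^sup>2)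
      \<le> 8 * real d * zz + 4 * (\<Sum>i=1..d. \<Sum>j=1..d. (T (nu i) \<bullet> nu j)\<^sup>2) + 16 * b\<^sup>2 * e"
      by blast
  qed
qed

context process_copy begin

lemma nn_integral_tail_mean:
  assumes h: "h < m"
  shows "(\<integral>\<^sup>+\<eta>. ennreal ((\<Sum>k=1..m - h. (norm (Yg (k + h) \<eta>))\<^sup>2) / real (m - h)) \<partial>N) = ennreal second_moment"
proof -
  have [measurable]: "Yg (k + h) \<in> borel_measurable N" if "k \<in> {1..m - h}" for k using that measurable_Y by auto
  have "(\<integral>\<^sup>+\<eta>. ennreal ((\<Sum>k=1..m - h. (norm (Yg (k + h) \<eta>))\<^sup>2) / real (m - h)) \<partial>N)
      = (\<integral>\<^sup>+\<eta>. ennreal (1 / real (m - h)) * (\<Sum>k=1..m - h. ennreal ((norm (Yg (k + h) \<eta>))\<^sup>2)) \<partial>N)"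
    by (intro nn_integral_cong) (simp add: ennreal_mult[symmetric] sum_nonneg)
  also have "\<dots> = ennreal (1 / real (m - h)) * (\<Sum>k=1..m - h. \<integral>\<^sup>+\<eta>. ennreal ((norm (Yg (k + h) \<eta>))\<^sup>2) \<partial>N)"
  proof -
    have [measurable]: "(\<lambda>\<eta>. \<Sum>k=1..m - h. ennreal ((norm (Yg (k + h) \<eta>))\<^sup>2)) \<in> borel_measurable N"
      by (intro borel_measurable_sum) measurable
    show ?thesis by (subst nn_integral_cmult, measurable) (subst nn_integral_sum, measurable)
  qed
  also have "\<dots> = ennreal (1 / real (m - h)) * (\<Sum>k=1..m - h. ennreal second_moment)"
    by (intro arg_cong2[where f="(*)"] refl sum.cong) (simp add: nn_integral_norm_law nn_second_moment)
  also have "\<dots> = ennreal (1 / real (m - h) * (real (m - h) * second_moment))"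
  proof -
    have "(\<Sum>k=1..m - h. ennreal second_moment) = ennreal (real (m - h) * second_moment)"
      using second_moment_nonneg by (subst sum_ennreal) auto
    then show ?thesis using second_moment_nonneg by (simp only: ennreal_mult[symmetric] mult_nonneg_nonneg of_nat_0_le_iff zero_le_divide_1_iff)
  qed
  finally show ?thesis using h by simp
qed

text \<open>Fourth moments need not be bounded uniformly in time, so the test operators have no uniform
  second moment at lags close to \<open>P\<close>. Instead, Cauchy--Schwarz splits such an operator into the
  initial block, dominated uniformly in its length by the dyadic variable \<open>Z\<close>, and the final block,
  which has bounded mean.\<close>

lemma test_operator_bound:
  assumes lower: "\<And>i. 2 ^ i \<le> m i" and upper: "\<And>i. m i \<le> q * 2 ^ i"
    and rate: "\<And>i. (\<integral>\<^sup>+\<omega>. hs_norm_sq (\<lambda>v. Chat Xg (m i) 0 \<omega> v - Cov M Xg 0 v) \<partial>M) \<le> ennreal (K / real (m i))"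
    and K: "0 \<le> K"
  obtains Z where "Z \<in> borel_measurable N" "(\<integral>\<^sup>+\<eta>. Z \<eta> \<partial>N) \<le> ennreal (2 * K)"
    and "\<And>\<eta> L h v. Z \<eta> \<le> ennreal L \<Longrightarrow> 0 \<le> L \<Longrightarrow> h \<le> P \<Longrightarrow>
      norm (kappahat Yg (P + 1) h \<eta> v - kappa M Xg h v)
        \<le> sqrt (8 * (2 * real q * (second_moment + 1 + L))
                 * ((\<Sum>k=1..P + 1 - h. (norm (Yg (k + h) \<eta>))\<^sup>2) / real (P + 1 - h)) + 8 * second_moment\<^sup>2) * norm v"
proof -
  define H where "H i \<eta> = hs_norm_sq (\<lambda>v. Chat Yg (m i) 0 \<eta> v - Cov M Xg 0 v)" for i \<eta>
  have Hm [measurable]: "H i \<in> borel_measurable N" for i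
    unfolding H_def[abs_def] by (intro measurable_hs_norm_sq borel_measurable_diff borel_measurable_const measurable_Chat measurable_Y) auto
  define Z where "Z \<eta> = (\<Sum>i\<le>P + 1. H i \<eta>)" for \<eta>
  show ?thesis
  proof (rule that[of Z])
    show "Z \<in> borel_measurable N" unfolding Z_def[abs_def] by measurable
    have Hi: "(\<integral>\<^sup>+\<eta>. H i \<eta> \<partial>N) \<le> ennreal (K * (1/2) ^ i)" for i
    proof -
      have m0: "0 < m i" using lower[of i] by (metis gr0I le_zero_eq power_not_zero zero_neq_numeral)
      have "(\<integral>\<^sup>+\<eta>. H i \<eta> \<partial>N) \<le> ennreal (K / real (m i))"
        unfolding H_def nn_integral_hs_law[OF m0] by (rule rate)
      also have "\<dots> \<le> ennreal (K / 2 ^ i)"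
      proof (intro ennreal_leI divide_left_mono K)
        show "2 ^ i \<le> real (m i)" using lower[of i] by (metis of_nat_le_iff of_nat_numeral of_nat_power)
      qed (use m0 in simp)
      finally show ?thesis by (simp add: power_one_over)
    qed
    have "(\<integral>\<^sup>+\<eta>. Z \<eta> \<partial>N) = (\<Sum>i\<le>P + 1. \<integral>\<^sup>+\<eta>. H i \<eta> \<partial>N)" unfolding Z_def by (rule nn_integral_sum) simp
    also have "\<dots> \<le> (\<Sum>i\<le>P + 1. ennreal (K * (1/2) ^ i))" by (intro sum_mono Hi)
    also have "\<dots> = ennreal (K * (\<Sum>i\<le>P + 1. (1/2) ^ i))" 
      using K by (subst sum_ennreal) (simp_all add: sum_distrib_left del: sum.atMost_Suc)
    also have "\<dots> \<le> ennreal (K * 2)"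
    proof (intro ennreal_leI mult_left_mono K)
      have "(\<Sum>i<Suc (P + 1). (1/2::real) ^ i) \<le> (\<Sum>i. (1/2) ^ i)" by (intro sum_le_suminf) auto
      then show "(\<Sum>i\<le>P + 1. (1/2::real) ^ i) \<le> 2" by (simp add: lessThan_Suc_atMost suminf_geometric)
    qed
    finally show "(\<integral>\<^sup>+\<eta>. Z \<eta> \<partial>N) \<le> ennreal (2 * K)" by (simp add: mult.commute)
    fix \<eta> L h v
    assume ZL: "Z \<eta> \<le> ennreal L" and L: "0 \<le> L" and h: "h \<le> P"
    let ?r = "P + 1 - h" and ?A = "2 * real q * (second_moment + 1 + L)"
    let ?B = "(\<Sum>k=1..P + 1 - h. (norm (Yg (k + h) \<eta>))\<^sup>2) / real (P + 1 - h)"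
    have A0: "0 \<le> ?A" using second_moment_nonneg L by simp
    have B0: "0 \<le> ?B" by (simp add: sum_nonneg)
    define i where "i = (LEAST i. ?r \<le> 2 ^ i)"
    have ri: "?r \<le> 2 ^ i" unfolding i_def by (rule LeastI[of "\<lambda>i. ?r \<le> 2 ^ i" ?r]) (simp add: less_imp_le)
    have iP: "i \<le> P + 1"
    proof -
      have "i \<le> ?r" unfolding i_def by (rule Least_le) (simp add: less_imp_le)
      then show ?thesis by simp
    qed
    have ir: "2 ^ i \<le> 2 * ?r"
    proof (cases i)
      case 0 then show ?thesis using h by simp
    next
      case (Suc k)
      then have "\<not> ?r \<le> 2 ^ k" using not_less_Least[of k "\<lambda>i. ?r \<le> 2 ^ i"] unfolding i_def by simp
      then show ?thesis using Suc by simp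
    qed
    have "real (m i) \<le> real (q * (2 * ?r))" using upper[of i] ir by (meson le_trans mult_le_mono2 of_nat_mono)
    then have mi: "real (m i) \<le> (2 * real q) * real ?r" by (simp add: mult_ac)
    have "H i \<eta> \<le> Z \<eta>" unfolding Z_def using iP by (intro member_le_sum) auto
    then have HL: "hs_norm_sq (\<lambda>v. Chat Yg (m i) 0 \<eta> v - Cov M Xg 0 v) \<le> ennreal L"
      using ZL unfolding H_def by (rule order_trans)
    have form: "(\<Sum>k=1..?r. (Yg k \<eta> \<bullet> v)\<^sup>2) \<le> real ?r * ?A * (norm v)\<^sup>2" for v
    proof -
      have "sqrt L \<le> 1 + L"
      proof (rule real_le_lsqrt)
        show "L \<le> (1 + L)\<^sup>2" using L by (simp add: power2_eq_square algebra_simps)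
      qed (use L in auto)
      then have "real ?r * ((2 * real q) * (second_moment + sqrt L)) * (norm v)\<^sup>2 \<le> real ?r * ?A * (norm v)\<^sup>2"
        by (intro mult_right_mono mult_left_mono) auto
      moreover have "(\<Sum>k=1..?r. (Yg k \<eta> \<bullet> v)\<^sup>2) \<le> real ?r * ((2 * real q) * (second_moment + sqrt L)) * (norm v)\<^sup>2"
        by (rule initial_form_le[OF HL L _ order_trans[OF ri lower] mi]) (use h in auto)
      ultimately show ?thesis by linarith
    qed
    have "norm (kappahat Yg (P + 1) h \<eta> v) \<le> 2 * sqrt (?A * ?B) * norm v"
      by (rule norm_kappahat_le[where m="P + 1" and h=h and Yg=Yg and \<eta>=\<eta> and A="?A", OF _ form A0 refl]) (use h in simp)
    then have "norm (kappahat Yg (P + 1) h \<eta> v - kappa M Xg h v) \<le> (2 * sqrt (?A * ?B) + 2 * second_moment) * norm v"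
      using norm_triangle_ineq4[of "kappahat Yg (P + 1) h \<eta> v" "kappa M Xg h v"] norm_kappa_le[of h v]
      by (simp add: distrib_right)
    also have "2 * sqrt (?A * ?B) + 2 * second_moment \<le> sqrt (8 * ?A * ?B + 8 * second_moment\<^sup>2)"
    proof (rule real_le_rsqrt)
      have "(sqrt (?A * ?B))\<^sup>2 = ?A * ?B" using mult_nonneg_nonneg[OF A0 B0] by (rule real_sqrt_pow2)
      then show "(2 * sqrt (?A * ?B) + 2 * second_moment)\<^sup>2 \<le> 8 * ?A * ?B + 8 * second_moment\<^sup>2"
        using power2_add_le[of "2 * sqrt (?A * ?B)" "2 * second_moment"]
        unfolding power_mult_distrib by simp
    qed
    finally show "norm (kappahat Yg (P + 1) h \<eta> v - kappa M Xg h v) \<le> sqrt (8 * ?A * ?B + 8 * second_moment\<^sup>2) * norm v"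
      by (simp add: mult_right_mono)
  qed
qed

end

section \<open>Consistency of the classifier\<close>

lemma (in prob_space) markov_bound:
  assumes [measurable]: "f \<in> borel_measurable M" and le: "(\<integral>\<^sup>+x. f x \<partial>M) \<le> ennreal b" and b: "0 \<le> b" and t: "0 < t"
  shows "prob {x \<in> space M. ennreal t \<le> f x} \<le> b / t"
proof -
  let ?A = "{x \<in> space M. ennreal t \<le> f x}"
  have "ennreal (t * prob ?A) = ennreal t * emeasure M ?A"
    using t by (simp add: emeasure_eq_measure ennreal_mult)
  also have "\<dots> = (\<integral>\<^sup>+x. ennreal t * indicator ?A x \<partial>M)" by (simp add: nn_integral_cmult_indicator)
  also have "\<dots> \<le> (\<integral>\<^sup>+x. f x \<partial>M)" by (intro nn_integral_mono) (auto simp: indicator_def)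
  also note le
  finally have "t * prob ?A \<le> b" using b by simp
  then show ?thesis using t by (simp add: field_simps)
qed

locale lagged_classifier =
  fixes M :: "'b measure" and N :: "'c measure"
    and X :: "nat \<Rightarrow> nat \<Rightarrow> 'b \<Rightarrow> 'a::{real_inner,complete_space,second_countable_topology}"
    and Y :: "nat \<Rightarrow> nat \<Rightarrow> 'c \<Rightarrow> 'a"
    and ns :: "nat \<Rightarrow> nat \<Rightarrow> nat" and p :: "nat \<Rightarrow> nat" and d :: "nat \<Rightarrow> nat \<Rightarrow> nat"
    and W \<tau> \<alpha> :: "nat \<Rightarrow> real" and c \<eta> :: real
    and lam :: "nat \<Rightarrow> nat \<Rightarrow> real" and nu :: "nat \<Rightarrow> nat \<Rightarrow> 'a"
    and lamhat :: "nat \<Rightarrow> nat \<Rightarrow> 'b \<Rightarrow> nat \<Rightarrow> real" and nuhat :: "nat \<Rightarrow> nat \<Rightarrow> 'b \<Rightarrow> nat \<Rightarrow> 'a"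
  assumes probM: "prob_space M" and probN: "prob_space N"
    and stat: "\<forall>g\<in>{0,1}. weakly_stationary_zm M (X g)"
    and mom4: "\<forall>g\<in>{0,1}. \<forall>k\<ge>1. integrable M (\<lambda>\<omega>. (norm (X g k \<omega>)) ^ 4)"
    and Y_meas: "\<forall>g\<in>{0,1}. \<forall>k\<ge>1. Y g k \<in> borel_measurable N"
    and Y_law: "\<forall>g\<in>{0,1}. \<forall>m. distr N (Pi\<^sub>M {1..m} (\<lambda>_. borel)) (\<lambda>\<eta>. \<lambda>k\<in>{1..m}. Y g k \<eta>)
                              = distr M (Pi\<^sub>M {1..m} (\<lambda>_. borel)) (\<lambda>\<omega>. \<lambda>k\<in>{1..m}. X g k \<omega>)"
    and W_pos: "\<forall>h. W h > 0"
    and sizes: "\<forall>n. ns 0 n + ns 1 n = n"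
    and A1_c: "c > 0"
    and A1: "\<forall>n. \<forall>h\<le>p n. spectral_decomp (Rop M X h) (lam h) (nu h)
               \<and> (\<forall>j\<ge>1. lam h j > lam h (j + 1)) \<and> lam h summable_on {1..}
               \<and> \<alpha> h > 2 \<and> (\<forall>j\<ge>1. lam h j - lam h (j + 1) \<ge> c * real j powr (- \<alpha> h))"
    and A2_p: "(\<lambda>n. real (p n) / real n) \<longlonglongrightarrow> 0"
    and A2_tau: "\<forall>h. \<tau> h > 0"
    and A2_d: "\<forall>h n. d h n = nat \<lfloor>real n powr (1 / \<tau> h)\<rfloor>"
    and A2_sum1: "(\<lambda>n. \<Sum>h = 0..p n. W h * real n powr ((2 * \<alpha> h + 1) / \<tau> h - 1)) \<longlonglongrightarrow> 0"
    and A2_sum2: "(\<lambda>n. \<Sum>h = 0..p n. W h * real n powr (1 / \<tau> h - 1 / 2)) \<longlonglongrightarrow> 0"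
    and A3: "\<exists>K. \<forall>n h g q. g \<in> {0,1} \<longrightarrow> q \<in> {1,2} \<longrightarrow> h < ns g n \<longrightarrow>
               (\<integral>\<^sup>+\<omega>. (hs_norm_sq (\<lambda>v. Chat (X g) (ns g n) h \<omega> v - Cov M (X g) h v)) ^ q \<partial>M)
                 \<le> ennreal (K / real (ns g n - h) ^ q)"
    and A3_ratio: "(\<lambda>n. real (ns 0 n) / real (ns 1 n)) \<longlonglongrightarrow> \<eta>" and eta_pos: "\<eta> > 0"
    and nuhat_eig: "\<forall>n. \<forall>h\<le>p n. \<forall>\<omega>\<in>space M.
               spectral_decomp (Rhat X ns n h \<omega>) (lamhat n h \<omega>) (nuhat n h \<omega>)
               \<and> (\<forall>j\<ge>1. 0 \<le> lamhat n h \<omega> (j + 1) \<and> lamhat n h \<omega> (j + 1) \<le> lamhat n h \<omega> j)"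
    and ratio: "\<forall>g\<in>{0,1}. filterlim (\<lambda>n.
               (\<Sum>h = 0..p n. W h * (\<Sum>j = 1..d h n. lam h j)) /
               (\<Sum>h = 0..p n. W h * (\<Sum>i = 1..d h n. \<Sum>j = 1..d h n.
                    sigma_coef M X N Y (p n) g h (nu h) i j))) at_top sequentially"
begin

lemma stationary_group: "g \<in> {0,1} \<Longrightarrow> stationary_process M (X g)"
  using stat by unfold_locales auto

lemma copy_group: "g \<in> {0,1} \<Longrightarrow> process_copy M (X g) N (Y g)"
  by (intro process_copy.intro stationary_group process_copy_axioms.intro)
     (use Y_meas Y_law in blast)+

definition "cov_error g n h \<omega> = hs_norm_sq (\<lambda>v. Chat (X g) (ns g n) h \<omega> v - Cov M (X g) h v)"

lemma measurable_cov_error: "g \<in> {0,1} \<Longrightarrow> cov_error g n h \<in> borel_measurable M"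
  unfolding cov_error_def[abs_def]
  by (intro measurable_hs_norm_sq borel_measurable_diff borel_measurable_const measurable_Chat
      stationary_process.measurable_X[OF stationary_group]) auto

definition "training_error n \<omega> = (\<Sum>h = 0..p n. ennreal (W h) *
    (ennreal (real n powr (1 / \<tau> h)) * (cov_error 0 n h \<omega> + cov_error 1 n h \<omega>)
     + ennreal (real n powr ((2 * \<alpha> h + 1) / \<tau> h)) * ((cov_error 0 n h \<omega> + cov_error 1 n h \<omega>) + (cov_error 0 n h \<omega> + cov_error 1 n h \<omega>)\<^sup>2)))"

lemma measurable_training_error: "training_error n \<in> borel_measurable M"
proof -
  have [measurable]: "cov_error 0 n h \<in> borel_measurable M" "cov_error 1 n h \<in> borel_measurable M" for h
    using measurable_cov_error by auto
  show ?thesis unfolding training_error_def[abs_def] by measurable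
qed

lemma sample_sizes_linear: "\<exists>\<rho>>0. \<forall>\<^sub>F n in sequentially. \<forall>g\<in>{0,1}. \<rho> * real n \<le> real (ns g n)"
proof -
  define \<rho> where "\<rho> = min 1 \<eta> / (\<eta> + 2)"
  have "\<forall>\<^sub>F n in sequentially. \<eta> / 2 < real (ns 0 n) / real (ns 1 n)"
    by (rule order_tendstoD(1)[OF A3_ratio]) (use eta_pos in simp)
  moreover have "\<forall>\<^sub>F n in sequentially. real (ns 0 n) / real (ns 1 n) < \<eta> + 1"
    by (rule order_tendstoD(2)[OF A3_ratio]) simp
  ultimately have "\<forall>\<^sub>F n in sequentially. \<forall>g\<in>{0,1}. \<rho> * real n \<le> real (ns g n)"
  proof eventually_elim
    case (elim n)
    let ?a = "real (ns 0 n)" and ?b = "real (ns 1 n)"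
    have "?b \<noteq> 0"
    proof
      assume "?b = 0"
      then have "?a / ?b = 0" by (simp only: div_by_0)
      then show False using elim(1) eta_pos by linarith
    qed
    then have b: "?b > 0" by simp
    have ab: "\<eta> * ?b \<le> 2 * ?a" "?a \<le> (\<eta> + 1) * ?b" using elim b by (simp_all add: field_simps)
    have n: "real n = ?a + ?b" using sizes by (metis of_nat_add)
    have "min 1 \<eta> * real n \<le> 1 * (?a + ?b)" unfolding n by (intro mult_right_mono) auto
    also have "\<dots> \<le> (\<eta> + 2) * ?b" using ab by (simp add: algebra_simps)
    finally have 1: "\<rho> * real n \<le> ?b" using eta_pos by (simp add: \<rho>_def field_simps)
    have "min 1 \<eta> * real n \<le> \<eta> * (?a + ?b)" unfolding n by (intro mult_right_mono) auto
    also have "\<dots> \<le> (\<eta> + 2) * ?a" using ab by (simp add: algebra_simps)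
    finally have 2: "\<rho> * real n \<le> ?a" using eta_pos by (simp add: \<rho>_def field_simps)
    show ?case using 1 2 by auto
  qed
  moreover have "\<rho> > 0" using eta_pos by (simp add: \<rho>_def)
  ultimately show ?thesis by blast
qed

lemma rate_constant:
  obtains K where "0 \<le> K" and "\<And>n h g q. g \<in> {0,1} \<Longrightarrow> q \<in> {1,2} \<Longrightarrow> h < ns g n \<Longrightarrow>
    (\<integral>\<^sup>+\<omega>. (cov_error g n h \<omega>) ^ q \<partial>M) \<le> ennreal (K / real (ns g n - h) ^ q)"
proof -
  obtain K where K: "\<And>n h g q. g \<in> {0,1} \<Longrightarrow> q \<in> {1,2} \<Longrightarrow> h < ns g n \<Longrightarrow>
    (\<integral>\<^sup>+\<omega>. (cov_error g n h \<omega>) ^ q \<partial>M) \<le> ennreal (K / real (ns g n - h) ^ q)"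
    using A3 unfolding cov_error_def by blast
  show ?thesis
  proof (rule that[of "\<bar>K\<bar>"])
    fix n h g and q :: nat assume *: "g \<in> {0,1::nat}" "q \<in> {1,2}" "h < ns g n"
    show "(\<integral>\<^sup>+\<omega>. (cov_error g n h \<omega>) ^ q \<partial>M) \<le> ennreal (\<bar>K\<bar> / real (ns g n - h) ^ q)"
      by (rule order_trans[OF K[OF *]]) (intro ennreal_leI divide_right_mono, auto)
  qed simp
qed

lemma training_error_bound:
  "\<exists>b. b \<longlonglongrightarrow> 0 \<and> (\<forall>n. 0 \<le> b n) \<and> (\<forall>\<^sub>F n in sequentially. (\<integral>\<^sup>+\<omega>. training_error n \<omega> \<partial>M) \<le> ennreal (b n))"
proof -
  obtain K where K0: "0 \<le> K" and K: "\<And>n h g q. g \<in> {0,1} \<Longrightarrow> q \<in> {1,2} \<Longrightarrow> h < ns g n \<Longrightarrow>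
    (\<integral>\<^sup>+\<omega>. (cov_error g n h \<omega>) ^ q \<partial>M) \<le> ennreal (K / real (ns g n - h) ^ q)" by (rule rate_constant) blast
  obtain \<rho> where \<rho>: "\<rho> > 0" and ev: "\<forall>\<^sub>F n in sequentially. \<forall>g\<in>{0,1}. \<rho> * real n \<le> real (ns g n)"
    using sample_sizes_linear by blast
  define C where "C = 4 * K / \<rho> + 16 * K / \<rho>\<^sup>2"
  have C0: "0 \<le> C" using K0 \<rho> by (simp add: C_def)
  define b where "b n = C * (\<Sum>h = 0..p n. W h * real n powr (1 / \<tau> h - 1 / 2))
    + C * (\<Sum>h = 0..p n. W h * real n powr ((2 * \<alpha> h + 1) / \<tau> h - 1))" for n
  have Wn: "0 \<le> W h" for h using W_pos by (simp add: less_imp_le)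
  have "b \<longlonglongrightarrow> C * 0 + C * 0" unfolding b_def by (intro tendsto_intros A2_sum1 A2_sum2)
  then have "b \<longlonglongrightarrow> 0" by simp
  moreover have "\<forall>n. 0 \<le> b n"
    unfolding b_def using C0 Wn by (auto intro!: add_nonneg_nonneg mult_nonneg_nonneg sum_nonneg)
  moreover have "\<forall>\<^sub>F n in sequentially. (\<integral>\<^sup>+\<omega>. training_error n \<omega> \<partial>M) \<le> ennreal (b n)"
  proof -
    have "\<forall>\<^sub>F n in sequentially. real (p n) / real n < \<rho> / 2"
      by (rule order_tendstoD(2)[OF A2_p]) (use \<rho> in simp)
    with ev eventually_ge_at_top[of 1] show ?thesis
    proof eventually_elim
      case (elim n)
      have n: "real n \<ge> 1" using elim by simp
      have pn: "real (p n) \<le> \<rho> / 2 * real n" using elim n by (simp add: field_simps)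
      have size: "h < ns g n" "\<rho> / 2 * real n \<le> real (ns g n - h)" if "g \<in> {0,1}" "h \<le> p n" for g h
      proof -
        have "real h \<le> \<rho> / 2 * real n" using that pn by (meson of_nat_mono order_trans)
        moreover have "\<rho> / 2 * real n + \<rho> / 2 * real n \<le> real (ns g n)" using elim that by auto
        moreover have "0 < \<rho> / 2 * real n" using \<rho> n by simp
        ultimately have "real h < real (ns g n)" "\<rho> / 2 * real n \<le> real (ns g n) - real h" by linarith+
        then show "h < ns g n" "\<rho> / 2 * real n \<le> real (ns g n - h)" by (simp_all add: of_nat_diff)
      qed
      have Hq: "(\<integral>\<^sup>+\<omega>. (cov_error g n h \<omega>) ^ q \<partial>M) \<le> ennreal (K / (\<rho> / 2 * real n) ^ q)"
        if "g \<in> {0,1}" "h \<le> p n" "q \<in> {1,2}" for g h and q :: nat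
      proof (rule order_trans[OF K[OF that(1,3) size(1)[OF that(1,2)]]])
        have "0 < \<rho> / 2 * real n" using \<rho> n by simp
        then show "ennreal (K / real (ns g n - h) ^ q) \<le> ennreal (K / (\<rho> / 2 * real n) ^ q)"
          using size[OF that(1,2)] K0 \<rho> n by (intro ennreal_leI divide_left_mono power_mono mult_pos_pos zero_less_power) auto
      qed
      define S where "S h \<omega> = cov_error 0 n h \<omega> + cov_error 1 n h \<omega>" for h \<omega>
      have [measurable]: "cov_error 0 n h \<in> borel_measurable M" "cov_error 1 n h \<in> borel_measurable M" for h
        using measurable_cov_error by auto
      have [measurable]: "S h \<in> borel_measurable M" for h unfolding S_def[abs_def] by measurable
      have S1: "(\<integral>\<^sup>+\<omega>. S h \<omega> \<partial>M) \<le> ennreal (4 * K / \<rho> / real n)" if h: "h \<le> p n" for h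
      proof -
        have "(\<integral>\<^sup>+\<omega>. S h \<omega> \<partial>M) = (\<integral>\<^sup>+\<omega>. cov_error 0 n h \<omega> ^ 1 \<partial>M) + (\<integral>\<^sup>+\<omega>. cov_error 1 n h \<omega> ^ 1 \<partial>M)"
          unfolding S_def by (simp add: nn_integral_add del: One_nat_def)
        also have "\<dots> \<le> ennreal (K / (\<rho> / 2 * real n) ^ 1) + ennreal (K / (\<rho> / 2 * real n) ^ 1)"
          by (intro add_mono Hq h) auto
        also have "\<dots> = ennreal (4 * K / \<rho> / real n)"
          using K0 \<rho> n by (simp add: ennreal_plus[symmetric] del: ennreal_plus)
        finally show ?thesis .
      qed
      have S2: "(\<integral>\<^sup>+\<omega>. (S h \<omega>)\<^sup>2 \<partial>M) \<le> ennreal (16 * K / \<rho>\<^sup>2 / real n)" if h: "h \<le> p n" for h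
      proof -
        have sq: "(x + y)\<^sup>2 \<le> 2 * x\<^sup>2 + 2 * y\<^sup>2" for x y :: ennreal
        proof (cases "x = \<top> \<or> y = \<top>")
          case False
          then obtain a b where "0 \<le> a" "x = ennreal a" "0 \<le> b" "y = ennreal b" by (metis ennreal_cases)
          then show ?thesis using power2_add_le[of a b]
            by (simp add: ennreal_power ennreal_mult[symmetric] ennreal_plus[symmetric] ennreal_numeral[symmetric]
                del: ennreal_plus ennreal_numeral)
        qed (auto simp: power2_eq_square ennreal_mult_top ennreal_top_mult)
        have "(\<integral>\<^sup>+\<omega>. (S h \<omega>)\<^sup>2 \<partial>M) \<le> (\<integral>\<^sup>+\<omega>. 2 * (cov_error 0 n h \<omega>)\<^sup>2 + 2 * (cov_error 1 n h \<omega>)\<^sup>2 \<partial>M)"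
          unfolding S_def by (intro nn_integral_mono sq)
        also have "\<dots> = 2 * (\<integral>\<^sup>+\<omega>. (cov_error 0 n h \<omega>)\<^sup>2 \<partial>M) + 2 * (\<integral>\<^sup>+\<omega>. (cov_error 1 n h \<omega>)\<^sup>2 \<partial>M)"
          by (simp add: nn_integral_add nn_integral_cmult del: One_nat_def)
        also have "\<dots> \<le> 2 * ennreal (K / (\<rho> / 2 * real n)\<^sup>2) + 2 * ennreal (K / (\<rho> / 2 * real n)\<^sup>2)"
          by (intro add_mono mult_left_mono Hq h) auto
        also have "\<dots> = ennreal (16 * K / \<rho>\<^sup>2 / (real n)\<^sup>2)"
        proof -
          have "2 * ennreal x + 2 * ennreal x = ennreal (4 * x)" if "0 \<le> x" for x
            using that by (simp add: ennreal_mult[symmetric] ennreal_plus[symmetric] ennreal_numeral[symmetric]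
                del: ennreal_plus ennreal_numeral)
          then show ?thesis using K0 by (simp add: power_mult_distrib power_divide)
        qed
        also have "\<dots> \<le> ennreal (16 * K / \<rho>\<^sup>2 / real n)"
          using n K0 by (intro ennreal_leI divide_left_mono) (auto simp: power2_eq_square)
        finally show ?thesis .
      qed
      have "(\<integral>\<^sup>+\<omega>. training_error n \<omega> \<partial>M) = (\<Sum>h = 0..p n. ennreal (W h) *
          (ennreal (real n powr (1 / \<tau> h)) * (\<integral>\<^sup>+\<omega>. S h \<omega> \<partial>M)
            + ennreal (real n powr ((2 * \<alpha> h + 1) / \<tau> h)) * ((\<integral>\<^sup>+\<omega>. S h \<omega> \<partial>M) + (\<integral>\<^sup>+\<omega>. (S h \<omega>)\<^sup>2 \<partial>M))))"
        unfolding training_error_def S_def[symmetric]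
        by (simp add: nn_integral_sum nn_integral_cmult nn_integral_add)
      also have "\<dots> \<le> (\<Sum>h = 0..p n. ennreal (C * (W h * real n powr (1 / \<tau> h - 1 / 2))
          + C * (W h * real n powr ((2 * \<alpha> h + 1) / \<tau> h - 1))))"
      proof (rule sum_mono)
        fix h assume "h \<in> {0..p n}"
        then have h: "h \<le> p n" by simp
        let ?x = "real n powr (1 / \<tau> h)" and ?y = "real n powr ((2 * \<alpha> h + 1) / \<tau> h)"
        let ?s = "4 * K / \<rho> / real n" and ?t = "16 * K / \<rho>\<^sup>2 / real n"
        have st: "0 \<le> ?s" "0 \<le> ?t" using K0 \<rho> by auto
        have "ennreal (W h) * (ennreal ?x * (\<integral>\<^sup>+\<omega>. S h \<omega> \<partial>M) + ennreal ?y * ((\<integral>\<^sup>+\<omega>. S h \<omega> \<partial>M) + (\<integral>\<^sup>+\<omega>. (S h \<omega>)\<^sup>2 \<partial>M)))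
            \<le> ennreal (W h) * (ennreal ?x * ennreal ?s + ennreal ?y * (ennreal ?s + ennreal ?t))"
          by (intro mult_left_mono add_mono S1 S2 h) auto
        also have "\<dots> = ennreal (W h * (?x * ?s + ?y * (?s + ?t)))"
        proof -
          have "ennreal w * (ennreal a * ennreal s + ennreal b * (ennreal s + ennreal t)) = ennreal (w * (a * s + b * (s + t)))"
            if "0 \<le> w" "0 \<le> a" "0 \<le> b" "0 \<le> s" "0 \<le> t" for w a b s t
            using that by (simp add: ennreal_mult[symmetric] ennreal_plus[symmetric] del: ennreal_plus)
          then show ?thesis using st Wn by (metis powr_ge_zero)
        qed
        also have "\<dots> \<le> ennreal (C * (W h * real n powr (1 / \<tau> h - 1 / 2)) + C * (W h * real n powr ((2 * \<alpha> h + 1) / \<tau> h - 1)))"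
        proof (rule ennreal_leI)
          have C_eq: "?s + ?t = C / real n" by (simp add: C_def add_divide_distrib)
          have sC: "?s \<le> C / real n" using st C_eq by linarith
          have "?x * ?s \<le> ?x * (C / real n)" by (intro mult_left_mono sC) simp
          also have "\<dots> = C * real n powr (1 / \<tau> h - 1)" using n by (simp add: powr_diff)
          also have "\<dots> \<le> C * real n powr (1 / \<tau> h - 1 / 2)" using n C0 by (intro mult_left_mono powr_mono) auto
          finally have 1: "?x * ?s \<le> C * real n powr (1 / \<tau> h - 1 / 2)" .
          have 2: "?y * (?s + ?t) = C * real n powr ((2 * \<alpha> h + 1) / \<tau> h - 1)"
            unfolding C_eq using n by (simp add: powr_diff)
          have "W h * (?x * ?s + ?y * (?s + ?t)) \<le> W h * (C * real n powr (1 / \<tau> h - 1 / 2) + C * real n powr ((2 * \<alpha> h + 1) / \<tau> h - 1))"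
            unfolding 2 using 1 by (intro mult_left_mono Wn) simp
          then show "W h * (?x * ?s + ?y * (?s + ?t))
              \<le> C * (W h * real n powr (1 / \<tau> h - 1 / 2)) + C * (W h * real n powr ((2 * \<alpha> h + 1) / \<tau> h - 1))"
            by (simp add: algebra_simps)
        qed
        finally show "ennreal (W h) * (ennreal ?x * (\<integral>\<^sup>+\<omega>. S h \<omega> \<partial>M) + ennreal ?y * ((\<integral>\<^sup>+\<omega>. S h \<omega> \<partial>M) + (\<integral>\<^sup>+\<omega>. (S h \<omega>)\<^sup>2 \<partial>M)))
          \<le> ennreal (C * (W h * real n powr (1 / \<tau> h - 1 / 2)) + C * (W h * real n powr ((2 * \<alpha> h + 1) / \<tau> h - 1)))" .
      qed
      also have "\<dots> = ennreal (b n)"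
        using C0 Wn by (subst sum_ennreal) (auto simp: b_def sum.distrib sum_distrib_left intro!: add_nonneg_nonneg mult_nonneg_nonneg)
      finally show ?case .
    qed
  qed
  ultimately show ?thesis by blast
qed

lemma training_error_tendsto:
  assumes \<delta>: "0 < \<delta>"
  shows "(\<lambda>n. measure M {\<omega> \<in> space M. ennreal \<delta> \<le> training_error n \<omega>}) \<longlonglongrightarrow> 0"
proof -
  interpret prob_space M by (rule probM)
  obtain b where b: "b \<longlonglongrightarrow> 0" "\<And>n. 0 \<le> b n"
    "\<forall>\<^sub>F n in sequentially. (\<integral>\<^sup>+\<omega>. training_error n \<omega> \<partial>M) \<le> ennreal (b n)"
    using training_error_bound by blast
  show ?thesis
  proof (rule tendsto_sandwich[where f="\<lambda>_. 0" and h="\<lambda>n. b n / \<delta>"])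
    show "\<forall>\<^sub>F n in sequentially. measure M {\<omega> \<in> space M. ennreal \<delta> \<le> training_error n \<omega>} \<le> b n / \<delta>"
      using b(3) by eventually_elim (rule markov_bound[OF measurable_training_error _ b(2) \<delta>])
    show "(\<lambda>n. b n / \<delta>) \<longlonglongrightarrow> 0" using tendsto_divide[OF b(1) tendsto_const[of \<delta>]] \<delta> by simp
  qed auto
qed

definition "total_moment = stationary_process.second_moment M (X 0) + stationary_process.second_moment M (X 1)"

definition "signal n = (\<Sum>h = 0..p n. W h * (\<Sum>j = 1..d h n. lam h j))"

definition "noise g n = (\<Sum>h = 0..p n. W h * (\<Sum>i = 1..d h n. \<Sum>j = 1..d h n.
    sigma_coef M X N Y (p n) g h (nu h) i j))"

definition "test_noise g n \<zeta> = (\<Sum>h = 0..p n. W h * (\<Sum>i = 1..d h n. \<Sum>j = 1..d h n.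
    (kappahat (Y g) (p n + 1) h \<zeta> (nu h i) \<bullet> nu h j - kappa M (X g) h (nu h i) \<bullet> nu h j)\<^sup>2))"

lemma W_nonneg: "0 \<le> W h"
  using W_pos by (simp add: less_imp_le)

lemma second_moment_le_total:
  assumes "g \<in> {0,1}" shows "stationary_process.second_moment M (X g) \<le> total_moment"
  using assms stationary_process.second_moment_nonneg[OF stationary_group[of 0]]
    stationary_process.second_moment_nonneg[OF stationary_group[of 1]]
  by (auto simp: total_moment_def)

lemma lam_pos: assumes h: "h \<le> p n" and j: "1 \<le> j" shows "0 < lam h j"
proof -
  interpret X0: stationary_process M "X 0" by (rule stationary_group) simp
  interpret X1: stationary_process M "X 1" by (rule stationary_group) simp
  have sd: "spectral_decomp (Rop M X h) (lam h) (nu h)" and dec: "lam h (j + 1) < lam h j" using A1 h j by auto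
  have "0 \<le> lam h (j + 1)"
    by (rule square_eigenvalue_nonneg[OF self_adjoint_minus[OF X0.self_adjoint_kappa X1.self_adjoint_kappa]
          sd[unfolded Rop_square]]) simp
  then show ?thesis using dec by simp
qed

lemma signal_ge:
  assumes n: "1 \<le> n" shows "W 0 * lam 0 1 \<le> signal n"
proof -
  have "1 \<le> real n powr (1 / \<tau> 0)" using n A2_tau by (intro ge_one_powr_ge_zero) (auto intro: less_imp_le)
  then have "1 \<le> d 0 n" unfolding A2_d[rule_format] by (simp add: le_nat_floor)
  have nn: "0 \<le> lam h j" if "h \<le> p n" "1 \<le> j" for h j using lam_pos[OF that] by simp
  have "lam 0 1 \<le> (\<Sum>j = 1..d 0 n. lam 0 j)"
    using \<open>1 \<le> d 0 n\<close> nn[of 0] by (intro member_le_sum) auto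
  then have "W 0 * lam 0 1 \<le> W 0 * (\<Sum>j = 1..d 0 n. lam 0 j)" by (intro mult_left_mono W_nonneg)
  also have "\<dots> \<le> signal n"
    unfolding signal_def
    by (rule member_le_sum[of 0 "{0..p n}" "\<lambda>h. W h * (\<Sum>j = 1..d h n. lam h j)"])
       (auto intro!: mult_nonneg_nonneg W_nonneg sum_nonneg nn)
  finally show ?thesis .
qed

lemma
  assumes g: "g \<in> {0,1}"
  shows measurable_test_noise: "test_noise g n \<in> borel_measurable N"
    and nn_integral_test_noise: "(\<integral>\<^sup>+\<zeta>. ennreal (test_noise g n \<zeta>) \<partial>N) = ennreal (noise g n)"
proof -
  interpret process_copy M "X g" N "Y g" by (rule copy_group[OF g])
  have int: "integrable N (\<lambda>\<zeta>. (kappahat (Y g) m h \<zeta> u \<bullet> v - a)\<^sup>2)" for m h u v a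
    by (rule integrable_matrix_entry_sq[OF probN]) (use mom4 g in auto)
  have intn: "integrable N (test_noise g n)"
    unfolding test_noise_def[abs_def] by (intro Bochner_Integration.integrable_sum integrable_mult_right int)
  then show "test_noise g n \<in> borel_measurable N" by simp
  have "(\<integral>\<zeta>. test_noise g n \<zeta> \<partial>N) = noise g n"
    unfolding test_noise_def noise_def sigma_coef_def
    by (simp add: int integral_sum)
  moreover have "0 \<le> test_noise g n \<zeta>" for \<zeta>
    unfolding test_noise_def by (intro sum_nonneg mult_nonneg_nonneg W_nonneg) auto
  ultimately show "(\<integral>\<^sup>+\<zeta>. ennreal (test_noise g n \<zeta>) \<partial>N) = ennreal (noise g n)"
    using intn by (simp add: nn_integral_eq_integral)
qed

lemma good_training:
  assumes small: "training_error n \<omega> < ennreal \<delta>" and n: "1 \<le> n"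
  obtains z where "\<And>g h. g \<in> {0,1} \<Longrightarrow> h \<le> p n \<Longrightarrow> cov_error g n h \<omega> \<le> ennreal (z g h)" "\<And>g h. 0 \<le> z g h"
    and "(\<Sum>h = 0..p n. W h * (real n powr (1 / \<tau> h) * (z 0 h + z 1 h)
        + real n powr ((2 * \<alpha> h + 1) / \<tau> h) * ((z 0 h + z 1 h) + (z 0 h + z 1 h)\<^sup>2))) \<le> \<delta>"
proof -
  define z where "z g h = enn2real (cov_error g n h \<omega>)" for g h
  define t where "t h = ennreal (W h) *
    (ennreal (real n powr (1 / \<tau> h)) * (cov_error 0 n h \<omega> + cov_error 1 n h \<omega>)
     + ennreal (real n powr ((2 * \<alpha> h + 1) / \<tau> h)) * ((cov_error 0 n h \<omega> + cov_error 1 n h \<omega>) + (cov_error 0 n h \<omega> + cov_error 1 n h \<omega>)\<^sup>2))" for h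
  have te: "training_error n \<omega> = (\<Sum>h = 0..p n. t h)" by (simp add: training_error_def t_def)
  have fin: "cov_error g n h \<omega> \<noteq> \<top>" if g: "g \<in> {0,1}" and h: "h \<le> p n" for g h
  proof
    assume "cov_error g n h \<omega> = \<top>"
    then have "cov_error 0 n h \<omega> + cov_error 1 n h \<omega> = \<top>" using g by auto
    then have "t h = \<top>" using W_pos[rule_format, of h] n by (auto simp: t_def ennreal_mult_eq_top_iff not_le)
    moreover have "t h \<le> (\<Sum>h = 0..p n. t h)" using h by (intro member_le_sum) auto
    ultimately have "(\<Sum>h = 0..p n. t h) = \<top>" by (metis top_unique)
    then show False using small unfolding te by (simp only: not_top_less)
  qed
  have zH: "cov_error g n h \<omega> = ennreal (z g h)" if "g \<in> {0,1}" "h \<le> p n" for g h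
    using fin[OF that] by (simp add: z_def less_top)
  have z0: "0 \<le> z g h" for g h by (simp add: z_def)
  show ?thesis
  proof (rule that[of z])
    have "t h = ennreal (W h * (real n powr (1 / \<tau> h) * (z 0 h + z 1 h)
        + real n powr ((2 * \<alpha> h + 1) / \<tau> h) * ((z 0 h + z 1 h) + (z 0 h + z 1 h)\<^sup>2)))" if "h \<le> p n" for h
      unfolding t_def using zH[OF _ that] z0 W_nonneg
      by (simp add: ennreal_mult[symmetric] ennreal_plus[symmetric] ennreal_power del: ennreal_plus)
    then have "training_error n \<omega> = (\<Sum>h = 0..p n. ennreal (W h * (real n powr (1 / \<tau> h) * (z 0 h + z 1 h)
        + real n powr ((2 * \<alpha> h + 1) / \<tau> h) * ((z 0 h + z 1 h) + (z 0 h + z 1 h)\<^sup>2))))"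
      unfolding te by (intro sum.cong) auto
    also have "\<dots> = ennreal (\<Sum>h = 0..p n. W h * (real n powr (1 / \<tau> h) * (z 0 h + z 1 h)
        + real n powr ((2 * \<alpha> h + 1) / \<tau> h) * ((z 0 h + z 1 h) + (z 0 h + z 1 h)\<^sup>2)))"
      by (intro sum_ennreal mult_nonneg_nonneg W_nonneg add_nonneg_nonneg z0) auto
    finally have "ennreal (\<Sum>h = 0..p n. W h * (real n powr (1 / \<tau> h) * (z 0 h + z 1 h)
        + real n powr ((2 * \<alpha> h + 1) / \<tau> h) * ((z 0 h + z 1 h) + (z 0 h + z 1 h)\<^sup>2))) < ennreal \<delta>"
      using small by (simp only:)
    then show "(\<Sum>h = 0..p n. W h * (real n powr (1 / \<tau> h) * (z 0 h + z 1 h)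
        + real n powr ((2 * \<alpha> h + 1) / \<tau> h) * ((z 0 h + z 1 h) + (z 0 h + z 1 h)\<^sup>2))) \<le> \<delta>"
      by (meson ennreal_leI linear not_le)
  qed (use zH z0 in auto)
qed

definition "basis_constant = 8 * (256 * total_moment\<^sup>2 + 128) / c\<^sup>2"

lemma misclass_event:
  assumes g: "g \<in> {0,1}" and n: "1 \<le> n" and \<omega>: "\<omega> \<in> space M"
    and small: "training_error n \<omega> < ennreal \<delta>"
  obtains e where "\<And>h. 0 \<le> e h" "(\<Sum>h = 0..p n. W h * e h) \<le> basis_constant * \<delta>"
    and "\<And>\<zeta> b. (\<And>h v. h \<le> p n \<Longrightarrow> norm (kappahat (Y g) (p n + 1) h \<zeta> v - kappa M (X g) h v) \<le> b h * norm v) \<Longrightarrow>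
      classif_stat (p n) W (\<lambda>h. d h n) (\<lambda>h. nuhat n h \<omega>) (\<lambda>h. kappahat (X (1 - g)) (ns (1 - g) n) h \<omega>)
          (\<lambda>h. kappahat (Y g) (p n + 1) h \<zeta>)
        \<le> classif_stat (p n) W (\<lambda>h. d h n) (\<lambda>h. nuhat n h \<omega>) (\<lambda>h. kappahat (X g) (ns g n) h \<omega>)
          (\<lambda>h. kappahat (Y g) (p n + 1) h \<zeta>) \<Longrightarrow>
      signal n \<le> 96 * \<delta> + 32 * test_noise g n \<zeta> + (\<Sum>h = 0..p n. W h * ((128 * (b h)\<^sup>2 + 64 * total_moment\<^sup>2) * e h))"
proof -
  interpret process_copy M "X g" N "Y g" by (rule copy_group[OF g])
  obtain z where zH: "\<And>g h. g \<in> {0,1} \<Longrightarrow> h \<le> p n \<Longrightarrow> cov_error g n h \<omega> \<le> ennreal (z g h)" and z0: "\<And>g h. 0 \<le> z g h"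
    and zs: "(\<Sum>h = 0..p n. W h * (real n powr (1 / \<tau> h) * (z 0 h + z 1 h)
        + real n powr ((2 * \<alpha> h + 1) / \<tau> h) * ((z 0 h + z 1 h) + (z 0 h + z 1 h)\<^sup>2))) \<le> \<delta>"
    using good_training[OF small n] by blast
  define zz where "zz h = z 0 h + z 1 h" for h
  have zz0: "0 \<le> zz h" for h using z0 by (simp add: zz_def)
  define u where "u h = nuhat n h \<omega>" for h
  define K where "K g h = kappahat (X g) (ns g n) h \<omega>" for g h
  have dle: "real (d h n) \<le> real n powr (1 / \<tau> h)" for h
    unfolding A2_d[rule_format] by (simp add: of_nat_nat)
  have dpow: "real (d h n) powr (2 * \<alpha> h + 1) \<le> real n powr ((2 * \<alpha> h + 1) / \<tau> h)" if "h \<le> p n" for h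
  proof -
    have "\<alpha> h > 2" using A1 that by blast
    then have "real (d h n) powr (2 * \<alpha> h + 1) \<le> (real n powr (1 / \<tau> h)) powr (2 * \<alpha> h + 1)"
      using dle[of h] by (intro powr_mono2) auto
    then show ?thesis by (simp add: powr_powr)
  qed
  have cC: "0 \<le> basis_constant" by (simp add: basis_constant_def)
  define good where "good h e \<longleftrightarrow> 0 \<le> e \<and> e \<le> basis_constant * real (d h n) powr (2 * \<alpha> h + 1) * (zz h + (zz h)\<^sup>2)
      \<and> (\<Sum>j=1..d h n. lam h j) \<le> 2 * (\<Sum>i=1..d h n. \<Sum>j=1..d h n. ((K 0 h (u h i) - K 1 h (u h i)) \<bullet> u h j)\<^sup>2)
          + 32 * real (d h n) * zz h + 64 * total_moment\<^sup>2 * e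
      \<and> (\<forall>g T b. g \<in> {0,1} \<longrightarrow> self_adjoint T \<longrightarrow> (\<forall>v. norm (T v) \<le> b * norm v) \<longrightarrow>
          (\<Sum>i=1..d h n. \<Sum>j=1..d h n. ((K g h (u h i) - kappa M (X g) h (u h i)) \<bullet> u h j - T (u h i) \<bullet> u h j)\<^sup>2)
          \<le> 8 * real (d h n) * zz h + 4 * (\<Sum>i=1..d h n. \<Sum>j=1..d h n. (T (nu h i) \<bullet> nu h j)\<^sup>2) + 16 * b\<^sup>2 * e)" for h e
  have ex: "\<exists>e. good h e"
    if h: "h \<le> p n" for h
  proof -
    have a1: "spectral_decomp (Rop M X h) (lam h) (nu h)" "\<alpha> h > 2"
      "\<And>j. 1 \<le> j \<Longrightarrow> c * real j powr (- \<alpha> h) \<le> lam h j - lam h (j + 1)" using A1 h by blast+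
    have ne: "spectral_decomp (Rhat X ns n h \<omega>) (lamhat n h \<omega>) (nuhat n h \<omega>)"
      "\<And>j. 1 \<le> j \<Longrightarrow> 0 \<le> lamhat n h \<omega> (j + 1) \<and> lamhat n h \<omega> (j + 1) \<le> lamhat n h \<omega> j"
      using nuhat_eig h \<omega> by blast+
    have st: "weakly_stationary_zm M (X 0)" "weakly_stationary_zm M (X 1)" and \<alpha>0: "0 < \<alpha> h"
      using stat a1(2) by auto
    have hs: "hs_norm_sq (\<lambda>v. Chat (X g) (ns g n) h \<omega> v - Cov M (X g) h v) \<le> ennreal (z g h)" if "g \<in> {0,1}" for g
      using zH[OF that h] by (simp add: cov_error_def)
    show ?thesis
      by (rule lag_perturbation[where d="d h n" and z="\<lambda>g. z g h" and zz="zz h",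
            OF st total_moment_def hs z0 zz_def a1(1,3) A1_c \<alpha>0 ne], assumption+,
          unfold good_def u_def K_def basis_constant_def, intro exI conjI)
  qed
  define e0 where "e0 h = (SOME e. good h e)" for h
  have good: "good h (e0 h)" if "h \<le> p n" for h unfolding e0_def by (rule someI_ex[OF ex[OF that]])
  have e0: "0 \<le> e0 h" "e0 h \<le> basis_constant * real (d h n) powr (2 * \<alpha> h + 1) * (zz h + (zz h)\<^sup>2)"
    "(\<Sum>j=1..d h n. lam h j) \<le> 2 * (\<Sum>i=1..d h n. \<Sum>j=1..d h n. ((K 0 h (u h i) - K 1 h (u h i)) \<bullet> u h j)\<^sup>2)
          + 32 * real (d h n) * zz h + 64 * total_moment\<^sup>2 * e0 h" if "h \<le> p n" for h
    using good[OF that] unfolding good_def by blast+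
  have e0_noise: "(\<Sum>i=1..d h n. \<Sum>j=1..d h n. ((K g h (u h i) - kappa M (X g) h (u h i)) \<bullet> u h j - T (u h i) \<bullet> u h j)\<^sup>2)
      \<le> 8 * real (d h n) * zz h + 4 * (\<Sum>i=1..d h n. \<Sum>j=1..d h n. (T (nu h i) \<bullet> nu h j)\<^sup>2) + 16 * b\<^sup>2 * e0 h"
    if "h \<le> p n" "self_adjoint T" "\<And>v. norm (T v) \<le> b * norm v" for h T b
    using good[OF that(1)] that(2,3) g unfolding good_def by blast
  define e where "e h = (if h \<le> p n then e0 h else 0)" for h
  have Wz: "(\<Sum>h = 0..p n. W h * (real (d h n) * zz h)) \<le> \<delta>"
  proof (rule order_trans[OF sum_mono zs], fold zz_def)
    fix h
    have "real (d h n) * zz h \<le> real n powr (1 / \<tau> h) * zz h" by (intro mult_right_mono dle zz0)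
    also have "\<dots> \<le> real n powr (1 / \<tau> h) * zz h + real n powr ((2 * \<alpha> h + 1) / \<tau> h) * (zz h + (zz h)\<^sup>2)"
      using zz0[of h] by simp
    finally show "W h * (real (d h n) * zz h) \<le> W h * (real n powr (1 / \<tau> h) * zz h + real n powr ((2 * \<alpha> h + 1) / \<tau> h) * (zz h + (zz h)\<^sup>2))"
      by (intro mult_left_mono W_nonneg)
  qed
  show ?thesis
  proof (rule that[of e])
    show "0 \<le> e h" for h using e0(1) by (simp add: e_def)
    have "(\<Sum>h = 0..p n. W h * e h) \<le> (\<Sum>h = 0..p n. basis_constant * (W h * (real n powr (1 / \<tau> h) * zz h
        + real n powr ((2 * \<alpha> h + 1) / \<tau> h) * (zz h + (zz h)\<^sup>2))))"
    proof (rule sum_mono)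
      fix h assume "h \<in> {0..p n}"
      then have h: "h \<le> p n" by simp
      have "e h \<le> basis_constant * real (d h n) powr (2 * \<alpha> h + 1) * (zz h + (zz h)\<^sup>2)" using e0(2)[OF h] h by (simp add: e_def)
      also have "\<dots> \<le> basis_constant * real n powr ((2 * \<alpha> h + 1) / \<tau> h) * (zz h + (zz h)\<^sup>2)"
        using zz0[of h] cC by (intro mult_right_mono mult_left_mono dpow h) auto
      also have "\<dots> \<le> basis_constant * (real n powr (1 / \<tau> h) * zz h + real n powr ((2 * \<alpha> h + 1) / \<tau> h) * (zz h + (zz h)\<^sup>2))"
        unfolding mult.assoc using zz0[of h] cC by (intro mult_left_mono) auto
      finally have "W h * e h \<le> W h * (basis_constant * (real n powr (1 / \<tau> h) * zz h + real n powr ((2 * \<alpha> h + 1) / \<tau> h) * (zz h + (zz h)\<^sup>2)))"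
        by (intro mult_left_mono W_nonneg)
      then show "W h * e h \<le> basis_constant * (W h * (real n powr (1 / \<tau> h) * zz h + real n powr ((2 * \<alpha> h + 1) / \<tau> h) * (zz h + (zz h)\<^sup>2)))"
        by (simp add: mult.left_commute)
    qed
    also have "\<dots> \<le> basis_constant * \<delta>"
      unfolding sum_distrib_left[symmetric] zz_def by (intro mult_left_mono zs cC)
    finally show "(\<Sum>h = 0..p n. W h * e h) \<le> basis_constant * \<delta>" .
    fix \<zeta> and b :: "nat \<Rightarrow> real"
    let ?T = "\<lambda>h v. kappahat (Y g) (p n + 1) h \<zeta> v - kappa M (X g) h v"
    assume b: "\<And>h v. h \<le> p n \<Longrightarrow> norm (?T h v) \<le> b h * norm v"
    let ?S = "\<lambda>g'. classif_stat (p n) W (\<lambda>h. d h n) (\<lambda>h. nuhat n h \<omega>) (\<lambda>h. kappahat (X g') (ns g' n) h \<omega>)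
          (\<lambda>h. kappahat (Y g) (p n + 1) h \<zeta>)"
    assume mis: "?S (1 - g) \<le> ?S g"
    define B where "B h = (\<Sum>i=1..d h n. \<Sum>j=1..d h n. ((K 0 h (u h i) - K 1 h (u h i)) \<bullet> u h j)\<^sup>2)" for h
    define Q where "Q h = (\<Sum>i=1..d h n. \<Sum>j=1..d h n. (?T h (nu h i) \<bullet> nu h j)\<^sup>2)" for h
    have B': "B h = (\<Sum>i=1..d h n. \<Sum>j=1..d h n. ((K g h (u h i) - K (1 - g) h (u h i)) \<bullet> u h j)\<^sup>2)" for h
      using g by (auto simp: B_def inner_diff_left power2_commute)
    have BS: "(\<Sum>h = 0..p n. W h * B h) \<le> 4 * ?S g"
      unfolding B' K_def u_def using classif_stat_triangle[OF W_nonneg mis] .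
    have saT: "self_adjoint (?T h)" for h by (intro self_adjoint_minus self_adjoint_kappahat self_adjoint_kappa)
    have "?S g = (\<Sum>h = 0..p n. W h * (\<Sum>i=1..d h n. \<Sum>j=1..d h n.
        ((K g h (u h i) - kappa M (X g) h (u h i)) \<bullet> u h j - ?T h (u h i) \<bullet> u h j)\<^sup>2))"
      by (simp add: classif_stat_def K_def u_def inner_diff_left)
    also have "\<dots> \<le> (\<Sum>h = 0..p n. W h * (8 * real (d h n) * zz h + 4 * Q h + 16 * (b h)\<^sup>2 * e h))"
    proof (intro sum_mono mult_left_mono W_nonneg)
      fix h assume "h \<in> {0..p n}"
      then have h: "h \<le> p n" by simp
      show "(\<Sum>i=1..d h n. \<Sum>j=1..d h n. ((K g h (u h i) - kappa M (X g) h (u h i)) \<bullet> u h j - ?T h (u h i) \<bullet> u h j)\<^sup>2)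
          \<le> 8 * real (d h n) * zz h + 4 * Q h + 16 * (b h)\<^sup>2 * e h"
        using e0_noise[OF h saT b[OF h]] h by (simp add: Q_def e_def)
    qed
    finally have Sg: "?S g \<le> (\<Sum>h = 0..p n. W h * (8 * real (d h n) * zz h + 4 * Q h + 16 * (b h)\<^sup>2 * e h))" .
    have "signal n \<le> (\<Sum>h = 0..p n. W h * (2 * B h + 32 * real (d h n) * zz h + 64 * total_moment\<^sup>2 * e h))"
      unfolding signal_def
    proof (intro sum_mono mult_left_mono W_nonneg)
      fix h assume "h \<in> {0..p n}"
      then have h: "h \<le> p n" by simp
      show "(\<Sum>j = 1..d h n. lam h j) \<le> 2 * B h + 32 * real (d h n) * zz h + 64 * total_moment\<^sup>2 * e h"
        using e0(3)[OF h] h by (simp add: B_def e_def)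
    qed
    also have "\<dots> = 2 * (\<Sum>h = 0..p n. W h * B h) + (\<Sum>h = 0..p n. W h * (32 * real (d h n) * zz h + 64 * total_moment\<^sup>2 * e h))"
      unfolding sum_distrib_left sum.distrib[symmetric] by (intro sum.cong) (auto simp: algebra_simps)
    also have "\<dots> \<le> 8 * (\<Sum>h = 0..p n. W h * (8 * real (d h n) * zz h + 4 * Q h + 16 * (b h)\<^sup>2 * e h))
        + (\<Sum>h = 0..p n. W h * (32 * real (d h n) * zz h + 64 * total_moment\<^sup>2 * e h))"
      using BS Sg by linarith
    also have "\<dots> = 96 * (\<Sum>h = 0..p n. W h * (real (d h n) * zz h)) + 32 * (\<Sum>h = 0..p n. W h * Q h)
        + (\<Sum>h = 0..p n. W h * ((128 * (b h)\<^sup>2 + 64 * total_moment\<^sup>2) * e h))"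
      unfolding sum_distrib_left sum.distrib[symmetric] by (intro sum.cong) (auto simp: algebra_simps)
    also have "(\<Sum>h = 0..p n. W h * Q h) = test_noise g n \<zeta>"
      by (simp add: test_noise_def Q_def inner_diff_left)
    finally show "signal n \<le> 96 * \<delta> + 32 * test_noise g n \<zeta> + (\<Sum>h = 0..p n. W h * ((128 * (b h)\<^sup>2 + 64 * total_moment\<^sup>2) * e h))"
      using Wz by linarith
  qed
qed

lemma dyadic_sample_sizes:
  assumes g: "g \<in> {0,1}"
  obtains m q K where "\<And>i. 2 ^ i \<le> m i" "\<And>i. m i \<le> q * 2 ^ i" "(1::nat) \<le> q" "0 \<le> K"
    "\<And>i. (\<integral>\<^sup>+\<omega>. hs_norm_sq (\<lambda>v. Chat (X g) (m i) 0 \<omega> v - Cov M (X g) 0 v) \<partial>M) \<le> ennreal (K / real (m i))"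
proof -
  obtain K where K0: "0 \<le> K" and K: "\<And>n h g q. g \<in> {0,1} \<Longrightarrow> q \<in> {1,2} \<Longrightarrow> h < ns g n \<Longrightarrow>
    (\<integral>\<^sup>+\<omega>. (cov_error g n h \<omega>) ^ q \<partial>M) \<le> ennreal (K / real (ns g n - h) ^ q)" by (rule rate_constant) blast
  obtain \<rho> n0 where \<rho>: "\<rho> > 0" and n0: "\<And>n. n \<ge> n0 \<Longrightarrow> \<rho> * real n \<le> real (ns g n)"
    using sample_sizes_linear g unfolding eventually_sequentially by blast
  define q where "q = max 1 (max n0 (nat \<lceil>1 / \<rho>\<rceil>))"
  define m where "m i = ns g (q * 2 ^ i)" for i
  have q: "1 \<le> q" "n0 \<le> q" by (auto simp: q_def)
  have "1 / \<rho> \<le> real q" unfolding q_def by linarith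
  then have q\<rho>: "1 \<le> \<rho> * real q" using \<rho> by (simp add: field_simps)
  have lower: "2 ^ i \<le> m i" for i
  proof -
    have "q * 1 \<le> q * 2 ^ i" by (intro mult_le_mono2) simp
    then have "n0 \<le> q * 2 ^ i" using q by linarith
    have "1 * (2::real) ^ i \<le> (\<rho> * real q) * 2 ^ i" by (intro mult_right_mono q\<rho>) simp
    also have "\<dots> = \<rho> * real (q * 2 ^ i)" by simp
    also have "\<dots> \<le> real (m i)" unfolding m_def by (rule n0) fact
    finally have "real (2 ^ i) \<le> real (m i)" by simp
    then show ?thesis by (simp only: of_nat_le_iff)
  qed
  show ?thesis
  proof (rule that[of m q K])
    show "2 ^ i \<le> m i" for i by (rule lower)
    show "m i \<le> q * 2 ^ i" for i
    proof -
      have "ns 0 (q * 2 ^ i) + ns 1 (q * 2 ^ i) = q * 2 ^ i" using sizes by blast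
      then show ?thesis using g unfolding m_def by auto
    qed
    show "(\<integral>\<^sup>+\<omega>. hs_norm_sq (\<lambda>v. Chat (X g) (m i) 0 \<omega> v - Cov M (X g) 0 v) \<partial>M) \<le> ennreal (K / real (m i))" for i
    proof -
      have "0 < (2::nat) ^ i" by simp
      then have "0 < m i" using lower[of i] by linarith
      then show ?thesis using K[of g 1 0 "q * 2 ^ i"] g unfolding cov_error_def m_def by simp
    qed
  qed (use q K0 in auto)
qed

lemma misclass_small:
  assumes g: "g \<in> {0,1}" and \<epsilon>: "0 < \<epsilon>"
  shows "\<exists>\<delta>>0. \<forall>\<^sub>F n in sequentially. \<forall>\<omega>\<in>space M. training_error n \<omega> < ennreal \<delta> \<longrightarrow>
    misclass X N Y ns p d W nuhat g n \<omega> \<le> \<epsilon>"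
proof -
  interpret process_copy M "X g" N "Y g" by (rule copy_group[OF g])
  interpret N: prob_space N by (rule probN)
  obtain m q K where mq: "\<And>i. 2 ^ i \<le> m i" "\<And>i. m i \<le> q * 2 ^ i" "(1::nat) \<le> q" and K: "0 \<le> K"
    and rate: "\<And>i. (\<integral>\<^sup>+\<omega>. hs_norm_sq (\<lambda>v. Chat (X g) (m i) 0 \<omega> v - Cov M (X g) 0 v) \<partial>M) \<le> ennreal (K / real (m i))"
    using dyadic_sample_sizes[OF g] by blast
  define L where "L = 8 * K / \<epsilon> + 1"
  have L: "0 < L" using K \<epsilon> by (simp add: L_def add_nonneg_pos)
  have KL: "2 * K / L \<le> \<epsilon> / 4"
  proof -
    have "\<epsilon> * L = 8 * K + \<epsilon>" using \<epsilon> by (simp add: L_def field_simps)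
    then show ?thesis using L \<epsilon> by (simp add: field_simps)
  qed
  define A where "A = 2 * real q * (second_moment + 1 + L)"
  have A: "0 < A" using mq(3) L second_moment_nonneg by (simp add: A_def add_nonneg_pos)
  define c0 where "c0 = W 0 * lam 0 1"
  have c0: "0 < c0" using W_pos lam_pos[of 0 0 1] by (simp add: c0_def)
  define t where "t = c0 / (4096 * A)"
  have t: "0 < t" using c0 A by (simp add: t_def)
  have C: "0 \<le> basis_constant" by (simp add: basis_constant_def)
  define C1 where "C1 = 96 + 1088 * total_moment\<^sup>2 * basis_constant"
  have C1: "0 \<le> C1" using C by (simp add: C1_def)
  define \<delta> where "\<delta> = min (c0 / (2 * (C1 + 1))) (\<epsilon> * t / (4 * (basis_constant * second_moment + 1)))"
  have Cs: "0 \<le> basis_constant * second_moment" using C second_moment_nonneg by simp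
  have \<delta>: "0 < \<delta>" using c0 C1 \<epsilon> t Cs by (simp add: \<delta>_def add_nonneg_pos)
  have \<delta>1: "C1 * \<delta> \<le> c0 / 2"
  proof -
    have "C1 * \<delta> \<le> (C1 + 1) * (c0 / (2 * (C1 + 1)))" using C1 \<delta> by (intro mult_mono) (auto simp: \<delta>_def)
    also have "\<dots> = c0 / 2" using C1 by (simp add: field_simps)
    finally show ?thesis .
  qed
  have \<delta>2: "basis_constant * second_moment * \<delta> / t \<le> \<epsilon> / 4"
  proof -
    have "basis_constant * second_moment * \<delta> \<le> (basis_constant * second_moment + 1) * (\<epsilon> * t / (4 * (basis_constant * second_moment + 1)))"
      using Cs \<delta> by (intro mult_mono) (auto simp: \<delta>_def)
    also have "\<dots> = \<epsilon> / 4 * t" using Cs by (simp add: field_simps)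
    finally show ?thesis using t by (simp add: pos_divide_le_eq)
  qed
  have "\<forall>\<^sub>F n in sequentially. 512 / \<epsilon> \<le> signal n / noise g n"
    using ratio g unfolding filterlim_at_top signal_def noise_def by blast
  with eventually_ge_at_top[of 1]
  have "\<forall>\<^sub>F n in sequentially. \<forall>\<omega>\<in>space M. training_error n \<omega> < ennreal \<delta> \<longrightarrow>
    misclass X N Y ns p d W nuhat g n \<omega> \<le> \<epsilon>"
  proof eventually_elim
    case (elim n)
    have sig: "c0 \<le> signal n" unfolding c0_def by (rule signal_ge) (use elim in simp)
    have sig0: "0 < signal n" using sig c0 by linarith
    have noise0: "0 \<le> noise g n"
      unfolding noise_def sigma_coef_def by (intro sum_nonneg mult_nonneg_nonneg W_nonneg integral_nonneg_AE) auto
    have noise: "noise g n / (signal n / 128) \<le> \<epsilon> / 4"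
    proof -
      have "0 < 512 / \<epsilon>" using \<epsilon> by simp
      then have "noise g n \<noteq> 0" using elim by auto
      then have "0 < noise g n" using noise0 by simp
      then have "512 * noise g n \<le> \<epsilon> * signal n" using elim \<epsilon> by (simp add: field_simps)
      then show ?thesis using sig0 by (simp add: field_simps)
    qed
    obtain Z where Zm: "Z \<in> borel_measurable N" and ZK: "(\<integral>\<^sup>+\<zeta>. Z \<zeta> \<partial>N) \<le> ennreal (2 * K)"
      and Zb: "\<And>\<zeta> L h v. Z \<zeta> \<le> ennreal L \<Longrightarrow> 0 \<le> L \<Longrightarrow> h \<le> p n \<Longrightarrow>
      norm (kappahat (Y g) (p n + 1) h \<zeta> v - kappa M (X g) h v)
        \<le> sqrt (8 * (2 * real q * (second_moment + 1 + L))
                 * ((\<Sum>k=1..p n + 1 - h. (norm (Y g (k + h) \<zeta>))\<^sup>2) / real (p n + 1 - h)) + 8 * second_moment\<^sup>2) * norm v"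
      using test_operator_bound[OF mq(1,2) rate K, of "p n"] by blast
    define B where "B h \<zeta> = (\<Sum>k=1..p n + 1 - h. (norm (Y g (k + h) \<zeta>))\<^sup>2) / real (p n + 1 - h)" for h \<zeta>
    have B0: "0 \<le> B h \<zeta>" for h \<zeta> by (simp add: B_def sum_nonneg)
    have Bm [measurable]: "B h \<in> borel_measurable N" for h
    proof -
      have [measurable]: "Y g (k + h) \<in> borel_measurable N" if "k \<in> {1..p n + 1 - h}" for k using that measurable_Y by auto
      show ?thesis unfolding B_def[abs_def] by (intro borel_measurable_divide borel_measurable_sum) measurable
    qed
    show ?case
    proof (intro ballI impI)
      fix \<omega> assume \<omega>: "\<omega> \<in> space M" and small: "training_error n \<omega> < ennreal \<delta>"
      have n1: "1 \<le> n" using elim by simp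
      obtain e where e0: "\<And>h. 0 \<le> e h" and eW: "(\<Sum>h = 0..p n. W h * e h) \<le> basis_constant * \<delta>"
        and ev: "\<And>\<zeta> b. (\<And>h v. h \<le> p n \<Longrightarrow> norm (kappahat (Y g) (p n + 1) h \<zeta> v - kappa M (X g) h v) \<le> b h * norm v) \<Longrightarrow>
          classif_stat (p n) W (\<lambda>h. d h n) (\<lambda>h. nuhat n h \<omega>) (\<lambda>h. kappahat (X (1 - g)) (ns (1 - g) n) h \<omega>)
              (\<lambda>h. kappahat (Y g) (p n + 1) h \<zeta>)
            \<le> classif_stat (p n) W (\<lambda>h. d h n) (\<lambda>h. nuhat n h \<omega>) (\<lambda>h. kappahat (X g) (ns g n) h \<omega>)
              (\<lambda>h. kappahat (Y g) (p n + 1) h \<zeta>) \<Longrightarrow>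
          signal n \<le> 96 * \<delta> + 32 * test_noise g n \<zeta> + (\<Sum>h = 0..p n. W h * ((128 * (b h)\<^sup>2 + 64 * total_moment\<^sup>2) * e h))"
        using misclass_event[OF g n1 \<omega> small] by blast
      define V where "V \<zeta> = (\<Sum>h = 0..p n. W h * e h * B h \<zeta>)" for \<zeta>
      have Vm [measurable]: "V \<in> borel_measurable N" unfolding V_def[abs_def] by measurable
      have [measurable]: "test_noise g n \<in> borel_measurable N" by (rule measurable_test_noise[OF g])
      note Zm [measurable]
      let ?E1 = "{\<zeta> \<in> space N. ennreal L \<le> Z \<zeta>}"
      let ?E2 = "{\<zeta> \<in> space N. ennreal (signal n / 128) \<le> ennreal (test_noise g n \<zeta>)}"
      let ?E3 = "{\<zeta> \<in> space N. ennreal t \<le> ennreal (V \<zeta>)}"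
      let ?S = "\<lambda>g' \<zeta>. classif_stat (p n) W (\<lambda>h. d h n) (\<lambda>h. nuhat n h \<omega>) (\<lambda>h. kappahat (X g') (ns g' n) h \<omega>)
          (\<lambda>h. kappahat (Y g) (p n + 1) h \<zeta>)"
      have V_int: "(\<integral>\<^sup>+\<zeta>. ennreal (V \<zeta>) \<partial>N) \<le> ennreal (basis_constant * second_moment * \<delta>)"
      proof -
        have "(\<integral>\<^sup>+\<zeta>. ennreal (V \<zeta>) \<partial>N) = (\<integral>\<^sup>+\<zeta>. (\<Sum>h = 0..p n. ennreal (W h * e h) * ennreal (B h \<zeta>)) \<partial>N)"
          unfolding V_def using W_nonneg e0 B0
          by (intro nn_integral_cong) (simp add: ennreal_mult[symmetric] sum_nonneg)
        also have "\<dots> = (\<Sum>h = 0..p n. ennreal (W h * e h) * (\<integral>\<^sup>+\<zeta>. ennreal (B h \<zeta>) \<partial>N))"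
          by (simp add: nn_integral_sum nn_integral_cmult)
        also have "\<dots> = (\<Sum>h = 0..p n. ennreal (W h * e h) * ennreal second_moment)"
          unfolding B_def by (intro sum.cong refl arg_cong2[where f="(*)"] nn_integral_tail_mean) auto
        also have "\<dots> = ennreal (\<Sum>h = 0..p n. W h * e h * second_moment)"
          using W_nonneg e0 second_moment_nonneg by (simp add: ennreal_mult[symmetric])
        also have "(\<Sum>h = 0..p n. W h * e h * second_moment) = (\<Sum>h = 0..p n. W h * e h) * second_moment"
          by (simp add: sum_distrib_right)
        also have "ennreal \<dots> \<le> ennreal (basis_constant * \<delta> * second_moment)"
          by (intro ennreal_leI mult_right_mono eW second_moment_nonneg)
        finally show ?thesis by (simp add: mult_ac)
      qed
      have sub: "{\<zeta> \<in> space N. ?S (1 - g) \<zeta> \<le> ?S g \<zeta>} \<subseteq> ?E1 \<union> ?E2 \<union> ?E3"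
      proof (intro subsetI)
        fix \<zeta> assume "\<zeta> \<in> {\<zeta> \<in> space N. ?S (1 - g) \<zeta> \<le> ?S g \<zeta>}"
        then have \<zeta>: "\<zeta> \<in> space N" and mis: "?S (1 - g) \<zeta> \<le> ?S g \<zeta>" by auto
        show "\<zeta> \<in> ?E1 \<union> ?E2 \<union> ?E3"
        proof (cases "ennreal L \<le> Z \<zeta>")
          case False
          then have "Z \<zeta> \<le> ennreal L" by simp
          from Zb[OF this less_imp_le[OF L], folded A_def B_def]
          have "signal n \<le> 96 * \<delta> + 32 * test_noise g n \<zeta>
              + (\<Sum>h = 0..p n. W h * ((128 * (sqrt (8 * A * B h \<zeta> + 8 * second_moment\<^sup>2))\<^sup>2 + 64 * total_moment\<^sup>2) * e h))"
            by (rule ev[OF _ mis])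
          also have "\<dots> \<le> 96 * \<delta> + 32 * test_noise g n \<zeta>
              + (1024 * A * V \<zeta> + 1088 * total_moment\<^sup>2 * (\<Sum>h = 0..p n. W h * e h))"
          proof (rule add_left_mono)
            have sm: "second_moment\<^sup>2 \<le> total_moment\<^sup>2"
              by (intro power_mono second_moment_le_total[OF g] second_moment_nonneg)
            have "(\<Sum>h = 0..p n. W h * ((128 * (sqrt (8 * A * B h \<zeta> + 8 * second_moment\<^sup>2))\<^sup>2 + 64 * total_moment\<^sup>2) * e h))
              \<le> (\<Sum>h = 0..p n. 1024 * A * (W h * e h * B h \<zeta>) + 1088 * total_moment\<^sup>2 * (W h * e h))"
            proof (rule sum_mono)
              fix h
              have "0 \<le> 8 * A * B h \<zeta> + 8 * second_moment\<^sup>2" using A B0 by simp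
              then have "W h * ((128 * (sqrt (8 * A * B h \<zeta> + 8 * second_moment\<^sup>2))\<^sup>2 + 64 * total_moment\<^sup>2) * e h)
                = W h * e h * (128 * (8 * A * B h \<zeta> + 8 * second_moment\<^sup>2) + 64 * total_moment\<^sup>2)"
                by (simp add: mult_ac)
              also have "\<dots> \<le> W h * e h * (1024 * A * B h \<zeta> + 1088 * total_moment\<^sup>2)"
                using sm W_nonneg e0 by (intro mult_left_mono) auto
              finally show "W h * ((128 * (sqrt (8 * A * B h \<zeta> + 8 * second_moment\<^sup>2))\<^sup>2 + 64 * total_moment\<^sup>2) * e h)
                \<le> 1024 * A * (W h * e h * B h \<zeta>) + 1088 * total_moment\<^sup>2 * (W h * e h)"
                by (simp add: algebra_simps)
            qed
            then show "(\<Sum>h = 0..p n. W h * ((128 * (sqrt (8 * A * B h \<zeta> + 8 * second_moment\<^sup>2))\<^sup>2 + 64 * total_moment\<^sup>2) * e h))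
              \<le> 1024 * A * V \<zeta> + 1088 * total_moment\<^sup>2 * (\<Sum>h = 0..p n. W h * e h)"
              by (simp add: V_def sum.distrib sum_distrib_left)
          qed
          also have "\<dots> \<le> 96 * \<delta> + 32 * test_noise g n \<zeta> + (1024 * A * V \<zeta> + 1088 * total_moment\<^sup>2 * (basis_constant * \<delta>))"
            by (intro add_left_mono mult_left_mono eW) simp
          also have "\<dots> = C1 * \<delta> + 32 * test_noise g n \<zeta> + 1024 * A * V \<zeta>" by (simp add: C1_def algebra_simps)
          finally have "signal n / 2 \<le> 32 * test_noise g n \<zeta> + 1024 * A * V \<zeta>" using \<delta>1 sig by linarith
          then have "signal n / 128 \<le> test_noise g n \<zeta> \<or> c0 / 4 \<le> 1024 * A * V \<zeta>" using sig by linarith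
          then show ?thesis
          proof
            assume "signal n / 128 \<le> test_noise g n \<zeta>"
            then show ?thesis using \<zeta> by (auto intro: ennreal_leI)
          next
            assume "c0 / 4 \<le> 1024 * A * V \<zeta>"
            then have "t \<le> V \<zeta>" using A by (simp add: t_def field_simps)
            then show ?thesis using \<zeta> by (auto intro: ennreal_leI)
          qed
        qed (use \<zeta> in auto)
      qed
      have "misclass X N Y ns p d W nuhat g n \<omega> \<le> measure N (?E1 \<union> ?E2 \<union> ?E3)"
        unfolding misclass_def Let_def
      proof (rule N.finite_measure_mono)
        show "?E1 \<union> ?E2 \<union> ?E3 \<in> sets N" by measurable
        show "{\<zeta> \<in> space N. if g = 0 then \<not> ?S 0 \<zeta> - ?S 1 \<zeta> < 0 else ?S 0 \<zeta> - ?S 1 \<zeta> < 0} \<subseteq> ?E1 \<union> ?E2 \<union> ?E3"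
          by (rule order_trans[OF _ sub]) (use g in auto)
      qed
      also have "\<dots> \<le> measure N ?E1 + measure N ?E2 + measure N ?E3"
      proof -
        have "measure N (?E1 \<union> ?E2 \<union> ?E3) \<le> measure N (?E1 \<union> ?E2) + measure N ?E3"
          by (rule measure_Un_le) measurable
        moreover have "measure N (?E1 \<union> ?E2) \<le> measure N ?E1 + measure N ?E2"
          by (rule measure_Un_le) measurable
        ultimately show ?thesis by linarith
      qed
      also have "\<dots> \<le> 2 * K / L + noise g n / (signal n / 128) + basis_constant * second_moment * \<delta> / t"
      proof (intro add_mono)
        show "measure N ?E1 \<le> 2 * K / L" by (rule N.markov_bound[OF Zm ZK _ L]) (use K in simp)
        show "measure N ?E2 \<le> noise g n / (signal n / 128)"
          by (rule N.markov_bound[OF _ _ noise0]) (use sig0 nn_integral_test_noise[OF g] in auto)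
        show "measure N ?E3 \<le> basis_constant * second_moment * \<delta> / t"
          by (rule N.markov_bound[OF _ V_int _ t]) (use Cs \<delta> in auto)
      qed
      also have "\<dots> \<le> \<epsilon>" using KL noise \<delta>2 \<epsilon> by linarith
      finally show "misclass X N Y ns p d W nuhat g n \<omega> \<le> \<epsilon>" .
    qed
  qed
  then show ?thesis using \<delta> by blast
qed

lemma misclass_tendsto:
  assumes g: "g \<in> {0,1}" and \<epsilon>: "0 < \<epsilon>"
  shows "(\<lambda>n. measure M {\<omega> \<in> space M. misclass X N Y ns p d W nuhat g n \<omega> > \<epsilon>}) \<longlonglongrightarrow> 0"
proof -
  interpret prob_space M by (rule probM)
  obtain \<delta> where \<delta>: "0 < \<delta>" and ev: "\<forall>\<^sub>F n in sequentially. \<forall>\<omega>\<in>space M. training_error n \<omega> < ennreal \<delta> \<longrightarrow>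
    misclass X N Y ns p d W nuhat g n \<omega> \<le> \<epsilon>"
    using misclass_small[OF g \<epsilon>] by blast
  show ?thesis
  proof (rule tendsto_sandwich[OF _ _ tendsto_const training_error_tendsto[OF \<delta>]])
    show "\<forall>\<^sub>F n in sequentially. measure M {\<omega> \<in> space M. misclass X N Y ns p d W nuhat g n \<omega> > \<epsilon>}
        \<le> measure M {\<omega> \<in> space M. ennreal \<delta> \<le> training_error n \<omega>}"
      using ev
    proof eventually_elim
      case (elim n)
      note measurable_training_error [measurable]
      show ?case
        by (rule finite_measure_mono) (use elim in \<open>force simp: not_less[symmetric]\<close>, measurable)
    qed
  qed auto
qed

end

theorem theorem2:
  fixes M :: "'b measure" and N :: "'c measure"
    and X :: "nat \<Rightarrow> nat \<Rightarrow> 'b \<Rightarrow> 'a::{real_inner,complete_space,second_countable_topology}"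
    and Y :: "nat \<Rightarrow> nat \<Rightarrow> 'c \<Rightarrow> 'a"
    and ns :: "nat \<Rightarrow> nat \<Rightarrow> nat" and p :: "nat \<Rightarrow> nat" and d :: "nat \<Rightarrow> nat \<Rightarrow> nat"
    and W \<tau> \<alpha> :: "nat \<Rightarrow> real" and c \<eta> :: real
    and lam :: "nat \<Rightarrow> nat \<Rightarrow> real" and nu :: "nat \<Rightarrow> nat \<Rightarrow> 'a"
    and lamhat :: "nat \<Rightarrow> nat \<Rightarrow> 'b \<Rightarrow> nat \<Rightarrow> real" and nuhat :: "nat \<Rightarrow> nat \<Rightarrow> 'b \<Rightarrow> nat \<Rightarrow> 'a"
  assumes probM: "prob_space M" and probN: "prob_space N"
    and stat: "\<forall>g\<in>{0,1}. weakly_stationary_zm M (X g)"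
    and mom4: "\<forall>g\<in>{0,1}. \<forall>k\<ge>1. integrable M (\<lambda>\<omega>. (norm (X g k \<omega>)) ^ 4)"
    and Y_meas: "\<forall>g\<in>{0,1}. \<forall>k\<ge>1. Y g k \<in> borel_measurable N"
    and Y_law: "\<forall>g\<in>{0,1}. \<forall>m. distr N (Pi\<^sub>M {1..m} (\<lambda>_. borel)) (\<lambda>\<eta>. \<lambda>k\<in>{1..m}. Y g k \<eta>)
                              = distr M (Pi\<^sub>M {1..m} (\<lambda>_. borel)) (\<lambda>\<omega>. \<lambda>k\<in>{1..m}. X g k \<omega>)"
    and R_nonzero: "\<exists>h. hs_norm_sq (Rop M X h) > 0"
    and W_pos: "\<forall>h. W h > 0"
    and sizes: "\<forall>n. ns 0 n + ns 1 n = n"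
    and A1_c: "c > 0"
    and A1: "\<forall>n. \<forall>h\<le>p n. spectral_decomp (Rop M X h) (lam h) (nu h)
               \<and> (\<forall>j\<ge>1. lam h j > lam h (j + 1)) \<and> lam h summable_on {1..}
               \<and> \<alpha> h > 2 \<and> (\<forall>j\<ge>1. lam h j - lam h (j + 1) \<ge> c * real j powr (- \<alpha> h))"
    and A2_p: "(\<lambda>n. real (p n) / real n) \<longlonglongrightarrow> 0"
    and A2_tau: "\<forall>h. \<tau> h > 0"
    and A2_d: "\<forall>h n. d h n = nat \<lfloor>real n powr (1 / \<tau> h)\<rfloor>"
    and A2_sum1: "(\<lambda>n. \<Sum>h = 0..p n. W h * real n powr ((2 * \<alpha> h + 1) / \<tau> h - 1)) \<longlonglongrightarrow> 0"
    and A2_sum2: "(\<lambda>n. \<Sum>h = 0..p n. W h * real n powr (1 / \<tau> h - 1 / 2)) \<longlonglongrightarrow> 0"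
    and A3: "\<exists>K. \<forall>n h g q. g \<in> {0,1} \<longrightarrow> q \<in> {1,2} \<longrightarrow> h < ns g n \<longrightarrow>
               (\<integral>\<^sup>+\<omega>. (hs_norm_sq (\<lambda>v. Chat (X g) (ns g n) h \<omega> v - Cov M (X g) h v)) ^ q \<partial>M)
                 \<le> ennreal (K / real (ns g n - h) ^ q)"
    and A3_ratio: "(\<lambda>n. real (ns 0 n) / real (ns 1 n)) \<longlonglongrightarrow> \<eta>" and eta_pos: "\<eta> > 0"
    and nuhat_eig: "\<forall>n. \<forall>h\<le>p n. \<forall>\<omega>\<in>space M.
               spectral_decomp (Rhat X ns n h \<omega>) (lamhat n h \<omega>) (nuhat n h \<omega>)
               \<and> (\<forall>j\<ge>1. 0 \<le> lamhat n h \<omega> (j + 1) \<and> lamhat n h \<omega> (j + 1) \<le> lamhat n h \<omega> j)"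
    and nuhat_meas: "\<forall>n h j. (\<lambda>\<omega>. nuhat n h \<omega> j) \<in> borel_measurable M"
    and ratio: "\<forall>g\<in>{0,1}. filterlim (\<lambda>n.
               (\<Sum>h = 0..p n. W h * (\<Sum>j = 1..d h n. lam h j)) /
               (\<Sum>h = 0..p n. W h * (\<Sum>i = 1..d h n. \<Sum>j = 1..d h n.
                    sigma_coef M X N Y (p n) g h (nu h) i j))) at_top sequentially"
  shows "\<forall>g\<in>{0,1}. \<forall>\<epsilon>>0.
           (\<lambda>n. measure M {\<omega> \<in> space M. misclass X N Y ns p d W nuhat g n \<omega> > \<epsilon>}) \<longlonglongrightarrow> 0"
proof -
  interpret lagged_classifier M N X Y ns p d W \<tau> \<alpha> c \<eta> lam nu lamhat nuhat
    by (rule lagged_classifier.intro) fact+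
  show ?thesis using misclass_tendsto by blast
qed

end
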